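(* Let $(G,\pi)$ be a connected and unimodular Poisson-Lie group with Lie algebra $\mathfrak g$, and let $\mu$ be a left invariant volume form on $G$. Then $d(i_\pi\mu)=0$ if and only if both of the following hold: (1) $(\mathfrak g^*,[\cdot,\cdot]^* )$ is a unimodular Lie algebra; (2) for any $u\in\mathfrak g$, $$\rho\big(i_{\xi(u)}\mu_e\big)=0,$$ where $\xi:\mathfrak g\to\mathfrak g\wedge\mathfrak g$ is the 1-cocycle associated to $\pi$ and $\rho=-d$ is the dual 1-cocycle extended as a differential to $\wedge^{\dim\mathfrak g-2}\mathfrak g^*$.
   Context: A Poisson-Lie group $(G,\pi)$ is a Lie group with a multiplicative Poisson tensor: $\pi(ab)=(L_a)_*\pi(b)+(R_b)_*\pi(a)$ for all $a,b\in G$. Put $\pi_\ell(g)=(L_{g^{-1}})_*\pi(g)\in\mathfrak g\wedge\mathfrak g$; the associated 1-cocycle is $\xi=d_e\pi_\ell:\mathfrak g\to\mathfrak g\wedge\mathfrak g$. The dual map of $\xi$ is a Lie bracket on $\mathfrak g^*$: $[\alpha,\beta]^*(u)=\langle\alpha\wedge\beta,\xi(u)\rangle$. The dual 1-cocycle $\rho:\mathfrak g^*\to\mathfrak g^*\wedge\mathfrak g^*$ is the dual of the Lie bracket of $\mathfrak g$, $\rho(\gamma)(u,v)=\gamma([u,v])$; thus $\rho=-d$ on left invariant 1-forms, and it is extended to $\wedge^\bullet\mathfrak g^*$ as a differential, i.e. as minus the exterior (Chevalley–Eilenberg) differential on left invariant forms, identified with $\wedge^\bullet\mathfrak g^*$.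 A Lie algebra is unimodular if $\operatorname{tr}\operatorname{ad}_x=0$ for all its elements $x$; a connected Lie group is unimodular iff its Lie algebra is. $i_Q$ denotes contraction with a bivector $Q$. *)

theory Defs
  imports "HOL-Analysis.Analysis" "HOL-Algebra.Group"
begin

section \<open>Smooth maps between open subsets of normed spaces\<close>

text \<open>Both predicates are only meant for open \<open>S\<close>.\<close>

primrec Ck_on :: "nat \<Rightarrow> 'a::real_normed_vector set \<Rightarrow> ('a \<Rightarrow> 'b::real_normed_vector) \<Rightarrow> bool" where
  "Ck_on 0 S f \<longleftrightarrow> continuous_on S f"
| "Ck_on (Suc k) S f \<longleftrightarrow>
     (\<forall>x\<in>S. f differentiable (at x)) \<and>
     (\<forall>v. Ck_on k S (\<lambda>x. frechet_derivative f (at x) v))"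

definition smooth_on :: "'a::real_normed_vector set \<Rightarrow> ('a \<Rightarrow> 'b::real_normed_vector) \<Rightarrow> bool" where
  "smooth_on S f \<longleftrightarrow> (\<forall>k. Ck_on k S f)"


section \<open>Manifolds and tangent maps\<close>

text \<open>A chart is its domain together with its coordinate map, whose values outside the domain are
  irrelevant. The manifold is all of the type \<open>'g\<close>; an atlas need not be maximal.\<close>

type_synonym ('g, 'n) chart = "'g set \<times> ('g \<Rightarrow> real^'n)"

definition chart_inv :: "('g, 'n) chart \<Rightarrow> real^'n \<Rightarrow> 'g" where
  "chart_inv C = inv_into (fst C) (snd C)"

definition chart_image :: "('g, 'n) chart \<Rightarrow> (real^'n) set" where
  "chart_image C = snd C ` fst C"

definition smooth_atlas :: "('g::topological_space, 'n::finite) chart set \<Rightarrow> bool" where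
  "smooth_atlas A \<longleftrightarrow>
     (\<forall>C\<in>A. open (fst C) \<and> open (chart_image C) \<and>
             homeomorphism (fst C) (chart_image C) (snd C) (chart_inv C)) \<and>
     (\<Union>C\<in>A. fst C) = UNIV \<and>
     (\<forall>C\<in>A. \<forall>C'\<in>A. smooth_on (snd C ` (fst C \<inter> fst C')) (snd C' \<circ> chart_inv C))"

definition smooth_fun_on :: "('g::topological_space, 'n::finite) chart set \<Rightarrow> 'g set \<Rightarrow> ('g \<Rightarrow> real) \<Rightarrow> bool" where
  "smooth_fun_on A U f \<longleftrightarrow> (\<forall>C\<in>A. smooth_on (snd C ` (fst C \<inter> U)) (f \<circ> chart_inv C))"

text \<open>Every point \<open>p\<close> has a preferred chart \<open>chart_at A p\<close>, and the tangent space at \<open>p\<close> is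
  \<open>real^'n\<close>, a vector standing for the tangent vector with these components in the preferred chart.
  The choice is not assumed to depend on \<open>p\<close> in any regular way, so smoothness of a tensor field is
  always tested on its components in a fixed chart, and so are derivatives.\<close>

definition chart_at :: "('g, 'n) chart set \<Rightarrow> 'g \<Rightarrow> ('g, 'n) chart" where
  "chart_at A p = (SOME C. C \<in> A \<and> p \<in> fst C)"

definition coord :: "('g, 'n) chart set \<Rightarrow> 'g \<Rightarrow> 'g \<Rightarrow> real^'n" where
  "coord A p = snd (chart_at A p)"

definition param :: "('g, 'n) chart set \<Rightarrow> 'g \<Rightarrow> real^'n \<Rightarrow> 'g" where
  "param A p = chart_inv (chart_at A p)"

definition tangent_map :: "('g, 'n::finite) chart set \<Rightarrow> ('g \<Rightarrow> 'g) \<Rightarrow> 'g \<Rightarrow> real^'n \<Rightarrow> real^'n" where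
  "tangent_map A f p = frechet_derivative (coord A (f p) \<circ> f \<circ> param A p) (at (coord A p p))"

text \<open>Tangent map at \<open>p\<close> of the coordinate map of \<open>C\<close>, and tangent map at \<open>x\<close> of its inverse.\<close>

definition to_chart :: "('g, 'n::finite) chart set \<Rightarrow> ('g, 'n) chart \<Rightarrow> 'g \<Rightarrow> real^'n \<Rightarrow> real^'n" where
  "to_chart A C p = frechet_derivative (snd C \<circ> param A p) (at (coord A p p))"

definition from_chart :: "('g, 'n::finite) chart set \<Rightarrow> ('g, 'n) chart \<Rightarrow> real^'n \<Rightarrow> real^'n \<Rightarrow> real^'n" where
  "from_chart A C x = frechet_derivative (coord A (chart_inv C x) \<circ> chart_inv C) (at x)"

text \<open>Covectors are written in the dual basis, so that \<open>\<alpha> \<bullet> u\<close> is the pairing of a covector with a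
  vector.\<close>

definition differential :: "('g, 'n::finite) chart set \<Rightarrow> ('g \<Rightarrow> real) \<Rightarrow> 'g \<Rightarrow> real^'n" where
  "differential A f p = (\<chi> k. frechet_derivative (f \<circ> param A p) (at (coord A p p)) (axis k 1))"


section \<open>Vector fields and their Lie bracket\<close>

definition vf_rep :: "('g, 'n::finite) chart set \<Rightarrow> ('g, 'n) chart \<Rightarrow> ('g \<Rightarrow> real^'n) \<Rightarrow> real^'n \<Rightarrow> real^'n" where
  "vf_rep A C X x = to_chart A C (chart_inv C x) (X (chart_inv C x))"

definition vf_bracket :: "('g, 'n::finite) chart set \<Rightarrow> ('g \<Rightarrow> real^'n) \<Rightarrow> ('g \<Rightarrow> real^'n) \<Rightarrow> 'g \<Rightarrow> real^'n" where
  "vf_bracket A X Y p =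
     frechet_derivative (vf_rep A (chart_at A p) Y) (at (coord A p p)) (X p) -
     frechet_derivative (vf_rep A (chart_at A p) X) (at (coord A p p)) (Y p)"


section \<open>Bivectors\<close>

text \<open>The skew-symmetric matrix \<open>Q\<close> stands for the bivector
  \<open>(1/2) \<Sum>\<^sub>i\<^sub>j Q\<^sub>i\<^sub>j e\<^sub>i \<and> e\<^sub>j\<close>, so that \<open>u \<and> v\<close> has matrix entries \<open>u\<^sub>i v\<^sub>j - v\<^sub>i u\<^sub>j\<close>. Its pairing
  with \<open>\<alpha> \<and> \<beta>\<close> is normalised by \<open>\<langle>\<alpha> \<and> \<beta>, u \<and> v\<rangle> = \<alpha>(u) \<beta>(v) - \<alpha>(v) \<beta>(u)\<close>.\<close>

definition bivector :: "real^'n^'n \<Rightarrow> bool" where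
  "bivector Q \<longleftrightarrow> transpose Q = - Q"

definition bivector_pairing :: "real^'n \<Rightarrow> real^'n \<Rightarrow> real^'n^'n \<Rightarrow> real" where
  "bivector_pairing \<alpha> \<beta> Q = \<alpha> \<bullet> (Q *v \<beta>)"

definition push_bivector :: "(real^'n \<Rightarrow> real^'n) \<Rightarrow> real^'n^'n \<Rightarrow> real^'n^'n" where
  "push_bivector T Q = matrix T ** Q ** transpose (matrix T)"

definition bivector_rep ::
  "('g, 'n::finite) chart set \<Rightarrow> ('g, 'n) chart \<Rightarrow> ('g \<Rightarrow> real^'n^'n) \<Rightarrow> real^'n \<Rightarrow> real^'n^'n" where
  "bivector_rep A C P x = push_bivector (to_chart A C (chart_inv C x)) (P (chart_inv C x))"

definition bivector_field :: "('g::topological_space, 'n::finite) chart set \<Rightarrow> ('g \<Rightarrow> real^'n^'n) \<Rightarrow> bool" where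
  "bivector_field A P \<longleftrightarrow>
     (\<forall>p. bivector (P p)) \<and> (\<forall>C\<in>A. smooth_on (chart_image C) (bivector_rep A C P))"

definition poisson_bracket ::
  "('g, 'n::finite) chart set \<Rightarrow> ('g \<Rightarrow> real^'n^'n) \<Rightarrow> ('g \<Rightarrow> real) \<Rightarrow> ('g \<Rightarrow> real) \<Rightarrow> 'g \<Rightarrow> real" where
  "poisson_bracket A P f g p = bivector_pairing (differential A f p) (differential A g p) (P p)"

definition poisson_tensor :: "('g::topological_space, 'n::finite) chart set \<Rightarrow> ('g \<Rightarrow> real^'n^'n) \<Rightarrow> bool" where
  "poisson_tensor A P \<longleftrightarrow>
     bivector_field A P \<and>
     (\<forall>U f g h. open U \<longrightarrow> smooth_fun_on A U f \<longrightarrow> smooth_fun_on A U g \<longrightarrow> smooth_fun_on A U h \<longrightarrow>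
        (\<forall>p\<in>U. poisson_bracket A P f (poisson_bracket A P g h) p +
                poisson_bracket A P g (poisson_bracket A P h f) p +
                poisson_bracket A P h (poisson_bracket A P f g) p = 0))"


section \<open>Differential forms\<close>

definition remove_nth :: "nat \<Rightarrow> 'a list \<Rightarrow> 'a list" where
  "remove_nth i xs = take i xs @ drop (Suc i) xs"

text \<open>A \<open>k\<close>-form takes the list of its arguments and vanishes, by convention, on lists of any length
  other than \<open>k\<close>. Contraction, exterior derivative and Chevalley-Eilenberg differential preserve this
  convention, so that the vanishing of a form can be expressed as equality with the zero function.\<close>

definition alternating_form :: "nat \<Rightarrow> ((real^'n) list \<Rightarrow> real) \<Rightarrow> bool" where
  "alternating_form k \<omega> \<longleftrightarrow>
     (\<forall>vs. length vs \<noteq> k \<longrightarrow> \<omega> vs = 0) \<and>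
     (\<forall>vs i. length vs = k \<and> i < k \<longrightarrow> linear (\<lambda>v. \<omega> (vs[i := v]))) \<and>
     (\<forall>vs i j. length vs = k \<and> i < j \<and> j < k \<and> vs ! i = vs ! j \<longrightarrow> \<omega> vs = 0)"

text \<open>\<open>i\<^sub>Q \<omega>\<close>, normalised by \<open>i\<^bsub>u \<and> v\<^esub> \<omega> = \<omega>(u, v, \<dots>)\<close>.\<close>

definition contract :: "real^'n::finite^'n \<Rightarrow> ((real^'n) list \<Rightarrow> real) \<Rightarrow> (real^'n) list \<Rightarrow> real" where
  "contract Q \<omega> vs = (\<Sum>i\<in>UNIV. \<Sum>j\<in>UNIV. Q $ i $ j / 2 * \<omega> (axis i 1 # axis j 1 # vs))"

definition form_rep ::
  "('g, 'n::finite) chart set \<Rightarrow> ('g, 'n) chart \<Rightarrow> ('g \<Rightarrow> (real^'n) list \<Rightarrow> real) \<Rightarrow>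
   real^'n \<Rightarrow> (real^'n) list \<Rightarrow> real" where
  "form_rep A C \<omega> x vs = \<omega> (chart_inv C x) (map (from_chart A C x) vs)"

definition differential_form ::
  "('g::topological_space, 'n::finite) chart set \<Rightarrow> nat \<Rightarrow> ('g \<Rightarrow> (real^'n) list \<Rightarrow> real) \<Rightarrow> bool" where
  "differential_form A k \<omega> \<longleftrightarrow>
     (\<forall>p. alternating_form k (\<omega> p)) \<and>
     (\<forall>C\<in>A. \<forall>vs. smooth_on (chart_image C) (\<lambda>x. form_rep A C \<omega> x vs))"

definition volume_form ::
  "('g::topological_space, 'n::finite) chart set \<Rightarrow> ('g \<Rightarrow> (real^'n) list \<Rightarrow> real) \<Rightarrow> bool" where
  "volume_form A \<omega> \<longleftrightarrow> differential_form A CARD('n) \<omega> \<and> (\<forall>p. \<exists>vs. \<omega> p vs \<noteq> 0)"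

text \<open>Exterior derivative, computed at \<open>p\<close> in the preferred chart of \<open>p\<close> by
  \<open>(d\<omega>)(v\<^sub>0, \<dots>, v\<^sub>k) = \<Sum>\<^sub>i (-1)\<^sup>i D\<omega>(v\<^sub>i)(v\<^sub>0, \<dots>, v\<^sub>k without v\<^sub>i)\<close>.\<close>

definition ext_d ::
  "('g, 'n::finite) chart set \<Rightarrow> ('g \<Rightarrow> (real^'n) list \<Rightarrow> real) \<Rightarrow> 'g \<Rightarrow> (real^'n) list \<Rightarrow> real" where
  "ext_d A \<omega> p vs =
     (\<Sum>i<length vs. (- 1) ^ i *
        frechet_derivative (\<lambda>x. form_rep A (chart_at A p) \<omega> x (remove_nth i vs))
          (at (coord A p p)) (vs ! i))"


section \<open>Lie algebras\<close>

definition lie_algebra :: "(real^'n \<Rightarrow> real^'n \<Rightarrow> real^'n) \<Rightarrow> bool" where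
  "lie_algebra br \<longleftrightarrow>
     bilinear br \<and> (\<forall>x. br x x = 0) \<and>
     (\<forall>x y z. br x (br y z) + br y (br z x) + br z (br x y) = 0)"

definition unimodular_lie_algebra :: "(real^'n::finite \<Rightarrow> real^'n \<Rightarrow> real^'n) \<Rightarrow> bool" where
  "unimodular_lie_algebra br \<longleftrightarrow> lie_algebra br \<and> (\<forall>x. trace (matrix (br x)) = 0)"

definition ce_d :: "(real^'n \<Rightarrow> real^'n \<Rightarrow> real^'n) \<Rightarrow> ((real^'n) list \<Rightarrow> real) \<Rightarrow> (real^'n) list \<Rightarrow> real" where
  "ce_d br \<omega> vs =
     (\<Sum>j<length vs. \<Sum>i<j. (- 1) ^ (i + j) *
        \<omega> (br (vs ! i) (vs ! j) # remove_nth i (remove_nth j vs)))"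

text \<open>The dual of the bracket, \<open>\<rho>(\<gamma>)(u, v) = \<gamma>([u, v])\<close> on covectors, extended to all forms as a
  differential.\<close>

definition dual_cocycle ::
  "(real^'n \<Rightarrow> real^'n \<Rightarrow> real^'n) \<Rightarrow> ((real^'n) list \<Rightarrow> real) \<Rightarrow> (real^'n) list \<Rightarrow> real" where
  "dual_cocycle br \<omega> vs = - ce_d br \<omega> vs"


section \<open>Lie groups\<close>

definition lie_group ::
  "('g::{t2_space, second_countable_topology}, 'n::finite) chart set \<Rightarrow> 'g monoid \<Rightarrow> bool" where
  "lie_group A G \<longleftrightarrow>
     group G \<and> carrier G = UNIV \<and> smooth_atlas A \<and>
     continuous_on UNIV (\<lambda>(a, b). a \<otimes>\<^bsub>G\<^esub> b) \<and>
     (\<forall>C1\<in>A. \<forall>C2\<in>A. \<forall>C\<in>A.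
        smooth_on {(x, y). x \<in> chart_image C1 \<and> y \<in> chart_image C2 \<and>
                            chart_inv C1 x \<otimes>\<^bsub>G\<^esub> chart_inv C2 y \<in> fst C}
          (\<lambda>(x, y). snd C (chart_inv C1 x \<otimes>\<^bsub>G\<^esub> chart_inv C2 y))) \<and>
     continuous_on UNIV (\<lambda>a. inv\<^bsub>G\<^esub> a) \<and>
     (\<forall>C1\<in>A. \<forall>C\<in>A.
        smooth_on {x \<in> chart_image C1. inv\<^bsub>G\<^esub> (chart_inv C1 x) \<in> fst C}
          (\<lambda>x. snd C (inv\<^bsub>G\<^esub> (chart_inv C1 x))))"

definition ltrans :: "('g, 'z) monoid_scheme \<Rightarrow> 'g \<Rightarrow> 'g \<Rightarrow> 'g" where
  "ltrans G a h = a \<otimes>\<^bsub>G\<^esub> h"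

definition rtrans :: "('g, 'z) monoid_scheme \<Rightarrow> 'g \<Rightarrow> 'g \<Rightarrow> 'g" where
  "rtrans G a h = h \<otimes>\<^bsub>G\<^esub> a"

text \<open>The Lie bracket on the tangent space at \<open>\<one>\<close>, through left invariant vector fields.\<close>

definition left_invariant_field ::
  "('g, 'n::finite) chart set \<Rightarrow> 'g monoid \<Rightarrow> real^'n \<Rightarrow> 'g \<Rightarrow> real^'n" where
  "left_invariant_field A G u a = tangent_map A (ltrans G a) \<one>\<^bsub>G\<^esub> u"

definition lie_bracket ::
  "('g, 'n::finite) chart set \<Rightarrow> 'g monoid \<Rightarrow> real^'n \<Rightarrow> real^'n \<Rightarrow> real^'n" where
  "lie_bracket A G u v =
     vf_bracket A (left_invariant_field A G u) (left_invariant_field A G v) \<one>\<^bsub>G\<^esub>"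

definition pullback ::
  "('g, 'n::finite) chart set \<Rightarrow> ('g \<Rightarrow> 'g) \<Rightarrow> ('g \<Rightarrow> (real^'n) list \<Rightarrow> real) \<Rightarrow>
   'g \<Rightarrow> (real^'n) list \<Rightarrow> real" where
  "pullback A f \<omega> p vs = \<omega> (f p) (map (tangent_map A f p) vs)"

definition left_invariant_form ::
  "('g, 'n::finite) chart set \<Rightarrow> 'g monoid \<Rightarrow> ('g \<Rightarrow> (real^'n) list \<Rightarrow> real) \<Rightarrow> bool" where
  "left_invariant_form A G \<omega> \<longleftrightarrow> (\<forall>a. pullback A (ltrans G a) \<omega> = \<omega>)"

text \<open>A group is unimodular if its left Haar measure is right invariant. On a Lie group the left Haar
  measures are the densities \<open>\<bar>\<nu>\<bar>\<close> of the left invariant volume forms \<open>\<nu>\<close>.\<close>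

definition unimodular_group ::
  "('g::topological_space, 'n::finite) chart set \<Rightarrow> 'g monoid \<Rightarrow> bool" where
  "unimodular_group A G \<longleftrightarrow>
     (\<forall>\<nu>. volume_form A \<nu> \<and> left_invariant_form A G \<nu> \<longrightarrow>
        (\<forall>a p vs. \<bar>pullback A (rtrans G a) \<nu> p vs\<bar> = \<bar>\<nu> p vs\<bar>))"


section \<open>Poisson-Lie groups\<close>

definition multiplicative ::
  "('g, 'n::finite) chart set \<Rightarrow> 'g monoid \<Rightarrow> ('g \<Rightarrow> real^'n^'n) \<Rightarrow> bool" where
  "multiplicative A G P \<longleftrightarrow>
     (\<forall>a b. P (a \<otimes>\<^bsub>G\<^esub> b) =
        push_bivector (tangent_map A (ltrans G a) b) (P b) +
        push_bivector (tangent_map A (rtrans G b) a) (P a))"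

definition poisson_lie_group ::
  "('g::{t2_space, second_countable_topology}, 'n::finite) chart set \<Rightarrow> 'g monoid \<Rightarrow>
   ('g \<Rightarrow> real^'n^'n) \<Rightarrow> bool" where
  "poisson_lie_group A G P \<longleftrightarrow> lie_group A G \<and> poisson_tensor A P \<and> multiplicative A G P"

definition left_translate ::
  "('g, 'n::finite) chart set \<Rightarrow> 'g monoid \<Rightarrow> ('g \<Rightarrow> real^'n^'n) \<Rightarrow> 'g \<Rightarrow> real^'n^'n" where
  "left_translate A G P a = push_bivector (tangent_map A (ltrans G (inv\<^bsub>G\<^esub> a)) a) (P a)"

definition cocycle ::
  "('g, 'n::finite) chart set \<Rightarrow> 'g monoid \<Rightarrow> ('g \<Rightarrow> real^'n^'n) \<Rightarrow> real^'n \<Rightarrow> real^'n^'n" where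
  "cocycle A G P =
     frechet_derivative (left_translate A G P \<circ> param A \<one>\<^bsub>G\<^esub>) (at (coord A \<one>\<^bsub>G\<^esub> \<one>\<^bsub>G\<^esub>))"

text \<open>The covector \<open>[\<alpha>, \<beta>]\<^sup>*\<close> given by \<open>[\<alpha>, \<beta>]\<^sup>*(u) = \<langle>\<alpha> \<and> \<beta>, \<xi>(u)\<rangle>\<close>, by its components.\<close>

definition dual_bracket ::
  "('g, 'n::finite) chart set \<Rightarrow> 'g monoid \<Rightarrow> ('g \<Rightarrow> real^'n^'n) \<Rightarrow>
   real^'n \<Rightarrow> real^'n \<Rightarrow> real^'n" where
  "dual_bracket A G P \<alpha> \<beta> = (\<chi> k. bivector_pairing \<alpha> \<beta> (cocycle A G P (axis k 1)))"

end

theory Submission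
  imports Defs
begin

text \<open>In the left invariant frame the form \<open>i\<^sub>\<pi> \<mu>\<close> is the function \<open>g \<mapsto> i\<^bsub>\<pi>\<ell>(g)\<^esub> \<mu>\<^sub>e\<close>, where
  \<open>\<pi>\<ell>(gh) = \<pi>\<ell>(h) + Ad(h\<inverse>) \<pi>\<ell>(g)\<close> by multiplicativity. Its derivative along the left invariant field of \<open>a\<close>
  is therefore \<open>\<xi>(a) - ad\<^sub>a \<pi>\<ell>(g)\<close>, contracted with \<open>\<mu>\<^sub>e\<close>. Unimodularity of \<open>G\<close> says that \<open>ad\<^sub>a\<close>
  annihilates \<open>\<mu>\<^sub>e\<close>, and the exterior derivative in the frame becomes
  \<open>d(i\<^sub>\<pi> \<mu>)\<^sub>g = \<Sum>\<^sub>i (-1)\<^sup>i (i\<^bsub>\<xi>(a\<^sub>i)\<^esub> \<mu>\<^sub>e)(\<dots> without a\<^sub>i \<dots>) + \<rho>(i\<^bsub>\<pi>\<ell>(g)\<^esub> \<mu>\<^sub>e)\<close>. The first term does not depend on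
  \<open>g\<close> and is the interior product of \<open>\<mu>\<^sub>e\<close> with the trace vector of the dual Lie algebra; the second
  vanishes at \<open>e\<close>, so the two must vanish separately. The second has zero derivative along
  right invariant fields exactly if \<open>\<rho>(i\<^bsub>\<xi>(u)\<^esub> \<mu>\<^sub>e) = 0\<close>, and \<open>G\<close> is connected.

  All this is done in charts. The only second order input is the symmetry of the second derivatives of
  the translations and of the multiplication.\<close>

section \<open>Alternating forms\<close>

text \<open>The obstacle is that components of a tensor at \<open>p\<close> refer to a preferred
  chart depending on \<open>p\<close> without any regularity, so \<open>P\<close>, \<mu> and the
  tangent maps of translations cannot be differentiated in \<open>p\<close>. Two kinds of objects
  can: components in a fixed chart (\<open>frame\<close>, \<open>bivector_rep\<close>,
  \<open>form_rep\<close>), and functions with values in tensors over the single tangent space at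
  the identity (\<open>pl\<close>, \<open>Ad_inv\<close>). The latter solve linear systems with
  coefficients of the former kind, which makes them differentiable. The coefficient of the second
  term of the formula is -2 + 1: the derivation ad contributes -2 times the Chevalley-Eilenberg
  differential, the commutators of the frame +1, and minus that differential is \<rho>.
  Unimodularity of the group gives the invariance of \<mu> under Ad only up to sign. Continuity
  settles the sign near the identity, so on the whole group one follows only whether the second term
  vanishes at \<open>g\<close>. Unimodularity of the dual algebra, as encoded, contains the Lie
  algebra axioms, so its Jacobi identity has to be derived from that of \<pi>.\<close>

lemma remove_nth_append: "remove_nth (length us) (us @ a # ws) = us @ ws"
  by (simp add: remove_nth_def)

lemma remove_nth_append_right: "remove_nth (length us + l) (us @ ws) = us @ remove_nth l ws"
  by (simp add: remove_nth_def)

lemma length_remove_nth: "i < length vs \<Longrightarrow> length (remove_nth i vs) = length vs - 1"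
  by (auto simp: remove_nth_def)

lemma map_remove_nth: "map f (remove_nth i vs) = remove_nth i (map f vs)"
  by (simp add: remove_nth_def take_map drop_map)

lemma remove_nth_Cons_0 [simp]: "remove_nth 0 (a # vs) = vs"
  by (simp add: remove_nth_def)

lemma remove_nth_Cons_Suc [simp]: "remove_nth (Suc i) (a # vs) = a # remove_nth i vs"
  by (simp add: remove_nth_def)

lemma nth_remove_nth:
  "i < length vs \<Longrightarrow> k < length vs - 1 \<Longrightarrow> remove_nth i vs ! k = (if k < i then vs ! k else vs ! Suc k)"
  by (auto simp: remove_nth_def nth_append min_def)

lemma remove_nth_commute:
  "i \<le> k \<Longrightarrow> Suc k < length vs \<Longrightarrow>
    remove_nth k (remove_nth i vs) = remove_nth i (remove_nth (Suc k) vs)"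
  by (rule nth_equalityI) (auto simp: length_remove_nth nth_remove_nth)

lemma list_update_split: "k < length vs \<Longrightarrow> vs[k := w] = take k vs @ w # drop (Suc k) vs"
  by (simp add: upd_conv_take_nth_drop)

lemma alternating_form_length:
  "alternating_form k \<omega> \<Longrightarrow> length vs \<noteq> k \<Longrightarrow> \<omega> vs = 0"
  by (simp add: alternating_form_def)

text \<open>The convention on lists of the wrong length makes this hold for all \<open>us\<close>
  and \<open>ws\<close>: where the lengths do not fit, the function is constantly zero. Later uses
  therefore carry no length hypothesis.\<close>

lemma alternating_form_linear:
  assumes "alternating_form k \<omega>"
  shows "linear (\<lambda>v. \<omega> (us @ v # ws))"
proof (cases "length us + length ws + 1 = k")
  case True
  let ?vs = "us @ 0 # ws"
  have "length ?vs = k \<and> length us < k" using True by simp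
  then have "linear (\<lambda>v. \<omega> (?vs[length us := v]))"
    using assms unfolding alternating_form_def by blast
  then show ?thesis by simp
next
  case False
  then have "\<And>v. \<omega> (us @ v # ws) = 0" by (intro alternating_form_length[OF assms]) auto
  then show ?thesis by (simp add: linear_zero)
qed

lemma alternating_form_linear_Cons: "alternating_form k \<omega> \<Longrightarrow> linear (\<lambda>v. \<omega> (v # ws))"
  using alternating_form_linear[of k \<omega> "[]" ws] by simp

lemma alternating_form_linear_Cons2: "alternating_form k \<omega> \<Longrightarrow> linear (\<lambda>v. \<omega> (u # v # ws))"
  using alternating_form_linear[of k \<omega> "[u]" ws] by simp

lemma alternating_form_repeat:
  assumes "alternating_form k \<omega>"
  shows "\<omega> (us @ a # ms @ a # ws) = 0"
proof (cases "length us + length ms + length ws + 2 = k")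
  case True
  let ?vs = "us @ a # ms @ a # ws"
  let ?i = "length us" and ?j = "length us + 1 + length ms"
  have "length ?vs = k \<and> ?i < ?j \<and> ?j < k \<and> ?vs ! ?i = ?vs ! ?j" using True by (simp add: nth_append)
  then show ?thesis
    using assms unfolding alternating_form_def by blast
qed (simp add: alternating_form_length[OF assms])

text \<open>Polarisation: expand the vanishing value with \<open>a + b\<close> in both
  slots.\<close>

lemma alternating_form_swap:
  assumes "alternating_form k \<omega>"
  shows "\<omega> (us @ a # b # ws) = - \<omega> (us @ b # a # ws)"
proof -
  have l1: "\<omega> (us @ (a + b) # v # ws) = \<omega> (us @ a # v # ws) + \<omega> (us @ b # v # ws)" for v
    using linear_add[OF alternating_form_linear[OF assms, of us "v # ws"]] by simp
  have l2: "\<omega> (us @ v # (a + b) # ws) = \<omega> (us @ v # a # ws) + \<omega> (us @ v # b # ws)" for v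
    using linear_add[OF alternating_form_linear[OF assms, of "us @ [v]" "ws"]] by simp
  have z: "\<omega> (us @ v # v # ws) = 0" for v
    using alternating_form_repeat[OF assms, of us v "[]" ws] by simp
  show ?thesis using l1[of "a+b"] l2[of a] l2[of b] z[of "a+b"] z[of a] z[of b] by simp
qed

lemma alternating_form_front:
  assumes "alternating_form k \<omega>"
  shows "\<omega> (us @ w # ws) = (-1) ^ length us * \<omega> (w # us @ ws)"
proof (induction us arbitrary: ws rule: rev_induct)
  case (snoc b us)
  have "\<omega> ((us @ [b]) @ w # ws) = - \<omega> (us @ w # b # ws)"
    using alternating_form_swap[OF assms, of us b w ws] by simp
  also have "\<dots> = - ((-1) ^ length us * \<omega> (w # us @ b # ws))" by (simp add: snoc)
  finally show ?case by simp
qed simp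

lemma alternating_formI:
  fixes \<omega> :: "(real^'n) list \<Rightarrow> real"
  assumes "\<And>vs. length vs \<noteq> k \<Longrightarrow> \<omega> vs = 0"
    and "\<And>us ws. length us + length ws + 1 = k \<Longrightarrow> linear (\<lambda>v. \<omega> (us @ v # ws))"
    and "\<And>us a ms ws. length us + length ms + length ws + 2 = k \<Longrightarrow> \<omega> (us @ a # ms @ a # ws) = 0"
  shows "alternating_form k \<omega>"
  unfolding alternating_form_def
proof (intro conjI allI impI)
  fix vs :: "(real^'n) list" and i assume "length vs = k \<and> i < k"
  then show "linear (\<lambda>v. \<omega> (vs[i := v]))"
    using assms(2)[of "take i vs" "drop (Suc i) vs"] by (simp add: list_update_split min_def)
next
  fix vs :: "(real^'n) list" and i j assume h: "length vs = k \<and> i < j \<and> j < k \<and> vs ! i = vs ! j"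
  define ms where "ms = take (j - Suc i) (drop (Suc i) vs)"
  have "vs = take i vs @ vs ! i # drop (Suc i) vs" using h id_take_nth_drop[of i vs] by simp
  moreover have "drop (Suc i) vs = ms @ vs ! j # drop (Suc j) vs"
  proof -
    have "j - Suc i < length (drop (Suc i) vs)" using h by auto
    moreover have "drop (Suc i) vs ! (j - Suc i) = vs ! j" using h by simp
    moreover have "drop (Suc (j - Suc i)) (drop (Suc i) vs) = drop (Suc j) vs" using h by simp
    ultimately show ?thesis using id_take_nth_drop[of "j - Suc i" "drop (Suc i) vs"] by (simp only: ms_def)
  qed
  ultimately have *: "vs = take i vs @ vs ! i # ms @ vs ! i # drop (Suc j) vs" using h by metis
  have "length ms = j - Suc i" using h by (auto simp: ms_def)
  then have "length (take i vs) + length ms + length (drop (Suc j) vs) + 2 = k" using h by auto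
  then show "\<omega> vs = 0" using assms(3)[of "take i vs" ms "drop (Suc j) vs" "vs ! i"] * by simp
qed (use assms(1) in auto)

text \<open>Brings a replaced argument into the shape of a summand of \<open>ce_d\<close>, where the
  bracket stands in front.\<close>

lemma alternating_form_replace:
  assumes "alternating_form k \<omega>" "j < length vs"
  shows "\<omega> (vs[j := w]) = (-1) ^ j * \<omega> (w # remove_nth j vs)"
  using alternating_form_front[OF assms(1), of "take j vs" w "drop (Suc j) vs"] assms(2)
  by (simp add: list_update_split remove_nth_def min_def)

text \<open>The combinatorial core of the formula for the exterior derivative in a moving frame: the
  argument \<open>v\<^sub>i\<close> acts on each of the others through \<open>S\<close>, and only the commutator of \<open>S\<close> survives.\<close>

lemma sum_replace_eq_ce_d:
  assumes "alternating_form m \<omega>" "length vs = Suc m"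
  shows "(\<Sum>i<Suc m. (-1) ^ i *
      (\<Sum>k<m. \<omega> ((remove_nth i vs)[k := S (vs ! i) (remove_nth i vs ! k)]))) =
    - ce_d (\<lambda>a b. S a b - S b a) \<omega> vs"
proof -
  define c where "c i j s = (-1::real) ^ (i + j) * \<omega> (s # remove_nth i (remove_nth j vs))" for i j s
  have lower: "(-1) ^ i * \<omega> ((remove_nth i vs)[k := S (vs ! i) (remove_nth i vs ! k)]) =
      c k i (S (vs ! i) (vs ! k))" if "k < i" "i < Suc m" for i k
    using that assms(2) alternating_form_replace[OF assms(1), of k "remove_nth i vs"]
    by (simp add: c_def length_remove_nth nth_remove_nth power_add)
  \<comment> \<open>From position \<open>i\<close> on the shortened list is shifted by one, so its
    entry \<open>k\<close> is argument \<open>Suc k\<close> of \<open>vs\<close>. Since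
    \<open>(-1) ^ (i + k)\<close> and \<open>(-1) ^ (i + Suc k)\<close> differ by a sign, these
    terms enter with the sign opposite to \<open>lower\<close>, which produces the
    commutator.\<close>
  have upper: "(-1) ^ i * \<omega> ((remove_nth i vs)[k := S (vs ! i) (remove_nth i vs ! k)]) =
      - c i (Suc k) (S (vs ! i) (vs ! Suc k))" if "i \<le> k" "k < m" for i k
    using that assms(2) alternating_form_replace[OF assms(1), of k "remove_nth i vs"]
    by (simp add: c_def length_remove_nth nth_remove_nth power_add remove_nth_commute)
  have split: "(\<Sum>k<m. g k) = (\<Sum>k<i. g k) + (\<Sum>k=i..<m. g k)" if "i < Suc m" for g :: "nat \<Rightarrow> real" and i
    using that sum.atLeastLessThan_concat[of 0 i m g] by (simp add: atLeast0LessThan)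
  have "(\<Sum>i<Suc m. (-1) ^ i * (\<Sum>k<m. \<omega> ((remove_nth i vs)[k := S (vs ! i) (remove_nth i vs ! k)]))) =
    (\<Sum>i<Suc m. (\<Sum>k<i. c k i (S (vs ! i) (vs ! k))) - (\<Sum>k=i..<m. c i (Suc k) (S (vs ! i) (vs ! Suc k))))"
    by (rule sum.cong[OF refl]) (simp add: split lower upper sum_distrib_left sum_negf distrib_left)
  also have "\<dots> = (\<Sum>i<Suc m. \<Sum>k<i. c k i (S (vs ! i) (vs ! k))) -
      (\<Sum>i<Suc m. \<Sum>k=i..<m. c i (Suc k) (S (vs ! i) (vs ! Suc k)))"
    by (simp add: sum_subtractf)
  also have "(\<Sum>i<Suc m. \<Sum>k=i..<m. c i (Suc k) (S (vs ! i) (vs ! Suc k))) =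
      (\<Sum>i<Suc m. \<Sum>j=Suc i..m. c i j (S (vs ! i) (vs ! j)))"
    by (rule sum.cong[OF refl])
      (simp add: sum.shift_bounds_Suc_ivl[symmetric, where g = "\<lambda>j. c _ j (S (vs ! _) (vs ! j))"] atLeastLessThanSuc_atLeastAtMost)
  also have "\<dots> = (\<Sum>i<m. \<Sum>j=Suc i..m. c i j (S (vs ! i) (vs ! j)))" by simp
  also have "\<dots> = (\<Sum>j\<le>m. \<Sum>i<j. c i j (S (vs ! i) (vs ! j)))"
    by (rule sum.nested_swap'[symmetric])
  also have "\<dots> = (\<Sum>j<Suc m. \<Sum>i<j. c i j (S (vs ! i) (vs ! j)))" by (simp add: lessThan_Suc_atMost)
  finally show ?thesis
    unfolding ce_d_def c_def assms(2)
    by (simp add: sum_subtractf[symmetric] sum_negf[symmetric] linear_diff[OF alternating_form_linear_Cons[OF assms(1)]]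
        algebra_simps del: sum.lessThan_Suc)
qed

text \<open>Naturality of the Chevalley-Eilenberg differential under pullback by \<open>f\<close>.
  The brackets are arbitrary functions here because one application takes for \<open>br'\<close> the
  commutator of the derivative of the frame.\<close>

lemma ce_d_map:
  assumes "\<And>a b. br' (f a) (f b) = f (br a b)"
  shows "ce_d br' \<omega> (map f vs) = ce_d br (\<lambda>ws. \<omega> (map f ws)) vs"
  unfolding ce_d_def
  by (auto intro!: sum.cong simp: assms map_remove_nth)

text \<open>The function is the wedge product of \<theta> and \<omega>. If two arguments are equal,
  every summand that removes a third one vanishes; in the two others, moving the remaining copy to
  the front produces opposite signs.\<close>

lemma wedge_alternating:
  fixes \<omega> :: "(real^'n) list \<Rightarrow> real"
  assumes "alternating_form k \<omega>" "linear \<theta>"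
  shows "alternating_form (Suc k)
    (\<lambda>ws. \<Sum>i<length ws. (-1) ^ i * \<theta> (ws ! i) * \<omega> (remove_nth i ws))"
    (is "alternating_form _ ?\<Psi>")
proof (rule alternating_formI)
  fix vs :: "(real^'n) list" assume "length vs \<noteq> Suc k"
  then have "\<omega> (remove_nth i vs) = 0" if "i < length vs" for i
    using that by (intro alternating_form_length[OF assms(1)]) (simp add: length_remove_nth)
  then show "?\<Psi> vs = 0" by (metis (mono_tags, lifting) lessThan_iff mult_zero_right sum.neutral)
next
  fix us ws :: "(real^'n) list"
  have "linear (\<lambda>v. (-1) ^ i * \<theta> ((us @ v # ws) ! i) * \<omega> (remove_nth i (us @ v # ws)))"
    if "i < length us + Suc (length ws)" for i
  proof -
    consider "i < length us" | "i = length us" | j where "i = Suc (length us + j)" "j < length ws"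
      using \<open>i < length us + Suc (length ws)\<close> that(3)[of "i - Suc (length us)"] by linarith
    then show ?thesis
    proof cases
      case 1
      then have "remove_nth i (us @ v # ws) = remove_nth i us @ v # ws" for v
        by (simp add: remove_nth_def)
      then show ?thesis using 1
        linear_compose_scale_right[OF alternating_form_linear[OF assms(1)], of "(-1) ^ i * \<theta> (us ! i)" "remove_nth i us" ws]
        by (simp add: nth_append)
    next
      case 2
      then show ?thesis using linear_compose_scale_right[OF assms(2), of "(-1)^i * \<omega> (us @ ws)"]
        by (simp add: nth_append remove_nth_append mult.commute mult.left_commute)
    next
      case 3
      then have "remove_nth i (us @ v # ws) = us @ v # remove_nth j ws" for v
        by (simp add: remove_nth_def)
      then show ?thesis using 3
        linear_compose_scale_right[OF alternating_form_linear[OF assms(1)], of "(-1) ^ i * \<theta> (ws ! j)" us "remove_nth j ws"]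
        by (simp add: nth_append)
    qed
  qed
  then show "linear (\<lambda>v. ?\<Psi> (us @ v # ws))"
    by (auto intro!: linear_compose_sum simp del: sum.lessThan_Suc)
next
  fix us ms ws :: "(real^'n) list" and a
  let ?vs = "us @ a # ms @ a # ws" and ?i = "length us" and ?j = "length us + Suc (length ms)"
  define g where "g i = (-1) ^ i * \<theta> (?vs ! i) * \<omega> (remove_nth i ?vs)" for i
  have zero: "g i = 0" if "i < length ?vs" "i \<noteq> ?i" "i \<noteq> ?j" for i
  proof -
    have "\<omega> (remove_nth i ?vs) = 0"
    proof (cases "i < ?i")
      case True
      then have "remove_nth i ?vs = remove_nth i us @ a # ms @ a # ws" by (simp add: remove_nth_def)
      then show ?thesis by (simp add: alternating_form_repeat[OF assms(1)])
    next
      case False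
      show ?thesis
      proof (cases "i < ?j")
        case True
        then obtain l where l: "i = Suc (?i + l)" "l < length ms"
          using False \<open>i \<noteq> ?i\<close> that[of "i - Suc ?i"] by linarith
        then have "remove_nth i ?vs = us @ a # remove_nth l ms @ a # ws" by (simp add: remove_nth_def)
        then show ?thesis by (simp add: alternating_form_repeat[OF assms(1)])
      next
        case False
        then obtain l where l: "i = Suc (?j + l)"
          using \<open>i \<noteq> ?j\<close> that[of "i - Suc ?j"] by linarith
        then have "remove_nth i ?vs = us @ a # ms @ a # remove_nth l ws"
          using remove_nth_append_right[of "us @ a # ms @ [a]" l ws] by simp
        then show ?thesis by (simp add: alternating_form_repeat[OF assms(1)])
      qed
    qed
    then show ?thesis by (simp add: g_def)
  qed
  have r: "remove_nth ?i ?vs = us @ ms @ a # ws" "remove_nth ?j ?vs = us @ a # ms @ ws"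
    by (simp_all add: remove_nth_def)
  have "\<omega> (us @ ms @ a # ws) = (-1) ^ (length us + length ms) * \<omega> (a # us @ ms @ ws)"
       "\<omega> (us @ a # ms @ ws) = (-1) ^ (length us) * \<omega> (a # us @ ms @ ws)"
    using alternating_form_front[OF assms(1), of "us @ ms" a ws]
      alternating_form_front[OF assms(1), of us a "ms @ ws"] by simp_all
  then have "g ?i + g ?j = 0" unfolding g_def r by (simp add: nth_append power_add)
  moreover have "?\<Psi> ?vs = sum g {?i, ?j}"
    unfolding g_def[symmetric] by (rule sum.mono_neutral_right) (auto intro: zero)
  ultimately show "?\<Psi> ?vs = 0" by simp
qed

text \<open>Among more than \<open>CARD('n)\<close> distinct vectors one lies in the span of the
  others. As a function of its slot the form is linear and vanishes on each of the others, hence on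
  their span. Lists with repetitions are split off because \<open>set vs\<close> may then be too
  small to be dependent.\<close>

lemma alternating_form_dependent:
  fixes \<omega> :: "(real^'n) list \<Rightarrow> real"
  assumes "alternating_form k \<omega>" "CARD('n) < k"
  shows "\<omega> vs = 0"
proof (cases "length vs = k \<and> distinct vs")
  case False
  then show ?thesis
    using alternating_form_length[OF assms(1)] alternating_form_repeat[OF assms(1)]
    by (metis append_Cons append_Nil append_assoc not_distinct_decomp)
next
  case True
  then have "dependent (set vs)"
    using assms(2) by (intro dependent_biggerset) (simp add: distinct_card)
  then obtain v where v: "v \<in> set vs" "v \<in> span (set vs - {v})" by (auto simp: dependent_def)
  from v(1) obtain us ws where vs: "vs = us @ v # ws" by (meson split_list)
  have "\<omega> (us @ w # ws) = 0" if "w \<in> span (set vs - {v})" for w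
    using that
  proof (rule span_induct)
    show "subspace {w. \<omega> (us @ w # ws) = 0}"
      by (rule linear_subspace_kernel[OF alternating_form_linear[OF assms(1)]])
    fix w assume "w \<in> set vs - {v}"
    then consider "w \<in> set us" | "w \<in> set ws" using vs by auto
    then show "\<omega> (us @ w # ws) = 0"
    proof cases
      case 1
      then obtain a b where "us = a @ w # b" by (meson split_list)
      then show ?thesis using alternating_form_repeat[OF assms(1), of a w b ws] by simp
    next
      case 2
      then obtain a b where "ws = a @ w # b" by (meson split_list)
      then show ?thesis using alternating_form_repeat[OF assms(1), of us w a b] by simp
    qed
  qed
  then show ?thesis using v(2) vs by simp
qed

text \<open>The wedge product has degree \<open>CARD('n) + 1\<close>.\<close>

lemma wedge_top_form:
  fixes \<omega> :: "(real^'n) list \<Rightarrow> real"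
  assumes "alternating_form CARD('n) \<omega>" "linear \<theta>"
  shows "(\<Sum>i<length ws. (-1) ^ i * \<theta> (ws ! i) * \<omega> (remove_nth i ws)) = 0"
  using alternating_form_dependent[OF wedge_alternating[OF assms]] by simp

text \<open>Wedge \<omega> with the covector given by the inner product with \<open>t\<close> and
  evaluate on \<open>t # vs\<close>: in all summands except the first, \<open>t\<close> is the first
  argument of \<omega>, so that \<open>(t \<bullet> t) * \<omega> vs = 0\<close> remains.\<close>

lemma top_form_nondegenerate:
  fixes \<omega> :: "(real^'n) list \<Rightarrow> real"
  assumes "alternating_form CARD('n) \<omega>" "\<omega> vs \<noteq> 0" "\<And>ws. length ws = CARD('n) - 1 \<Longrightarrow> \<omega> (t # ws) = 0"
  shows "t = 0"
proof -
  have len: "length vs = CARD('n)" using alternating_form_length[OF assms(1)] assms(2) by blast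
  have "linear (\<lambda>v. t \<bullet> v)" by (intro bounded_linear.linear bounded_linear_inner_right)
  from wedge_top_form[OF assms(1) this, of "t # vs"]
  have "(t \<bullet> t) * \<omega> vs = 0"
    by (simp add: lessThan_Suc_eq_insert_0 sum.reindex len assms(3) length_remove_nth del: sum.lessThan_Suc)
  then show ?thesis using assms(2) by simp
qed

text \<open>Linearity slot by slot. A comparison of forms becomes finitely many conditions, which
  allows the exchange of quantifiers in \<open>eventually_\<mu>_Ad_inv_all\<close>.\<close>

lemma form_eq_if_eq_on_axes:
  fixes \<omega> \<nu> :: "(real^'n) list \<Rightarrow> real"
  assumes "alternating_form k \<omega>" "alternating_form k \<nu>"
    and "\<And>vs. length vs = k \<Longrightarrow> set vs \<subseteq> Basis \<Longrightarrow> \<omega> vs = \<nu> vs"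
  shows "\<omega> vs = \<nu> vs"
proof (cases "length vs = k")
  case True
  have "\<omega> (us @ ws) = \<nu> (us @ ws)" if "length us + length ws = k" "set ws \<subseteq> Basis" for us ws
    using that
  proof (induction us arbitrary: ws rule: rev_induct)
    case (snoc u us)
    have "\<omega> (us @ u # ws) = \<nu> (us @ u # ws)"
      using alternating_form_linear[OF assms(1)] alternating_form_linear[OF assms(2)]
      by (rule linear_eq_on_span[where B = Basis]) (use snoc in \<open>auto simp: span_Basis\<close>)
    then show ?case by simp
  qed (use assms(3) in auto)
  from this[of vs "[]"] True show ?thesis by simp
qed (simp add: alternating_form_length[OF assms(1)] alternating_form_length[OF assms(2)])

section \<open>Contraction with bivectors\<close>

lemma sum_rotate:
  "(\<Sum>l\<in>A. \<Sum>i\<in>B. \<Sum>j\<in>C. f l i j) = (\<Sum>i\<in>B. \<Sum>j\<in>C. \<Sum>l\<in>A. f l i j)"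
  by (rule trans[OF sum.swap], rule sum.cong[OF refl], rule sum.swap)

lemma contract_length:
  "alternating_form k \<omega> \<Longrightarrow> Suc (Suc (length vs)) \<noteq> k \<Longrightarrow> contract Q \<omega> vs = 0"
  by (simp add: contract_def alternating_form_length)

lemma contract_zero [simp]: "contract 0 \<omega> vs = 0"
  by (simp add: contract_def)

lemma contract_add: "contract (Q + R) \<omega> vs = contract Q \<omega> vs + contract R \<omega> vs"
  by (simp add: contract_def sum.distrib[symmetric] field_simps)

lemma contract_diff: "contract (Q - R) \<omega> vs = contract Q \<omega> vs - contract R \<omega> vs"
  by (simp add: contract_def sum_subtractf[symmetric] field_simps)

lemma contract_scaleR: "contract (c *\<^sub>R Q) \<omega> vs = c * contract Q \<omega> vs"
  by (simp add: contract_def sum_distrib_left mult_ac)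

lemma linear_contract: "linear (\<lambda>Q. contract Q \<omega> vs)"
  by (rule linearI) (simp_all add: contract_add contract_scaleR)

lemma linear_contract_slot:
  assumes "alternating_form k \<omega>"
  shows "linear (\<lambda>v. contract Q \<omega> (us @ v # ws))"
proof -
  have "linear (\<lambda>v. Q $ i $ j / 2 * \<omega> (axis i 1 # axis j 1 # us @ v # ws))" for i j
    using linear_compose_scale_right[OF alternating_form_linear[OF assms, of "axis i 1 # axis j 1 # us" ws],
        of "Q $ i $ j / 2"] by simp
  then show ?thesis unfolding contract_def by (auto intro!: linear_compose_sum)
qed

lemma alternating_contract:
  assumes "alternating_form (Suc (Suc k)) \<omega>"
  shows "alternating_form k (contract Q \<omega>)"
proof (rule alternating_formI)
  fix us a ms ws
  show "contract Q \<omega> (us @ a # ms @ a # ws) = 0"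
    using alternating_form_repeat[OF assms, of "axis _ 1 # axis _ 1 # us"] by (simp add: contract_def)
qed (simp_all add: contract_length[OF assms] linear_contract_slot[OF assms])

lemma linear_ce_d_contract: "linear (\<lambda>Q. ce_d b (contract Q \<omega>) vs)"
proof -
  have "linear (\<lambda>Q. (-1) ^ (i + j) * contract Q \<omega> ws)" for i j :: nat and ws
    using linear_compose_scale_right[OF linear_contract, of "(-1) ^ (i + j)"] by simp
  then show ?thesis unfolding ce_d_def by (auto intro!: linear_compose_sum)
qed

lemma ce_d_contract_length:
  fixes \<omega> :: "(real^'n) list \<Rightarrow> real"
  assumes "alternating_form CARD('n) \<omega>" "length vs \<noteq> CARD('n) - 1"
  shows "ce_d b (contract Q \<omega>) vs = 0"
proof -
  have "contract Q \<omega> (b (vs ! i) (vs ! j) # remove_nth i (remove_nth j vs)) = 0" if "i < j" "j < length vs" for i j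
    by (rule contract_length[OF assms(1)]) (use that assms(2) in \<open>simp add: length_remove_nth\<close>)
  then show ?thesis unfolding ce_d_def by (auto intro!: sum.neutral)
qed

lemma linear_basis_sum:
  fixes f :: "real^'n \<Rightarrow> 'c::real_vector"
  assumes "linear f"
  shows "f v = (\<Sum>i\<in>UNIV. v $ i *\<^sub>R f (axis i 1))"
proof -
  have "v = (\<Sum>i\<in>UNIV. v $ i *\<^sub>R axis i 1)" using basis_expansion[of v] by (simp add: scalar_mult_eq_scaleR)
  then have "f v = f (\<Sum>i\<in>UNIV. v $ i *\<^sub>R axis i 1)" by simp
  then show ?thesis by (simp add: linear_sum[OF assms] linear_scale[OF assms])
qed

lemma linear_axis_expand:
  fixes f :: "real^'n \<Rightarrow> real"
  shows "linear f \<Longrightarrow> f v = (\<Sum>i\<in>UNIV. v $ i * f (axis i 1))"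
  using linear_basis_sum[of f v] by simp

text \<open>Naturality of contraction under pullback by \<open>T\<close>. Expanding both inserted
  vectors \<open>T (axis _ 1)\<close> in the basis reduces it to a reordering of four finite
  sums.\<close>

lemma contract_push:
  fixes T :: "real^'n \<Rightarrow> real^'n"
  assumes "alternating_form k \<omega>" "linear T"
  shows "contract (push_bivector T Q) \<omega> (map T bs) = contract Q (\<lambda>ws. \<omega> (map T ws)) bs"
proof -
  have T: "T (axis i 1) $ j = matrix T $ j $ i" for i j by (simp add: matrix_def)
  let ?m = "matrix T" and ?w = "\<lambda>k l. \<omega> (axis k 1 # axis l 1 # map T bs)"
  have w: "\<omega> (T (axis i 1) # T (axis j 1) # map T bs) = (\<Sum>k\<in>UNIV. \<Sum>l\<in>UNIV. ?m $ k $ i * ?m $ l $ j * ?w k l)" for i j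
    unfolding linear_axis_expand[OF alternating_form_linear_Cons[OF assms(1)], of "T (axis i 1)"]
    unfolding linear_axis_expand[OF alternating_form_linear_Cons2[OF assms(1)], of _ "T (axis j 1)"]
    by (simp add: T sum_distrib_left mult_ac)
  have "contract (push_bivector T Q) \<omega> (map T bs) =
    (\<Sum>k\<in>UNIV. \<Sum>l\<in>UNIV. (\<Sum>j\<in>UNIV. \<Sum>i\<in>UNIV. ?m $ k $ i * Q $ i $ j * ?m $ l $ j) / 2 * ?w k l)"
    by (simp add: contract_def push_bivector_def matrix_matrix_mult_def transpose_def sum_distrib_right)
  also have "\<dots> = (\<Sum>k\<in>UNIV. \<Sum>l\<in>UNIV. \<Sum>j\<in>UNIV. \<Sum>i\<in>UNIV. Q $ i $ j / 2 * (?m $ k $ i * ?m $ l $ j * ?w k l))"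
    by (simp add: sum_distrib_left sum_distrib_right sum_divide_distrib mult_ac)
  also have "\<dots> = (\<Sum>k\<in>UNIV. \<Sum>j\<in>UNIV. \<Sum>l\<in>UNIV. \<Sum>i\<in>UNIV. Q $ i $ j / 2 * (?m $ k $ i * ?m $ l $ j * ?w k l))"
    by (rule sum.cong[OF refl], rule sum.swap)
  also have "\<dots> = (\<Sum>k\<in>UNIV. \<Sum>j\<in>UNIV. \<Sum>i\<in>UNIV. \<Sum>l\<in>UNIV. Q $ i $ j / 2 * (?m $ k $ i * ?m $ l $ j * ?w k l))"
    by (rule sum.cong[OF refl], rule sum.cong[OF refl], rule sum.swap)
  also have "\<dots> = (\<Sum>j\<in>UNIV. \<Sum>k\<in>UNIV. \<Sum>i\<in>UNIV. \<Sum>l\<in>UNIV. Q $ i $ j / 2 * (?m $ k $ i * ?m $ l $ j * ?w k l))"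
    by (rule sum.swap)
  also have "\<dots> = (\<Sum>j\<in>UNIV. \<Sum>i\<in>UNIV. \<Sum>k\<in>UNIV. \<Sum>l\<in>UNIV. Q $ i $ j / 2 * (?m $ k $ i * ?m $ l $ j * ?w k l))"
    by (rule sum.cong[OF refl], rule sum.swap)
  also have "\<dots> = (\<Sum>i\<in>UNIV. \<Sum>j\<in>UNIV. \<Sum>k\<in>UNIV. \<Sum>l\<in>UNIV. Q $ i $ j / 2 * (?m $ k $ i * ?m $ l $ j * ?w k l))"
    by (rule sum.swap)
  also have "\<dots> = contract Q (\<lambda>ws. \<omega> (map T ws)) bs"
    by (simp add: contract_def w sum_distrib_left)
  finally show ?thesis .
qed

lemma alternating_map:
  assumes "alternating_form k \<omega>" "linear T"
  shows "alternating_form k (\<lambda>ws. \<omega> (map T ws))"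
proof (rule alternating_formI)
  fix us ws
  show "linear (\<lambda>v. \<omega> (map T (us @ v # ws)))"
    using linear_compose[OF assms(2) alternating_form_linear[OF assms(1)]] by (simp add: o_def)
qed (use alternating_form_repeat[OF assms(1)] alternating_form_length[OF assms(1)] in auto)

text \<open>The hypothesis on \<open>\<delta>\<close>, applied to the lists \<open>e\<^sub>i, e\<^sub>j, bs\<close>, moves \<open>\<delta>\<close> from the bivector to \<open>bs\<close>.\<close>

lemma contract_derivation:
  fixes \<delta> :: "real^'n \<Rightarrow> real^'n"
  assumes alt: "alternating_form k \<omega>" and "linear \<delta>"
    and inv: "\<And>vs. length vs = k \<Longrightarrow> (\<Sum>j<length vs. \<omega> (vs[j := \<delta> (vs ! j)])) = 0"
    and len: "Suc (Suc (length bs)) = k"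
  shows "contract (matrix \<delta> ** Q + Q ** transpose (matrix \<delta>)) \<omega> bs =
    - (\<Sum>j<length bs. contract Q \<omega> (bs[j := \<delta> (bs ! j)]))"
proof -
  let ?d = "matrix \<delta>" and ?w = "\<lambda>k l. \<omega> (axis k 1 # axis l 1 # bs)"
  have d: "\<delta> (axis i 1) $ j = ?d $ j $ i" for i j by (simp add: matrix_def)
  have w1: "\<omega> (\<delta> (axis i 1) # axis j 1 # bs) = (\<Sum>k\<in>UNIV. ?d $ k $ i * ?w k j)" for i j
    unfolding linear_axis_expand[OF alternating_form_linear_Cons[OF alt], of "\<delta> (axis i 1)"]
    by (simp add: d)
  have w2: "\<omega> (axis i 1 # \<delta> (axis j 1) # bs) = (\<Sum>k\<in>UNIV. ?d $ k $ j * ?w i k)" for i j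
    unfolding linear_axis_expand[OF alternating_form_linear_Cons2[OF alt], of _ "\<delta> (axis j 1)"]
    by (simp add: d)
  have "\<omega> (\<delta> (axis i 1) # axis j 1 # bs) + \<omega> (axis i 1 # \<delta> (axis j 1) # bs) =
      - (\<Sum>l<length bs. \<omega> (axis i 1 # axis j 1 # bs[l := \<delta> (bs ! l)]))" for i j
  proof -
    have "length (axis i 1 # axis j 1 # bs) = k" using len by simp
    from inv[OF this] show ?thesis
      by (simp add: sum.lessThan_Suc_shift del: sum.lessThan_Suc)
  qed
  then have "- (\<Sum>l<length bs. contract Q \<omega> (bs[l := \<delta> (bs ! l)])) =
      (\<Sum>i\<in>UNIV. \<Sum>j\<in>UNIV. Q $ i $ j / 2 * (\<omega> (\<delta> (axis i 1) # axis j 1 # bs) + \<omega> (axis i 1 # \<delta> (axis j 1) # bs)))"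
    unfolding contract_def by (subst sum_rotate) (simp add: sum_negf sum_distrib_left)
  also have "\<dots> = (\<Sum>i\<in>UNIV. \<Sum>j\<in>UNIV. \<Sum>k\<in>UNIV. Q $ i $ j / 2 * ?d $ k $ i * ?w k j) +
     (\<Sum>i\<in>UNIV. \<Sum>j\<in>UNIV. \<Sum>k\<in>UNIV. Q $ i $ j / 2 * ?d $ k $ j * ?w i k)"
    by (simp add: w1 w2 distrib_left sum.distrib sum_distrib_left mult_ac)
  also have "(\<Sum>i\<in>UNIV. \<Sum>j\<in>UNIV. \<Sum>k\<in>UNIV. Q $ i $ j / 2 * ?d $ k $ i * ?w k j) =
     (\<Sum>j\<in>UNIV. \<Sum>i\<in>UNIV. \<Sum>k\<in>UNIV. Q $ i $ j / 2 * ?d $ k $ i * ?w k j)"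
    by (rule sum.swap)
  also have "\<dots> = (\<Sum>j\<in>UNIV. \<Sum>k\<in>UNIV. \<Sum>i\<in>UNIV. Q $ i $ j / 2 * ?d $ k $ i * ?w k j)"
    by (rule sum.cong[OF refl], rule sum.swap)
  also have "\<dots> = (\<Sum>k\<in>UNIV. \<Sum>j\<in>UNIV. \<Sum>i\<in>UNIV. Q $ i $ j / 2 * ?d $ k $ i * ?w k j)"
    by (rule sum.swap)
  also have "\<dots> = contract (?d ** Q) \<omega> bs"
    by (simp add: contract_def matrix_matrix_mult_def sum_divide_distrib sum_distrib_left sum_distrib_right mult_ac)
  also have "(\<Sum>i\<in>UNIV. \<Sum>j\<in>UNIV. \<Sum>k\<in>UNIV. Q $ i $ j / 2 * ?d $ k $ j * ?w i k) =
    (\<Sum>i\<in>UNIV. \<Sum>k\<in>UNIV. \<Sum>j\<in>UNIV. Q $ i $ j / 2 * ?d $ k $ j * ?w i k)"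
    by (rule sum.cong[OF refl], rule sum.swap)
  also have "\<dots> = contract (Q ** transpose ?d) \<omega> bs"
    by (simp add: contract_def matrix_matrix_mult_def transpose_def sum_divide_distrib sum_distrib_left sum_distrib_right mult_ac)
  finally show ?thesis unfolding contract_add by (rule sym)
qed

lemma bivector_skew: "bivector Q \<Longrightarrow> Q $ k $ l = - Q $ l $ k"
proof -
  assume "bivector Q"
  then have "transpose Q $ l $ k = (- Q) $ l $ k" by (simp only: bivector_def)
  then show ?thesis by (simp add: transpose_def)
qed

text \<open>A top form wedged with a covector vanishes; taking for the covector the entries of \<open>\<xi>\<close> turns
  \<open>\<Sum>\<^sub>i (-1)\<^sup>i (i\<^bsub>\<xi>(a\<^sub>i)\<^esub> \<omega>)(\<dots>)\<close> into an interior product with the trace vector of \<open>\<xi>\<close>.\<close>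

lemma sum_contract_eq_trace:
  fixes \<omega> :: "(real^'n) list \<Rightarrow> real" and \<xi> :: "real^'n \<Rightarrow> real^'n^'n"
  assumes "alternating_form CARD('n) \<omega>" "linear \<xi>" "\<And>u. bivector (\<xi> u)"
  shows "(\<Sum>i<length vs. (-1) ^ i * contract (\<xi> (vs ! i)) \<omega> (remove_nth i vs)) =
    - \<omega> ((\<chi> l. \<Sum>k\<in>UNIV. \<xi> (axis k 1) $ k $ l) # vs)"
proof -
  have skew: "\<xi> u $ k $ l = - \<xi> u $ l $ k" for u k l
    by (rule bivector_skew[OF assms(3)])
  have skew': "\<xi> (axis l 1) $ k $ l * c / 2 = - (\<xi> (axis l 1) $ l $ k * c / 2)" for k l c
    using skew[of "axis l 1" k l] by simp
  have lin: "linear (\<lambda>u. \<xi> u $ k $ l)" for k l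
    using assms(2) by (auto simp: linear_iff)
  \<comment> \<open>The list starts with the two basis vectors that \<open>contract\<close> inserts,
    and the covector is the entry \<open>k\<close>, \<open>l\<close> of \<xi>. The two summands that
    remove one of these vectors form the right-hand side.\<close>
  have wedge: "(\<Sum>i<length vs. (-1) ^ i * \<xi> (vs ! i) $ k $ l * \<omega> (axis k 1 # axis l 1 # remove_nth i vs)) =
     \<xi> (axis l 1) $ k $ l * \<omega> (axis k 1 # vs) - \<xi> (axis k 1) $ k $ l * \<omega> (axis l 1 # vs)" for k l
    using wedge_top_form[OF assms(1) lin[of k l], of "axis k 1 # axis l 1 # vs"]
    by (simp add: sum.lessThan_Suc_shift del: sum.lessThan_Suc)
  have "(\<Sum>i<length vs. (-1) ^ i * contract (\<xi> (vs ! i)) \<omega> (remove_nth i vs)) =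
    (\<Sum>i<length vs. \<Sum>k\<in>UNIV. \<Sum>l\<in>UNIV. ((-1) ^ i * \<xi> (vs ! i) $ k $ l * \<omega> (axis k 1 # axis l 1 # remove_nth i vs)) / 2)"
    by (simp add: contract_def sum_distrib_left mult_ac)
  also have "\<dots> = (\<Sum>k\<in>UNIV. \<Sum>l\<in>UNIV. \<Sum>i<length vs. ((-1) ^ i * \<xi> (vs ! i) $ k $ l * \<omega> (axis k 1 # axis l 1 # remove_nth i vs)) / 2)"
    by (rule sum_rotate)
  also have "\<dots> = (\<Sum>k\<in>UNIV. \<Sum>l\<in>UNIV. (\<xi> (axis l 1) $ k $ l * \<omega> (axis k 1 # vs) - \<xi> (axis k 1) $ k $ l * \<omega> (axis l 1 # vs)) / 2)"
    by (simp add: sum_divide_distrib[symmetric] wedge)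
  also have "\<dots> = (\<Sum>k\<in>UNIV. \<Sum>l\<in>UNIV. \<xi> (axis l 1) $ k $ l * \<omega> (axis k 1 # vs) / 2) -
      (\<Sum>k\<in>UNIV. \<Sum>l\<in>UNIV. \<xi> (axis k 1) $ k $ l * \<omega> (axis l 1 # vs) / 2)"
    by (simp add: sum_subtractf diff_divide_distrib)
  also have "(\<Sum>k\<in>UNIV. \<Sum>l\<in>UNIV. \<xi> (axis l 1) $ k $ l * \<omega> (axis k 1 # vs) / 2) =
      (\<Sum>l\<in>UNIV. \<Sum>k\<in>UNIV. \<xi> (axis l 1) $ k $ l * \<omega> (axis k 1 # vs) / 2)" by (rule sum.swap)
  \<comment> \<open>By skew-symmetry the two double sums are negatives of each other, which cancels
    the factor 1/2 of \<open>contract\<close>.\<close>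
  also have "\<dots> = - (\<Sum>k\<in>UNIV. \<Sum>l\<in>UNIV. \<xi> (axis k 1) $ k $ l * \<omega> (axis l 1 # vs) / 2)"
    by (simp only: skew' sum_negf)
  finally have "(\<Sum>i<length vs. (-1) ^ i * contract (\<xi> (vs ! i)) \<omega> (remove_nth i vs)) =
     - (\<Sum>k\<in>UNIV. \<Sum>l\<in>UNIV. \<xi> (axis k 1) $ k $ l * \<omega> (axis l 1 # vs))"
    by (simp add: sum_divide_distrib[symmetric])
  also have "(\<Sum>k\<in>UNIV. \<Sum>l\<in>UNIV. \<xi> (axis k 1) $ k $ l * \<omega> (axis l 1 # vs)) =
      (\<Sum>l\<in>UNIV. \<Sum>k\<in>UNIV. \<xi> (axis k 1) $ k $ l * \<omega> (axis l 1 # vs))" by (rule sum.swap)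
  also have "\<dots> = \<omega> ((\<chi> l. \<Sum>k\<in>UNIV. \<xi> (axis k 1) $ k $ l) # vs)"
    unfolding linear_axis_expand[OF alternating_form_linear_Cons[OF assms(1)], of "\<chi> l. \<Sum>k\<in>UNIV. \<xi> (axis k 1) $ k $ l"]
    by (simp add: sum_distrib_right)
  finally show ?thesis .
qed

lemma push_bivector_compose:
  "linear S \<Longrightarrow> linear T \<Longrightarrow> push_bivector S (push_bivector T Q) = push_bivector (S \<circ> T) Q"
  by (simp add: push_bivector_def matrix_compose matrix_transpose_mul matrix_mul_assoc)

lemma push_bivector_add: "push_bivector T (Q + R) = push_bivector T Q + push_bivector T R"
  by (simp add: push_bivector_def matrix_matrix_mult_def vec_eq_iff sum.distrib distrib_left distrib_right)

lemma push_bivector_zero [simp]: "push_bivector T 0 = 0"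
  by (simp add: push_bivector_def matrix_matrix_mult_def vec_eq_iff)

lemma push_bivector_ident [simp]: "push_bivector (\<lambda>x. x) Q = Q" "push_bivector id Q = Q"
  by (simp_all add: push_bivector_def matrix_id[unfolded id_def] matrix_id_mat_1[unfolded id_def] id_def)

lemma push_bivector_uminus: "push_bivector T (- Q) = - push_bivector T Q"
  by (simp add: push_bivector_def matrix_matrix_mult_def vec_eq_iff sum_negf)

lemma push_bivector_bivector:
  assumes "bivector Q"
  shows "bivector (push_bivector T Q)"
proof -
  have "transpose (push_bivector T Q) = push_bivector T (transpose Q)"
    by (simp add: push_bivector_def matrix_transpose_mul matrix_mul_assoc)
  then show ?thesis using assms by (simp add: bivector_def push_bivector_uminus)
qed

section \<open>Calculus\<close>

lemma has_derivative_transform_nhds: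
  assumes "(f has_derivative f') (at x)" "\<forall>\<^sub>F y in nhds x. f y = g y"
  shows "(g has_derivative f') (at x)"
proof -
  have "f x = g x" using assms(2) by (rule eventually_nhds_x_imp_x)
  moreover have "\<forall>\<^sub>F y in at x. f y = g y" using assms(2) by (simp add: eventually_at_filter eventually_mono)
  ultimately show ?thesis using has_derivative_transform_eventually[OF assms(1)] by simp
qed

lemma frechet_derivativeI: "(f has_derivative f') (at x) \<Longrightarrow> frechet_derivative f (at x) = f'"
  by (rule frechet_derivative_at[symmetric])

lemma eventually_nhds_open: "open S \<Longrightarrow> x \<in> S \<Longrightarrow> \<forall>\<^sub>F y in nhds x. y \<in> S"
  by (simp add: eventually_nhds) blast

lemma isCont_eventually:
  assumes "isCont f x" "\<forall>\<^sub>F y in nhds (f x). P y"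
  shows "\<forall>\<^sub>F z in nhds x. P (f z)"
proof -
  have "filterlim f (nhds (f x)) (nhds x)" using assms(1) by (simp add: isCont_def tendsto_at_iff_tendsto_nhds)
  then show ?thesis using assms(2) by (simp add: filterlim_iff)
qed

lemma Ck_on_cong:
  assumes "open S" "\<And>x. x \<in> S \<Longrightarrow> f x = g x" "Ck_on k S f"
  shows "Ck_on k S g"
  using assms(2,3)
proof (induction k arbitrary: f g)
  case 0
  then have "continuous_on S f" by simp
  then have "continuous_on S g" by (rule continuous_on_eq) (rule 0)
  then show ?case by simp
next
  case (Suc k)
  have D: "(g has_derivative frechet_derivative f (at x)) (at x)" if "x \<in> S" for x
  proof (rule has_derivative_transform_within_open[OF _ assms(1) that Suc.prems(1)])
    show "(f has_derivative frechet_derivative f (at x)) (at x)"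
      using Suc.prems(2) that by (simp add: frechet_derivative_works[symmetric])
  qed
  then have "frechet_derivative g (at x) = frechet_derivative f (at x)" if "x \<in> S" for x
    using that by (simp add: frechet_derivativeI)
  then have "Ck_on k S (\<lambda>x. frechet_derivative g (at x) v)" for v
    using Suc.IH[of "\<lambda>x. frechet_derivative f (at x) v"] Suc.prems by simp
  then show ?case using D by (auto simp: differentiable_def)
qed

lemma Ck_on_bounded_linear:
  assumes "open S" "bounded_linear L" "Ck_on k S f"
  shows "Ck_on k S (\<lambda>x. L (f x))"
  using assms(3)
proof (induction k arbitrary: f)
  case 0
  then show ?case by (simp add: bounded_linear.continuous_on[OF assms(2)])
next
  case (Suc k)
  have D: "((\<lambda>x. L (f x)) has_derivative (\<lambda>v. L (frechet_derivative f (at x) v))) (at x)" if "x \<in> S" for x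
    using Suc.prems that
    by (intro bounded_linear.has_derivative[OF assms(2)]) (auto simp: frechet_derivative_works[symmetric])
  have "Ck_on k S (\<lambda>x. frechet_derivative (\<lambda>x. L (f x)) (at x) v)" for v
    by (rule Ck_on_cong[OF assms(1) _ Suc.IH[of "\<lambda>x. frechet_derivative f (at x) v"]])
      (use Suc.prems in \<open>simp_all add: frechet_derivativeI[OF D]\<close>)
  then show ?case using D by (auto simp: differentiable_def)
qed

section \<open>Symmetry of second derivatives\<close>

definition second_derivative ::
  "('a::real_normed_vector \<Rightarrow> 'b::real_normed_vector) \<Rightarrow> 'a \<Rightarrow> 'a \<Rightarrow> 'a \<Rightarrow> 'b" where
  "second_derivative f x v = frechet_derivative (\<lambda>y. frechet_derivative f (at y) v) (at x)"

lemma smooth_on_has_derivative: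
  "smooth_on S f \<Longrightarrow> x \<in> S \<Longrightarrow> (f has_derivative frechet_derivative f (at x)) (at x)"
  by (auto simp: smooth_on_def frechet_derivative_works[symmetric] dest: spec[of _ "Suc 0"])

lemma smooth_on_has_second_derivative:
  assumes "smooth_on S f" "x \<in> S"
  shows "((\<lambda>y. frechet_derivative f (at y) v) has_derivative second_derivative f x v) (at x)"
proof -
  have "Ck_on (Suc (Suc 0)) S f" using assms(1) by (simp only: smooth_on_def)
  then show ?thesis using assms(2) by (simp add: second_derivative_def frechet_derivative_works[symmetric])
qed

text \<open>The second difference is symmetric in \<open>u\<close> and \<open>v\<close>, so its
  limit yields the symmetry of second derivatives. The mean value theorem, once in direction
  \<open>u\<close> and once in direction \<open>v\<close>, writes the quotient as the mixed
  derivative at a point near \<open>x\<close>; continuity of that derivative does the rest.\<close>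

lemma second_difference_tendsto:
  fixes f :: "'a::real_normed_vector \<Rightarrow> real"
  assumes "open S" "Ck_on 2 S f" "x \<in> S"
  shows "((\<lambda>t. (f (x + t *\<^sub>R u + t *\<^sub>R v) - f (x + t *\<^sub>R u) - f (x + t *\<^sub>R v) + f x) / t\<^sup>2)
    \<longlongrightarrow> second_derivative f x u v) (at_right 0)"
proof (rule tendstoI)
  fix e :: real assume "0 < e"
  have C: "Ck_on (Suc (Suc 0)) S f" using assms(2) by (simp add: numeral_2_eq_2)
  have D1: "(f has_derivative frechet_derivative f (at y)) (at y)" if "y \<in> S" for y
    using C that by (simp add: frechet_derivative_works[symmetric])
  have D2: "((\<lambda>y. frechet_derivative f (at y) u) has_derivative second_derivative f y u) (at y)" if "y \<in> S" for y
    using C that by (simp add: frechet_derivative_works[symmetric] second_derivative_def)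
  have "continuous_on S (\<lambda>y. second_derivative f y u v)"
    using C by (simp add: second_derivative_def)
  then have "isCont (\<lambda>y. second_derivative f y u v) x"
    using assms(1,3) by (simp add: continuous_on_eq_continuous_at)
  then have "\<forall>\<^sub>F y in nhds x. dist (second_derivative f y u v) (second_derivative f x u v) < e"
    by (rule isCont_eventually) (use \<open>0 < e\<close> in \<open>auto simp only: eventually_nhds_metric\<close>)
  with eventually_nhds_open[OF assms(1,3)]
  have "\<forall>\<^sub>F y in nhds x. y \<in> S \<and> dist (second_derivative f y u v) (second_derivative f x u v) < e"
    by (rule eventually_conj)
  then obtain d where d: "d > 0" "\<And>y. dist y x < d \<Longrightarrow> y \<in> S"
      "\<And>y. dist y x < d \<Longrightarrow> dist (second_derivative f y u v) (second_derivative f x u v) < e"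
    by (auto simp: eventually_nhds_metric)
  \<comment> \<open>All intermediate points are \<open>x\<close> plus multiples of \<open>u\<close>
    and \<open>v\<close> by factors in [0, r), hence within \<open>d\<close> of \<open>x\<close>;
    the summand 1 keeps the denominator positive.\<close>
  define r where "r = d / (norm u + norm v + 1)"
  have r: "r > 0" using d(1) by (simp add: r_def add_nonneg_pos)
  have near: "dist (x + s *\<^sub>R u + s' *\<^sub>R v) x < d" if "0 \<le> s" "0 \<le> s'" "s \<le> t" "s' \<le> t" "t < r" for s s' t
  proof -
    have "dist (x + s *\<^sub>R u + s' *\<^sub>R v) x \<le> norm (s *\<^sub>R u) + norm (s' *\<^sub>R v)"
      by (simp add: dist_norm) (metis add.assoc add_diff_cancel_left' norm_scaleR norm_triangle_ineq)
    also have "\<dots> \<le> t * norm u + t * norm v" using that by (simp add: add_mono mult_right_mono)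
    also have "\<dots> \<le> t * (norm u + norm v + 1)" using that by (simp add: algebra_simps)
    also have "\<dots> < r * (norm u + norm v + 1)"
      using that by (intro mult_strict_right_mono) (auto simp: add_nonneg_pos)
    also have "\<dots> = d" using add_nonneg_pos[of "norm u + norm v" 1] by (simp add: r_def)
    finally show ?thesis .
  qed
  show "\<forall>\<^sub>F t in at_right 0. dist ((f (x + t *\<^sub>R u + t *\<^sub>R v) - f (x + t *\<^sub>R u) - f (x + t *\<^sub>R v) + f x) / t\<^sup>2)
      (second_derivative f x u v) < e"
    unfolding eventually_at_right_field
  proof (intro exI[of _ r] conjI allI impI r)
    fix t :: real assume t: "0 < t" "t < r"
    \<comment> \<open>\<open>g\<close> is the increment in direction \<open>v\<close> as a function
      of the step along \<open>u\<close>. The summand \<open>0 *\<^sub>R v\<close> gives both terms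
      the same shape, so that one derivative fact serves both.\<close>
    define g where "g s = f (x + s *\<^sub>R u + t *\<^sub>R v) - f (x + s *\<^sub>R u + 0 *\<^sub>R v)" for s
    define g' where "g' s = frechet_derivative f (at (x + s *\<^sub>R u + t *\<^sub>R v)) u
      - frechet_derivative f (at (x + s *\<^sub>R u + 0 *\<^sub>R v)) u" for s
    have g: "(g has_derivative (\<lambda>h. h *\<^sub>R g' s)) (at s within {0..t})" if "s \<in> {0..t}" for s
    proof -
      have inS: "x + s *\<^sub>R u + t *\<^sub>R v \<in> S" "x + s *\<^sub>R u + 0 *\<^sub>R v \<in> S"
        using that t by (auto intro!: d(2) near[of _ _ t, simplified] near[of s 0 t, simplified])
      have a: "((\<lambda>s. f (x + s *\<^sub>R u + c *\<^sub>R v)) has_derivative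
          (\<lambda>h. frechet_derivative f (at (x + s *\<^sub>R u + c *\<^sub>R v)) (h *\<^sub>R u))) (at s within {0..t})"
        if "x + s *\<^sub>R u + c *\<^sub>R v \<in> S" for c
        by (rule has_derivative_compose[where f = "\<lambda>s. x + s *\<^sub>R u + c *\<^sub>R v", OF _ D1[OF that]]) (auto intro!: derivative_eq_intros)
      have b: "frechet_derivative f (at y) (h *\<^sub>R u) = h *\<^sub>R frechet_derivative f (at y) u" if "y \<in> S" for y h
        using D1[OF that] by (metis has_derivative_linear linear_scale)
      show ?thesis
        unfolding g_def g'_def scaleR_diff_right b[OF inS(1), symmetric] b[OF inS(2), symmetric]
        by (intro has_derivative_diff a inS)
    qed
    obtain s where s: "s \<in> {0<..<t}" "g t - g 0 = (t - 0) *\<^sub>R g' s"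
      using mvt_simple[OF t(1), of g "\<lambda>s h. h *\<^sub>R g' s"] g by auto
    define h where "h \<sigma> = frechet_derivative f (at (x + s *\<^sub>R u + \<sigma> *\<^sub>R v)) u" for \<sigma>
    have h: "(h has_derivative (\<lambda>k. k *\<^sub>R second_derivative f (x + s *\<^sub>R u + \<sigma> *\<^sub>R v) u v)) (at \<sigma> within {0..t})"
      if "\<sigma> \<in> {0..t}" for \<sigma>
    proof -
      have inS: "x + s *\<^sub>R u + \<sigma> *\<^sub>R v \<in> S"
        using that t s by (auto intro!: d(2) near[of s \<sigma> t])
      have b: "second_derivative f (x + s *\<^sub>R u + \<sigma> *\<^sub>R v) u (k *\<^sub>R v)
          = k *\<^sub>R second_derivative f (x + s *\<^sub>R u + \<sigma> *\<^sub>R v) u v" for k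
        using D2[OF inS] by (metis has_derivative_linear linear_scale)
      show ?thesis unfolding h_def b[symmetric]
        by (rule has_derivative_compose[where f = "\<lambda>\<sigma>. x + s *\<^sub>R u + \<sigma> *\<^sub>R v", OF _ D2[OF inS]])
          (auto intro!: derivative_eq_intros)
    qed
    obtain \<sigma> where \<sigma>: "\<sigma> \<in> {0<..<t}" "h t - h 0 = (t - 0) *\<^sub>R second_derivative f (x + s *\<^sub>R u + \<sigma> *\<^sub>R v) u v"
      using mvt_simple[OF t(1), of h "\<lambda>\<sigma> k. k *\<^sub>R second_derivative f (x + s *\<^sub>R u + \<sigma> *\<^sub>R v) u v"] h by auto
    have "g' s = h t - h 0" by (simp add: g'_def h_def)
    then have eq: "f (x + t *\<^sub>R u + t *\<^sub>R v) - f (x + t *\<^sub>R u) - f (x + t *\<^sub>R v) + f x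
        = t\<^sup>2 * second_derivative f (x + s *\<^sub>R u + \<sigma> *\<^sub>R v) u v"
      using s(2) \<sigma>(2) by (simp add: g_def power2_eq_square algebra_simps)
    have "dist (second_derivative f (x + s *\<^sub>R u + \<sigma> *\<^sub>R v) u v) (second_derivative f x u v) < e"
      using s(1) \<sigma>(1) t by (intro d(3) near[of _ _ t]) auto
    then show "dist ((f (x + t *\<^sub>R u + t *\<^sub>R v) - f (x + t *\<^sub>R u) - f (x + t *\<^sub>R v) + f x) / t\<^sup>2)
      (second_derivative f x u v) < e" unfolding eq using t(1) by simp
  qed
qed

text \<open>The mean value theorem concerns real functions, so the components are treated one by
  one. Both orders of differentiation are limits of the same symmetric quotient.\<close>

lemma second_derivative_symmetric:
  fixes f :: "'a::real_normed_vector \<Rightarrow> real^'n"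
  assumes "open S" "smooth_on S f" "x \<in> S"
  shows "second_derivative f x u v = second_derivative f x v u"
proof -
  have "second_derivative f x u v $ i = second_derivative f x v u $ i" for i
  proof -
    have C: "Ck_on 2 S (\<lambda>y. f y $ i)"
      by (rule Ck_on_bounded_linear[OF assms(1) bounded_linear_vec_nth])
        (use assms(2) in \<open>simp add: smooth_on_def\<close>)
    have D1: "((\<lambda>y. f y $ i) has_derivative (\<lambda>v. frechet_derivative f (at y) v $ i)) (at y)" if "y \<in> S" for y
      by (rule bounded_linear.has_derivative[OF bounded_linear_vec_nth smooth_on_has_derivative[OF assms(2) that]])
    have "second_derivative (\<lambda>y. f y $ i) x u = (\<lambda>w. second_derivative f x u w $ i)" for u
      unfolding second_derivative_def[of "\<lambda>y. f y $ i"]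
      by (rule frechet_derivativeI, rule has_derivative_transform_within_open[OF
            bounded_linear.has_derivative[OF bounded_linear_vec_nth smooth_on_has_second_derivative[OF assms(2,3)]] assms(1,3)])
        (simp add: frechet_derivativeI[OF D1])
    moreover have "second_derivative (\<lambda>y. f y $ i) x u v = second_derivative (\<lambda>y. f y $ i) x v u"
    proof (rule tendsto_unique)
      show "((\<lambda>t. (f (x + t *\<^sub>R u + t *\<^sub>R v) $ i - f (x + t *\<^sub>R u) $ i - f (x + t *\<^sub>R v) $ i + f x $ i) / t\<^sup>2)
        \<longlongrightarrow> second_derivative (\<lambda>y. f y $ i) x v u) (at_right 0)"
        using second_difference_tendsto[OF assms(1) C assms(3), of v u] by (simp add: algebra_simps)
      show "((\<lambda>t. (f (x + t *\<^sub>R u + t *\<^sub>R v) $ i - f (x + t *\<^sub>R u) $ i - f (x + t *\<^sub>R v) $ i + f x $ i) / t\<^sup>2)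
        \<longlongrightarrow> second_derivative (\<lambda>y. f y $ i) x u v) (at_right 0)"
        using second_difference_tendsto[OF assms(1) C assms(3), of u v] .
    qed simp
    ultimately show ?thesis by simp
  qed
  then show ?thesis by (simp add: vec_eq_iff)
qed

section \<open>Product and chain rules for families of linear and multilinear maps\<close>

lemma has_derivative_slice2:
  "(f has_derivative f') (at (x, y)) \<Longrightarrow> ((\<lambda>y. f (x, y)) has_derivative (\<lambda>v. f' (0, v))) (at y)"
  by (rule has_derivative_compose[of "\<lambda>y. (x, y)" "\<lambda>v. (0, v)"]) (auto intro!: derivative_eq_intros)

lemma has_derivative_slice1:
  "(f has_derivative f') (at (x, y)) \<Longrightarrow> ((\<lambda>x. f (x, y)) has_derivative (\<lambda>v. f' (v, 0))) (at x)"
  by (rule has_derivative_compose[of "\<lambda>x. (x, y)" "\<lambda>v. (v, 0)"]) (auto intro!: derivative_eq_intros)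

lemma eventually_nhds_slice2:
  fixes W :: "('a::t2_space \<times> 'b::t2_space) set"
  assumes "open W" "(x, y) \<in> W"
  shows "\<forall>\<^sub>F y in nhds y. (x, y) \<in> W"
proof -
  have "isCont (\<lambda>y. (x, y)) y" by (intro continuous_intros)
  then show ?thesis by (rule isCont_eventually) (rule eventually_nhds_open[OF assms])
qed

lemma eventually_nhds_slice1:
  fixes W :: "('a::t2_space \<times> 'b::t2_space) set"
  assumes "open W" "(x, y) \<in> W"
  shows "\<forall>\<^sub>F x in nhds x. (x, y) \<in> W"
proof -
  have "isCont (\<lambda>x. (x, y)) x" by (intro continuous_intros)
  then show ?thesis by (rule isCont_eventually) (rule eventually_nhds_open[OF assms])
qed

text \<open>Additivity and homogeneity of \<open>D z\<close> survive differentiation in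
  \<open>z\<close>. This supplies the linearity of \<open>br a\<close>, which is not evident from
  its definition through charts.\<close>

lemma linear_derivative_parameter:
  assumes "\<forall>\<^sub>F z in nhds x. linear (D z)"
    and D: "\<And>v. ((\<lambda>z. D z v) has_derivative (\<lambda>a. D' a v)) (at x)"
  shows "linear (D' a)"
proof (rule linearI)
  fix u v
  have "((\<lambda>z. D z u + D z v) has_derivative (\<lambda>a. D' a u + D' a v)) (at x)"
    by (intro has_derivative_add D)
  then have "((\<lambda>z. D z (u + v)) has_derivative (\<lambda>a. D' a u + D' a v)) (at x)"
    by (rule has_derivative_transform_nhds) (use assms(1) in \<open>eventually_elim, simp add: linear_add\<close>)
  from has_derivative_unique[OF this D] show "D' a (u + v) = D' a u + D' a v" by metis
next
  fix c v
  have "((\<lambda>z. c *\<^sub>R D z v) has_derivative (\<lambda>a. c *\<^sub>R D' a v)) (at x)"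
    by (intro has_derivative_scaleR_right D)
  then have "((\<lambda>z. D z (c *\<^sub>R v)) has_derivative (\<lambda>a. c *\<^sub>R D' a v)) (at x)"
    by (rule has_derivative_transform_nhds) (use assms(1) in \<open>eventually_elim, simp add: linear_scale\<close>)
  from has_derivative_unique[OF this D] show "D' a (c *\<^sub>R v) = c *\<^sub>R D' a v" by metis
qed

text \<open>Product rule for evaluation at a moving vector, when differentiability of
  \<open>D\<close> is known only at each fixed vector. Expanding \<open>w z\<close> in the basis
  leaves finitely many fixed vectors.\<close>

lemma has_derivative_apply_linear:
  fixes D :: "'a::real_normed_vector \<Rightarrow> real^'n \<Rightarrow> 'c::real_normed_vector"
  assumes lin: "\<forall>\<^sub>F z in nhds x. linear (D z)"
    and D: "\<And>v. ((\<lambda>z. D z v) has_derivative (\<lambda>a. D' a v)) (at x)"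
    and w: "(w has_derivative w') (at x)"
  shows "((\<lambda>z. D z (w z)) has_derivative (\<lambda>a. D' a (w x) + D x (w' a))) (at x)"
proof -
  have linx: "linear (D x)" using lin by (rule eventually_nhds_x_imp_x)
  have wi: "((\<lambda>z. w z $ i) has_derivative (\<lambda>a. w' a $ i)) (at x)" for i
    by (rule bounded_linear.has_derivative[OF bounded_linear_vec_nth w])
  have expand: "\<forall>\<^sub>F z in nhds x. (\<Sum>i\<in>UNIV. u z $ i *\<^sub>R D z (axis i 1)) = D z (u z)" for u :: "'a \<Rightarrow> real^'n"
    using lin by eventually_elim (rule linear_basis_sum[symmetric])
  \<comment> \<open>With the vector frozen at \<open>w x\<close>, uniqueness of derivatives gives
    the basis expansion of \<open>D' a (w x)\<close> without a separate proof that
    \<open>D' a\<close> is linear.\<close>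
  have "((\<lambda>z. \<Sum>i\<in>UNIV. w x $ i *\<^sub>R D z (axis i 1)) has_derivative (\<lambda>a. \<Sum>i\<in>UNIV. w x $ i *\<^sub>R D' a (axis i 1))) (at x)"
    by (intro derivative_intros D)
  from has_derivative_transform_nhds[OF this expand[of "\<lambda>_. w x"]]
  have D': "(\<lambda>a. \<Sum>i\<in>UNIV. w x $ i *\<^sub>R D' a (axis i 1)) = (\<lambda>a. D' a (w x))"
    by (rule has_derivative_unique[OF _ D])
  have "((\<lambda>z. \<Sum>i\<in>UNIV. w z $ i *\<^sub>R D z (axis i 1)) has_derivative
      (\<lambda>a. \<Sum>i\<in>UNIV. w x $ i *\<^sub>R D' a (axis i 1) + w' a $ i *\<^sub>R D x (axis i 1))) (at x)"
    by (intro has_derivative_sum has_derivative_scaleR wi D)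
  from has_derivative_transform_nhds[OF this expand]
  show ?thesis by (simp add: sum.distrib fun_cong[OF D'] linear_basis_sum[OF linx, of "w' _"])
qed

text \<open>Differentiating the intertwining relation \<open>\<phi>(m(z, y)) = n(\<phi>(z), \<kappa>(y))\<close> in \<open>y\<close> and then in
  \<open>z\<close>. With \<open>\<phi>\<close> a left translation this is the structure equation of the left invariant frame, with
  \<open>\<phi>\<close> a right translation it shows that the adjoint representation preserves the bracket.\<close>

lemma intertwining_second_order:
  fixes \<phi> :: "real^'n \<Rightarrow> real^'n" and m n :: "real^'n \<Rightarrow> real^'n \<Rightarrow> real^'n"
  assumes \<phi>: "\<forall>\<^sub>F z in nhds x. (\<phi> has_derivative \<phi>' z) (at z)"
    and \<phi>2: "\<And>v. ((\<lambda>z. \<phi>' z v) has_derivative (\<lambda>a. \<phi>'' a v)) (at x)"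
    and M: "\<forall>\<^sub>F z in nhds x. ((\<lambda>y. m z y) has_derivative M z) (at x)"
    and M2: "\<And>v. ((\<lambda>z. M z v) has_derivative (\<lambda>a. B a v)) (at x)"
    and Mx: "\<And>v. M x v = v"
    and m: "\<forall>\<^sub>F z in nhds x. m z x = z"
    and X: "\<forall>\<^sub>F z in nhds (\<phi> x). ((\<lambda>y. n z y) has_derivative X z) (at (\<kappa> x))"
    and X2: "\<And>v. ((\<lambda>z. X z v) has_derivative (\<lambda>a. C a v)) (at (\<phi> x))"
    and \<kappa>: "(\<kappa> has_derivative K) (at x)"
    and rel: "\<forall>\<^sub>F z in nhds x. \<forall>\<^sub>F y in nhds x. \<phi> (m z y) = n (\<phi> z) (\<kappa> y)"
  shows "\<phi>'' a b + \<phi>' x (B a b) = C (\<phi>' x a) (K b)"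
proof -
  have \<phi>x: "(\<phi> has_derivative \<phi>' x) (at x)" using \<phi> by (rule eventually_nhds_x_imp_x)
  then have "isCont \<phi> x" by (rule has_derivative_continuous)
  from isCont_eventually[OF this X] \<phi> M m rel
  have eq: "\<forall>\<^sub>F z in nhds x. \<phi>' z (M z b) = X (\<phi> z) (K b)"
  proof eventually_elim
    case (elim z)
    have "((\<lambda>y. \<phi> (m z y)) has_derivative (\<lambda>b. \<phi>' z (M z b))) (at x)"
      using has_derivative_compose[OF elim(3), of \<phi> "\<phi>' z"] elim(2,4) by simp
    moreover have "((\<lambda>y. n (\<phi> z) (\<kappa> y)) has_derivative (\<lambda>b. X (\<phi> z) (K b))) (at x)"
      using has_derivative_compose[OF \<kappa>, of "n (\<phi> z)" "X (\<phi> z)"] elim(1) by simp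
    then have "((\<lambda>y. \<phi> (m z y)) has_derivative (\<lambda>b. X (\<phi> z) (K b))) (at x)"
      by (rule has_derivative_transform_nhds) (use elim(5) in \<open>simp add: eq_commute\<close>)
    ultimately have "(\<lambda>b. \<phi>' z (M z b)) = (\<lambda>b. X (\<phi> z) (K b))" by (rule has_derivative_unique)
    then show ?case by (rule fun_cong)
  qed
  have "((\<lambda>z. \<phi>' z (M z b)) has_derivative (\<lambda>a. \<phi>'' a (M x b) + \<phi>' x (B a b))) (at x)"
    by (rule has_derivative_apply_linear[OF _ \<phi>2 M2]) (rule eventually_mono[OF \<phi>], rule has_derivative_linear)
  from has_derivative_transform_nhds[OF this eq]
  have "((\<lambda>z. X (\<phi> z) (K b)) has_derivative (\<lambda>a. \<phi>'' a b + \<phi>' x (B a b))) (at x)" by (simp add: Mx)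
  moreover have "((\<lambda>z. X (\<phi> z) (K b)) has_derivative (\<lambda>a. C (\<phi>' x a) (K b))) (at x)"
    by (rule has_derivative_compose[OF \<phi>x X2])
  ultimately have "(\<lambda>a. \<phi>'' a b + \<phi>' x (B a b)) = (\<lambda>a. C (\<phi>' x a) (K b))" by (rule has_derivative_unique)
  then show ?thesis by (rule fun_cong)
qed

text \<open>The fixed prefix \<open>us\<close> carries the induction: the first moving vector is
  frozen and joins the prefix, and its own motion is added by
  \<open>has_derivative_apply_linear\<close>.\<close>

lemma has_derivative_multilinear:
  fixes \<Lambda> :: "'a::real_normed_vector \<Rightarrow> (real^'n) list \<Rightarrow> real"
  assumes lin': "\<forall>\<^sub>F x in nhds x0. \<forall>us ws. linear (\<lambda>v. \<Lambda> x (us @ v # ws))"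
    and \<Lambda>: "\<And>vs. ((\<lambda>x. \<Lambda> x vs) has_derivative (\<lambda>a. \<Lambda>' a vs)) (at x0)"
    and X: "\<And>b. ((\<lambda>x. X x b) has_derivative (\<lambda>a. X' a b)) (at x0)"
  shows "((\<lambda>x. \<Lambda> x (us @ map (X x) bs)) has_derivative
    (\<lambda>a. \<Lambda>' a (us @ map (X x0) bs) +
      (\<Sum>j<length bs. \<Lambda> x0 (us @ (map (X x0) bs)[j := X' a (bs ! j)])))) (at x0)"
proof (induction bs arbitrary: us)
  case Nil
  then show ?case using \<Lambda> by simp
next
  case (Cons b bs)
  have "((\<lambda>x. \<Lambda> x (us @ X x b # map (X x) bs)) has_derivative
    (\<lambda>a. (\<Lambda>' a ((us @ [X x0 b]) @ map (X x0) bs) +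
      (\<Sum>j<length bs. \<Lambda> x0 ((us @ [X x0 b]) @ (map (X x0) bs)[j := X' a (bs ! j)]))) +
      \<Lambda> x0 (us @ X' a b # map (X x0) bs))) (at x0)"
  proof (rule has_derivative_apply_linear[where D = "\<lambda>x v. \<Lambda> x (us @ v # map (X x) bs)"])
    show "\<forall>\<^sub>F x in nhds x0. linear (\<lambda>v. \<Lambda> x (us @ v # map (X x) bs))"
      using lin' by eventually_elim blast
    show "((\<lambda>x. \<Lambda> x (us @ v # map (X x) bs)) has_derivative
      (\<lambda>a. \<Lambda>' a ((us @ [v]) @ map (X x0) bs) +
        (\<Sum>j<length bs. \<Lambda> x0 ((us @ [v]) @ (map (X x0) bs)[j := X' a (bs ! j)])))) (at x0)" for v
      using Cons[of "us @ [v]"] by simp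
  qed (rule X)
  then show ?case
    by (simp add: sum.lessThan_Suc_shift algebra_simps del: sum.lessThan_Suc)
qed

section \<open>Derivatives of matrix valued functions and of solutions of linear systems\<close>

lemma has_derivative_linear_comp:
  fixes L :: "'b::euclidean_space \<Rightarrow> 'c::real_normed_vector"
  assumes "linear L" "(f has_derivative f') F"
  shows "((\<lambda>x. L (f x)) has_derivative (\<lambda>a. L (f' a))) F"
  using assms bounded_linear.has_derivative linear_conv_bounded_linear by blast

lemma has_derivative_vec_componentwise:
  fixes f :: "'a::real_normed_vector \<Rightarrow> 'b::euclidean_space^'n"
  assumes "\<And>i. ((\<lambda>x. f x $ i) has_derivative (\<lambda>a. f' a $ i)) (at x)"
  shows "(f has_derivative f') (at x)"
proof -
  have "((\<lambda>x. f x \<bullet> b) has_derivative (\<lambda>a. f' a \<bullet> b)) (at x)" if "b \<in> Basis" for b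
  proof -
    from that obtain i c where b: "b = axis i c" by (auto simp: Basis_vec_def)
    have "((\<lambda>x. f x $ i \<bullet> c) has_derivative (\<lambda>a. f' a $ i \<bullet> c)) (at x)"
      by (rule bounded_linear.has_derivative[OF bounded_linear_inner_left assms])
    then show ?thesis by (simp add: b inner_axis)
  qed
  then show ?thesis using has_derivative_componentwise_within[of f f' x UNIV] by simp
qed

lemma differentiable_vec_componentwise:
  fixes f :: "'a::real_normed_vector \<Rightarrow> 'b::euclidean_space^'n"
  assumes "\<And>i. (\<lambda>x. f x $ i) differentiable (at x)"
  shows "f differentiable (at x)"
proof -
  have "((\<lambda>x. f x $ i) has_derivative (\<lambda>a. (\<chi> i. frechet_derivative (\<lambda>x. f x $ i) (at x) a) $ i)) (at x)" for i
    using assms[of i] by (simp add: frechet_derivative_works[symmetric] eta_contract_eq)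
  from has_derivative_vec_componentwise[OF this] show ?thesis by (auto simp: differentiable_def)
qed

lemma differentiable_vec_nth:
  "f differentiable (at x) \<Longrightarrow> (\<lambda>x. f x $ i) differentiable (at x)"
  unfolding differentiable_def using bounded_linear.has_derivative[OF bounded_linear_vec_nth] by blast

lemma differentiable_det:
  fixes F :: "'a::real_normed_vector \<Rightarrow> real^'n^'n"
  assumes "\<And>i j. (\<lambda>z. F z $ i $ j) differentiable (at x)"
  shows "(\<lambda>z. det (F z)) differentiable (at x)"
proof -
  have "(\<lambda>z. \<Prod>i\<in>UNIV. F z $ i $ p i) differentiable (at x)" for p
  proof -
    have d: "((\<lambda>z. F z $ i $ p i) has_derivative frechet_derivative (\<lambda>z. F z $ i $ p i) (at x)) (at x)" for i
      using assms by (simp add: frechet_derivative_works[symmetric])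
    show ?thesis by (rule differentiableI, rule has_derivative_prod, rule d)
  qed
  then show ?thesis unfolding det_def
    by (intro differentiable_sum finite_permutations differentiable_mult differentiable_const) auto
qed

text \<open>Cramer's rule exhibits the solution of a differentiable linear system as differentiable.\<close>

lemma differentiable_linear_solution:
  fixes M :: "'a::real_normed_vector \<Rightarrow> real^'n \<Rightarrow> real^'n"
  assumes lin: "\<forall>\<^sub>F z in nhds x. linear (M z) \<and> inj (M z)"
    and M: "\<And>v. (\<lambda>z. M z v) differentiable (at x)"
    and b: "b differentiable (at x)"
    and eq: "\<forall>\<^sub>F z in nhds x. M z (u z) = b z"
  shows "u differentiable (at x)"
proof -
  let ?A = "\<lambda>z. matrix (M z)"
  have A: "(\<lambda>z. ?A z $ i $ j) differentiable (at x)" for i j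
    unfolding matrix_def using differentiable_vec_nth[OF M[of "axis j 1"]] by simp
  have dA: "det (?A z) \<noteq> 0" if "linear (M z) \<and> inj (M z)" for z
    using that det_nz_iff_inj by blast
  have "(\<lambda>z. det (\<chi> i j. if j = k then b z $ i else ?A z $ i $ j) / det (?A z)) differentiable (at x)" for k
  proof (rule differentiable_divide)
    show "(\<lambda>z. det (\<chi> i j. if j = k then b z $ i else ?A z $ i $ j)) differentiable at x"
    proof (rule differentiable_det)
      fix i j
      show "(\<lambda>z. (\<chi> i j. if j = k then b z $ i else ?A z $ i $ j) $ i $ j) differentiable at x"
        using differentiable_vec_nth[OF b, of i] A[of i j] by (cases "j = k") simp_all
    qed
    show "(\<lambda>z. det (?A z)) differentiable at x" by (rule differentiable_det[OF A])
    show "det (?A x) \<noteq> 0" using dA eventually_nhds_x_imp_x[OF lin] by blast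
  qed
  then have "(\<lambda>z. \<chi> k. det (\<chi> i j. if j = k then b z $ i else ?A z $ i $ j) / det (?A z)) differentiable (at x)"
    by (intro differentiable_vec_componentwise) simp
  then obtain D where D: "((\<lambda>z. \<chi> k. det (\<chi> i j. if j = k then b z $ i else ?A z $ i $ j) / det (?A z)) has_derivative D) (at x)"
    by (auto simp: differentiable_def)
  have "\<forall>\<^sub>F z in nhds x. (\<chi> k. det (\<chi> i j. if j = k then b z $ i else ?A z $ i $ j) / det (?A z)) = u z"
    using lin eq
  proof eventually_elim
    case (elim z)
    then have "?A z *v u z = b z" by (simp add: matrix_works)
    then show ?case using cramer[OF dA[OF elim(1)], of "u z" "b z"] by simp
  qed
  from has_derivative_transform_nhds[OF D this] show ?thesis by (auto simp: differentiable_def)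
qed

lemma bounded_bilinear_matrix_mult:
  "bounded_bilinear (\<lambda>(M::real^'n^'m) (N::real^'k^'n). M ** N)"
proof -
  have "bilinear (\<lambda>(M::real^'n^'m) (N::real^'k^'n). M ** N)"
    unfolding bilinear_def
    by (auto intro!: linearI simp: vec_eq_iff matrix_matrix_mult_def sum.distrib sum_distrib_left algebra_simps)
  then show ?thesis by (simp add: bilinear_conv_bounded_bilinear)
qed

lemma linear_transpose: "linear (transpose :: real^'n^'m \<Rightarrow> _)"
  by (rule linearI) (simp_all add: transpose_def vec_eq_iff)

lemma has_derivative_matrix:
  fixes T :: "'a::real_normed_vector \<Rightarrow> real^'n \<Rightarrow> real^'m"
  assumes "\<And>v. ((\<lambda>z. T z v) has_derivative (\<lambda>a. T' a v)) (at x)"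
  shows "((\<lambda>z. matrix (T z)) has_derivative (\<lambda>a. matrix (T' a))) (at x)"
proof (rule has_derivative_vec_componentwise, rule has_derivative_vec_componentwise)
  fix i j
  show "((\<lambda>z. matrix (T z) $ i $ j) has_derivative (\<lambda>a. matrix (T' a) $ i $ j)) (at x)"
    using bounded_linear.has_derivative[OF bounded_linear_vec_nth assms] by (simp add: matrix_def)
qed

lemma push_bivector_has_derivative:
  fixes T :: "'a::real_normed_vector \<Rightarrow> real^'n \<Rightarrow> real^'n"
  assumes T: "\<And>v. ((\<lambda>z. T z v) has_derivative (\<lambda>a. T' a v)) (at x)"
    and Q: "(Q has_derivative Q') (at x)"
  shows "((\<lambda>z. push_bivector (T z) (Q z)) has_derivative
    (\<lambda>a. matrix (T' a) ** Q x ** transpose (matrix (T x)) + push_bivector (T x) (Q' a) +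
      matrix (T x) ** Q x ** transpose (matrix (T' a)))) (at x)"
proof -
  note mult = bounded_bilinear.FDERIV[OF bounded_bilinear_matrix_mult]
  have "((\<lambda>z. push_bivector (T z) (Q z)) has_derivative
    (\<lambda>a. (matrix (T x) ** Q x) ** transpose (matrix (T' a)) +
      (matrix (T x) ** Q' a + matrix (T' a) ** Q x) ** transpose (matrix (T x)))) (at x)"
    unfolding push_bivector_def
    by (rule mult[OF mult[OF has_derivative_matrix[OF T] Q] has_derivative_linear_comp[OF linear_transpose has_derivative_matrix[OF T]]])
  then show ?thesis
    by (simp add: push_bivector_def matrix_add_ldistrib bounded_bilinear.add_left[OF bounded_bilinear_matrix_mult] algebra_simps)
qed

text \<open>Linear systems are solved twice. The columns of \<open>Y\<close>, the product of
  \<open>Q\<close> with the transpose of \<open>M\<close>, solve a system whose right-hand sides are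
  the columns of \<open>R\<close>; then the rows of \<open>Q\<close> solve one whose right-hand
  sides are the rows of \<open>Y\<close>.\<close>

lemma differentiable_push_bivector_cancel:
  fixes M :: "'a::real_normed_vector \<Rightarrow> real^'n \<Rightarrow> real^'n"
  assumes iso: "\<forall>\<^sub>F z in nhds x. linear (M z) \<and> inj (M z)"
    and M: "\<And>v. (\<lambda>z. M z v) differentiable (at x)"
    and R: "R differentiable (at x)"
    and eq: "\<forall>\<^sub>F z in nhds x. push_bivector (M z) (Q z) = R z"
  shows "Q differentiable (at x)"
proof -
  define Y where "Y z = Q z ** transpose (matrix (M z))" for z
  have col: "(N ** (B::real^'n^'n)) $ i $ j = (N *v (\<chi> k. B $ k $ j)) $ i" for N B :: "real^'n^'n" and i j
    by (simp add: matrix_matrix_mult_def matrix_vector_mult_def)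
  have "(\<lambda>z. \<chi> k. Y z $ k $ j) differentiable (at x)" for j
  proof (rule differentiable_linear_solution[OF iso M])
    show "(\<lambda>z. \<chi> i. R z $ i $ j) differentiable at x"
      by (rule differentiable_vec_componentwise) (simp add: differentiable_vec_nth R)
    show "\<forall>\<^sub>F z in nhds x. M z (\<chi> k. Y z $ k $ j) = (\<chi> i. R z $ i $ j)"
      using iso eq
    proof eventually_elim
      case (elim z)
      have "R z = matrix (M z) ** Y z"
        using elim(2) by (simp add: push_bivector_def Y_def matrix_mul_assoc)
      then show ?case using elim(1) by (simp add: vec_eq_iff col matrix_works)
    qed
  qed
  from differentiable_vec_nth[OF this] have Y: "(\<lambda>z. Y z $ k $ j) differentiable (at x)" for k j by simp
  show ?thesis
  proof (rule differentiable_vec_componentwise)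
    fix j
    show "(\<lambda>z. Q z $ j) differentiable (at x)"
    proof (rule differentiable_linear_solution[OF iso M])
      show "(\<lambda>z. \<chi> i. Y z $ j $ i) differentiable at x"
        by (rule differentiable_vec_componentwise) (simp add: Y)
      show "\<forall>\<^sub>F z in nhds x. M z (Q z $ j) = (\<chi> i. Y z $ j $ i)"
        using iso
      proof eventually_elim
        case (elim z)
        then have mv: "M z (Q z $ j) = matrix (M z) *v (Q z $ j)" by (simp add: matrix_works)
        show ?case unfolding mv
          by (simp add: Y_def vec_eq_iff matrix_matrix_mult_def matrix_vector_mult_def transpose_def mult.commute)
      qed
    qed
  qed
qed

section \<open>Charts and tangent maps\<close>

text \<open>Continuity is included because \<open>coord A (f p)\<close> has arbitrary values outside
  its domain: differentiability of the chart expression alone does not keep the values of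
  \<open>f\<close> near \<open>p\<close> inside the chart around \<open>f p\<close>.\<close>

definition mdiff :: "('g::t2_space, 'n::finite) chart set \<Rightarrow> ('g \<Rightarrow> 'g) \<Rightarrow> 'g \<Rightarrow> bool" where
  "mdiff A f p \<longleftrightarrow> isCont f p \<and> (coord A (f p) \<circ> f \<circ> param A p) differentiable (at (coord A p p))"

lemma mdiff_isCont: "mdiff A f p \<Longrightarrow> isCont f p"
  by (simp add: mdiff_def)

locale smooth_manifold =
  fixes A :: "('g::t2_space, 'n::finite) chart set"
  assumes smooth_atlas: "smooth_atlas A"
begin

lemma chart_at_in: "chart_at A p \<in> A" and in_chart_at: "p \<in> fst (chart_at A p)"
proof -
  have "p \<in> (\<Union>C\<in>A. fst C)" using smooth_atlas by (simp add: smooth_atlas_def)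
  then have "\<exists>C. C \<in> A \<and> p \<in> fst C" by blast
  from someI_ex[OF this] show "chart_at A p \<in> A" "p \<in> fst (chart_at A p)"
    unfolding chart_at_def by blast+
qed

lemma open_chart_domain: "C \<in> A \<Longrightarrow> open (fst C)"
  and open_chart_image: "C \<in> A \<Longrightarrow> open (chart_image C)"
  and chart_homeomorphism: "C \<in> A \<Longrightarrow> homeomorphism (fst C) (chart_image C) (snd C) (chart_inv C)"
  using smooth_atlas by (auto simp: smooth_atlas_def)

lemma chart_inv_chart: "C \<in> A \<Longrightarrow> p \<in> fst C \<Longrightarrow> chart_inv C (snd C p) = p"
  using chart_homeomorphism[of C] by (simp add: homeomorphism_def)

lemma chart_chart_inv: "C \<in> A \<Longrightarrow> x \<in> chart_image C \<Longrightarrow> snd C (chart_inv C x) = x"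
  using chart_homeomorphism[of C] by (simp add: homeomorphism_def)

lemma chart_inv_in: "C \<in> A \<Longrightarrow> x \<in> chart_image C \<Longrightarrow> chart_inv C x \<in> fst C"
  using chart_homeomorphism[of C] by (auto simp: homeomorphism_def)

lemma chart_in_image: "p \<in> fst C \<Longrightarrow> snd C p \<in> chart_image C"
  by (simp add: chart_image_def)

lemma isCont_chart_inv: "C \<in> A \<Longrightarrow> x \<in> chart_image C \<Longrightarrow> isCont (chart_inv C) x"
  using chart_homeomorphism[of C] open_chart_image[of C] continuous_on_eq_continuous_at[of "chart_image C" "chart_inv C"]
  by (simp add: homeomorphism_def)

lemma param_coord [simp]: "param A p (coord A p p) = p"
  by (simp add: param_def coord_def chart_inv_chart chart_at_in in_chart_at)

lemma coord_in_image: "coord A p p \<in> chart_image (chart_at A p)"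
  by (simp add: coord_def chart_in_image in_chart_at)

lemma isCont_param: "isCont (param A p) (coord A p p)"
  unfolding param_def by (rule isCont_chart_inv[OF chart_at_in coord_in_image])

lemma eventually_param:
  assumes "\<forall>\<^sub>F q in nhds p. P q"
  shows "\<forall>\<^sub>F y in nhds (coord A p p). P (param A p y)"
  using isCont_eventually[OF isCont_param, of P p] assms by simp

lemma eventually_chart_image: "C \<in> A \<Longrightarrow> x \<in> chart_image C \<Longrightarrow> \<forall>\<^sub>F y in nhds x. y \<in> chart_image C"
  by (rule eventually_nhds_open[OF open_chart_image])

lemma eventually_chart_domain: "C \<in> A \<Longrightarrow> p \<in> fst C \<Longrightarrow> \<forall>\<^sub>F q in nhds p. q \<in> fst C"
  by (rule eventually_nhds_open[OF open_chart_domain])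

lemma open_chart_Int:
  assumes "C \<in> A" "open U"
  shows "open (snd C ` (fst C \<inter> U))"
proof -
  have "snd C ` (fst C \<inter> U) = chart_image C \<inter> chart_inv C -` U"
  proof (intro equalityI subsetI)
    fix y assume "y \<in> snd C ` (fst C \<inter> U)"
    then show "y \<in> chart_image C \<inter> chart_inv C -` U"
      using assms(1) by (auto simp: chart_in_image chart_inv_chart)
  next
    fix y assume y: "y \<in> chart_image C \<inter> chart_inv C -` U"
    then have "y = snd C (chart_inv C y)" "chart_inv C y \<in> fst C \<inter> U"
      using assms(1) by (auto simp: chart_chart_inv chart_inv_in)
    then show "y \<in> snd C ` (fst C \<inter> U)" by (rule image_eqI)
  qed
  moreover have "continuous_on (chart_image C) (chart_inv C)"
    using chart_homeomorphism[OF assms(1)] by (simp add: homeomorphism_def)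
  ultimately show ?thesis
    using continuous_on_open_vimage[OF open_chart_image[OF assms(1)], of "chart_inv C"] assms(2)
    by (simp add: Int_commute)
qed

lemma transition_smooth: "C \<in> A \<Longrightarrow> D \<in> A \<Longrightarrow> smooth_on (snd C ` (fst C \<inter> fst D)) (snd D \<circ> chart_inv C)"
  using smooth_atlas by (simp add: smooth_atlas_def)

lemma transition_has_derivative:
  assumes "C \<in> A" "D \<in> A" "p \<in> fst C" "p \<in> fst D"
  shows "((snd D \<circ> chart_inv C) has_derivative frechet_derivative (snd D \<circ> chart_inv C) (at (snd C p))) (at (snd C p))"
  by (rule smooth_on_has_derivative[OF transition_smooth[OF assms(1,2)]]) (use assms(3,4) in blast)

lemma to_chart_has_derivative:
  "C \<in> A \<Longrightarrow> p \<in> fst C \<Longrightarrow> ((snd C \<circ> param A p) has_derivative to_chart A C p) (at (coord A p p))"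
  unfolding to_chart_def param_def coord_def
  by (rule transition_has_derivative) (simp_all add: chart_at_in in_chart_at)

lemma from_chart_has_derivative:
  "C \<in> A \<Longrightarrow> p \<in> fst C \<Longrightarrow> ((coord A p \<circ> chart_inv C) has_derivative from_chart A C (snd C p)) (at (snd C p))"
  using transition_has_derivative[of C "chart_at A p" p]
  by (simp add: from_chart_def chart_inv_chart coord_def chart_at_in in_chart_at)

lemma linear_to_chart: "C \<in> A \<Longrightarrow> p \<in> fst C \<Longrightarrow> linear (to_chart A C p)"
  by (rule has_derivative_linear[OF to_chart_has_derivative])

lemma linear_from_chart: "C \<in> A \<Longrightarrow> p \<in> fst C \<Longrightarrow> linear (from_chart A C (snd C p))"
  by (rule has_derivative_linear[OF from_chart_has_derivative])

lemma from_to_chart: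
  assumes "C \<in> A" "p \<in> fst C"
  shows "from_chart A C (snd C p) (to_chart A C p v) = v"
proof -
  have "((\<lambda>y. (coord A p \<circ> chart_inv C) ((snd C \<circ> param A p) y)) has_derivative
      (\<lambda>v. from_chart A C (snd C p) (to_chart A C p v))) (at (coord A p p))"
    by (rule has_derivative_compose[OF to_chart_has_derivative[OF assms]])
      (use from_chart_has_derivative[OF assms] in \<open>simp add: o_def\<close>)
  moreover have "\<forall>\<^sub>F y in nhds (coord A p p). (coord A p \<circ> chart_inv C) ((snd C \<circ> param A p) y) = y"
    using eventually_param[OF eventually_chart_domain[OF assms]] eventually_chart_image[OF chart_at_in coord_in_image[of p]]
    by eventually_elim (simp add: chart_inv_chart[OF assms(1)], simp add: coord_def param_def chart_chart_inv chart_at_in)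
  ultimately have "((\<lambda>y. y) has_derivative (\<lambda>v. from_chart A C (snd C p) (to_chart A C p v))) (at (coord A p p))"
    by (rule has_derivative_transform_nhds)
  from has_derivative_unique[OF this has_derivative_ident] show ?thesis by metis
qed

lemma to_chart_self: "to_chart A (chart_at A p) p v = v"
proof -
  have "\<forall>\<^sub>F y in nhds (coord A p p). (snd (chart_at A p) \<circ> param A p) y = y"
    using eventually_chart_image[OF chart_at_in coord_in_image[of p]]
    by eventually_elim (simp add: param_def chart_chart_inv chart_at_in)
  from has_derivative_transform_nhds[OF to_chart_has_derivative[OF chart_at_in in_chart_at] this]
  have "((\<lambda>y. y) has_derivative to_chart A (chart_at A p) p) (at (coord A p p))" .
  from has_derivative_unique[OF this has_derivative_ident] show ?thesis by metis
qed

text \<open>The chain rule replaces the preferred chart at \<open>f p\<close> by any chart around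
  \<open>f p\<close>; continuity of \<open>f\<close> makes the change of charts valid near
  \<open>p\<close>.\<close>

lemma tangent_has_derivative:
  assumes "mdiff A f p" "C \<in> A" "f p \<in> fst C"
  shows "((\<lambda>y. snd C (f (param A p y))) has_derivative (\<lambda>v. to_chart A C (f p) (tangent_map A f p v))) (at (coord A p p))"
proof -
  have "((coord A (f p) \<circ> f \<circ> param A p) has_derivative tangent_map A f p) (at (coord A p p))"
    using assms(1) by (simp add: mdiff_def tangent_map_def frechet_derivative_works[symmetric])
  moreover have "((snd C \<circ> param A (f p)) has_derivative to_chart A C (f p)) (at ((coord A (f p) \<circ> f \<circ> param A p) (coord A p p)))"
    using to_chart_has_derivative[OF assms(2,3)] by simp
  ultimately have "((\<lambda>y. (snd C \<circ> param A (f p)) ((coord A (f p) \<circ> f \<circ> param A p) y)) has_derivative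
      (\<lambda>v. to_chart A C (f p) (tangent_map A f p v))) (at (coord A p p))"
    by (rule has_derivative_compose)
  moreover have "\<forall>\<^sub>F q in nhds p. f q \<in> fst (chart_at A (f p))"
    by (rule isCont_eventually[OF mdiff_isCont[OF assms(1)] eventually_chart_domain[OF chart_at_in in_chart_at]])
  then have "\<forall>\<^sub>F y in nhds (coord A p p). (snd C \<circ> param A (f p)) ((coord A (f p) \<circ> f \<circ> param A p) y) = snd C (f (param A p y))"
    by - (drule eventually_param, erule eventually_mono, simp add: param_def[of A "f p"] coord_def[of A "f p"] chart_inv_chart chart_at_in)
  ultimately show ?thesis by (rule has_derivative_transform_nhds)
qed

lemma linear_tangent_map: "mdiff A f p \<Longrightarrow> linear (tangent_map A f p)"
  unfolding mdiff_def tangent_map_def by (simp add: linear_frechet_derivative)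

lemma tangent_map_eqI:
  assumes "((coord A (f p) \<circ> f \<circ> param A p) has_derivative f') (at (coord A p p))"
  shows "tangent_map A f p = f'"
  unfolding tangent_map_def by (rule frechet_derivativeI[OF assms])

lemma tangent_map_comp:
  assumes "mdiff A g p" "mdiff A f (g p)"
  shows "mdiff A (\<lambda>q. f (g q)) p" (is ?A)
    and "tangent_map A (\<lambda>q. f (g q)) p v = tangent_map A f (g p) (tangent_map A g p v)" (is ?B)
proof -
  let ?h = "\<lambda>q. f (g q)"
  have "((\<lambda>y. coord A (g p) (g (param A p y))) has_derivative tangent_map A g p) (at (coord A p p))"
    using tangent_has_derivative[OF assms(1) chart_at_in in_chart_at] by (simp add: coord_def[of A "g p"] to_chart_self)
  moreover have "((\<lambda>y. coord A (?h p) (f (param A (g p) y))) has_derivative tangent_map A f (g p)) (at (coord A (g p) (g (param A p (coord A p p)))))"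
    using tangent_has_derivative[OF assms(2) chart_at_in in_chart_at] by (simp add: coord_def[of A "?h p"] to_chart_self)
  ultimately have "((\<lambda>y. coord A (?h p) (f (param A (g p) (coord A (g p) (g (param A p y)))))) has_derivative
      (\<lambda>v. tangent_map A f (g p) (tangent_map A g p v))) (at (coord A p p))"
    by (rule has_derivative_compose)
  moreover have "\<forall>\<^sub>F q in nhds p. g q \<in> fst (chart_at A (g p))"
    by (rule isCont_eventually[OF mdiff_isCont[OF assms(1)] eventually_chart_domain[OF chart_at_in in_chart_at]])
  then have "\<forall>\<^sub>F y in nhds (coord A p p). coord A (?h p) (f (param A (g p) (coord A (g p) (g (param A p y))))) = (coord A (?h p) \<circ> ?h \<circ> param A p) y"
    by - (drule eventually_param, erule eventually_mono, simp add: param_def[of A "g p"] coord_def[of A "g p"] chart_inv_chart chart_at_in)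
  ultimately have D: "((coord A (?h p) \<circ> ?h \<circ> param A p) has_derivative
      (\<lambda>v. tangent_map A f (g p) (tangent_map A g p v))) (at (coord A p p))"
    by (rule has_derivative_transform_nhds)
  show ?A
    using assms D unfolding mdiff_def differentiable_def by (blast intro: isCont_o2)
  show ?B by (rule fun_cong[OF tangent_map_eqI[OF D]])
qed

lemma tangent_map_ident: "tangent_map A (\<lambda>q. q) p v = v"
proof -
  have "\<forall>\<^sub>F y in nhds (coord A p p). y = (coord A p \<circ> (\<lambda>q. q) \<circ> param A p) y"
    using eventually_chart_image[OF chart_at_in coord_in_image[of p]]
    by eventually_elim (simp add: param_def coord_def chart_chart_inv chart_at_in)
  from has_derivative_transform_nhds[OF has_derivative_ident this]
  show ?thesis by (rule fun_cong[OF tangent_map_eqI])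
qed

end

section \<open>Lie groups\<close>

locale lie_group_manifold =
  fixes A :: "('g::{t2_space, second_countable_topology}, 'n::finite) chart set"
    and G :: "'g monoid" (structure)
  assumes lie_group: "lie_group A G"
begin

sublocale smooth_manifold A
  using lie_group by unfold_locales (simp add: lie_group_def)

sublocale group G
  using lie_group by (simp add: lie_group_def)

lemma carrier_UNIV [simp]: "carrier G = UNIV"
  using lie_group by (simp add: lie_group_def)

abbreviation "C1 \<equiv> chart_at A \<one>"
abbreviation "x1 \<equiv> coord A \<one> \<one>"
abbreviation "param1 \<equiv> param A \<one>"

lemma mult_continuous: "continuous_on UNIV (\<lambda>(a, b). a \<otimes> b)"
  using lie_group by (simp add: lie_group_def)

lemma isCont_mult_left: "isCont (\<lambda>h. g \<otimes> h) p" and isCont_mult_right: "isCont (\<lambda>h. h \<otimes> g) p"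
proof -
  have m: "isCont (\<lambda>x. fst x \<otimes> snd x) (a, b)" for a b
    using mult_continuous by (simp add: continuous_on_eq_continuous_at case_prod_beta')
  have l: "isCont (\<lambda>h. (g, h)) p" and r: "isCont (\<lambda>h. (h, g)) p" by (intro continuous_intros)+
  show "isCont (\<lambda>h. g \<otimes> h) p" using isCont_o2[OF l m] by simp
  show "isCont (\<lambda>h. h \<otimes> g) p" using isCont_o2[OF r m] by simp
qed

section \<open>The multiplication in charts and the tangent maps of translations\<close>

definition mult_rep :: "('g, 'n) chart \<Rightarrow> ('g, 'n) chart \<Rightarrow> ('g, 'n) chart \<Rightarrow> (real^'n) \<times> (real^'n) \<Rightarrow> real^'n" where
  "mult_rep C D E = (\<lambda>(x, y). snd E (chart_inv C x \<otimes> chart_inv D y))"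

definition mult_dom :: "('g, 'n) chart \<Rightarrow> ('g, 'n) chart \<Rightarrow> ('g, 'n) chart \<Rightarrow> ((real^'n) \<times> (real^'n)) set" where
  "mult_dom C D E = {(x, y). x \<in> chart_image C \<and> y \<in> chart_image D \<and> chart_inv C x \<otimes> chart_inv D y \<in> fst E}"

lemma mult_rep_smooth: "C \<in> A \<Longrightarrow> D \<in> A \<Longrightarrow> E \<in> A \<Longrightarrow> smooth_on (mult_dom C D E) (mult_rep C D E)"
  using lie_group by (simp add: lie_group_def mult_dom_def mult_rep_def)

lemma open_mult_dom:
  assumes "C \<in> A" "D \<in> A" "E \<in> A"
  shows "open (mult_dom C D E)"
proof -
  let ?W = "chart_image C \<times> chart_image D" and ?f = "\<lambda>z. chart_inv C (fst z) \<otimes> chart_inv D (snd z)"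
  have c: "continuous_on (chart_image K) (chart_inv K)" if "K \<in> A" for K
    using chart_homeomorphism[OF that] by (simp add: homeomorphism_def)
  have "continuous_on ?W (\<lambda>z. (chart_inv C (fst z), chart_inv D (snd z)))"
    using assms c by (intro continuous_on_Pair continuous_on_compose2[OF c] continuous_on_fst continuous_on_snd continuous_on_id) auto
  from continuous_on_compose2[OF mult_continuous this]
  have "continuous_on ?W ?f" by simp
  moreover have "open ?W" using assms by (simp add: open_Times open_chart_image)
  ultimately have "open (?f -` fst E \<inter> ?W)"
    using continuous_on_open_vimage[of ?W ?f] open_chart_domain[OF assms(3)] by blast
  moreover have "?f -` fst E \<inter> ?W = mult_dom C D E"
    unfolding mult_dom_def by auto
  ultimately show ?thesis by simp
qed

abbreviation "Dmult C D E z \<equiv> frechet_derivative (mult_rep C D E) (at z)"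

lemma mult_rep_slice2:
  assumes "C \<in> A" "D \<in> A" "E \<in> A" "(x, y) \<in> mult_dom C D E"
  shows "((\<lambda>y. snd E (chart_inv C x \<otimes> chart_inv D y)) has_derivative (\<lambda>v. Dmult C D E (x, y) (0, v))) (at y)"
  using has_derivative_slice2[OF smooth_on_has_derivative[OF mult_rep_smooth[OF assms(1-3)] assms(4)]]
  by (simp add: mult_rep_def)

lemma mult_rep_slice1:
  assumes "C \<in> A" "D \<in> A" "E \<in> A" "(x, y) \<in> mult_dom C D E"
  shows "((\<lambda>x. snd E (chart_inv C x \<otimes> chart_inv D y)) has_derivative (\<lambda>v. Dmult C D E (x, y) (v, 0))) (at x)"
  using has_derivative_slice1[OF smooth_on_has_derivative[OF mult_rep_smooth[OF assms(1-3)] assms(4)]]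
  by (simp add: mult_rep_def)

lemma Dmult_slice2:
  assumes "C \<in> A" "D \<in> A" "E \<in> A" "(x, y) \<in> mult_dom C D E"
  shows "((\<lambda>y. Dmult C D E (x, y) w) has_derivative (\<lambda>a. second_derivative (mult_rep C D E) (x, y) w (0, a))) (at y)"
  by (rule has_derivative_slice2[OF smooth_on_has_second_derivative[OF mult_rep_smooth[OF assms(1-3)] assms(4)]])

lemma Dmult_slice1:
  assumes "C \<in> A" "D \<in> A" "E \<in> A" "(x, y) \<in> mult_dom C D E"
  shows "((\<lambda>x. Dmult C D E (x, y) w) has_derivative (\<lambda>a. second_derivative (mult_rep C D E) (x, y) w (a, 0))) (at x)"
  by (rule has_derivative_slice1[OF smooth_on_has_second_derivative[OF mult_rep_smooth[OF assms(1-3)] assms(4)]])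

lemma second_Dmult_symmetric:
  assumes "C \<in> A" "D \<in> A" "E \<in> A" "(x, y) \<in> mult_dom C D E"
  shows "second_derivative (mult_rep C D E) (x, y) u v = second_derivative (mult_rep C D E) (x, y) v u"
  by (rule second_derivative_symmetric[OF open_mult_dom[OF assms(1-3)] mult_rep_smooth[OF assms(1-3)] assms(4)])

lemma mult_dom_coord: "(coord A g g, coord A h h) \<in> mult_dom (chart_at A g) (chart_at A h) (chart_at A (g \<otimes> h))"
  using param_coord[of g] param_coord[of h]
  by (simp add: mult_dom_def coord_in_image in_chart_at param_def)

lemma mdiff_ltrans: "mdiff A (ltrans G g) p"
proof -
  have "((\<lambda>y. snd (chart_at A (g \<otimes> p)) (chart_inv (chart_at A g) (coord A g g) \<otimes> chart_inv (chart_at A p) y)) has_derivative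
      (\<lambda>v. Dmult (chart_at A g) (chart_at A p) (chart_at A (g \<otimes> p)) (coord A g g, coord A p p) (0, v))) (at (coord A p p))"
    by (rule mult_rep_slice2[OF chart_at_in chart_at_in chart_at_in mult_dom_coord])
  then have "(coord A (ltrans G g p) \<circ> ltrans G g \<circ> param A p) differentiable (at (coord A p p))"
    using param_coord[of g] by (auto simp: differentiable_def coord_def[of A "g \<otimes> p"] ltrans_def o_def param_def)
  then show ?thesis using isCont_mult_left by (simp add: mdiff_def ltrans_def[abs_def])
qed

lemma mdiff_rtrans: "mdiff A (rtrans G g) p"
proof -
  have "((\<lambda>y. snd (chart_at A (p \<otimes> g)) (chart_inv (chart_at A p) y \<otimes> chart_inv (chart_at A g) (coord A g g))) has_derivative
      (\<lambda>v. Dmult (chart_at A p) (chart_at A g) (chart_at A (p \<otimes> g)) (coord A p p, coord A g g) (v, 0))) (at (coord A p p))"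
    by (rule mult_rep_slice1[OF chart_at_in chart_at_in chart_at_in mult_dom_coord])
  then have "(coord A (rtrans G g p) \<circ> rtrans G g \<circ> param A p) differentiable (at (coord A p p))"
    using param_coord[of g] by (auto simp: differentiable_def coord_def[of A "p \<otimes> g"] rtrans_def o_def param_def)
  then show ?thesis using isCont_mult_right by (simp add: mdiff_def rtrans_def[abs_def])
qed

abbreviation "TL g p \<equiv> tangent_map A (ltrans G g) p"
abbreviation "TR g p \<equiv> tangent_map A (rtrans G g) p"

lemma linear_TL: "linear (TL g p)" and linear_TR: "linear (TR g p)"
  by (rule linear_tangent_map[OF mdiff_ltrans], rule linear_tangent_map[OF mdiff_rtrans])

lemma TL_TL: "TL g (h \<otimes> p) (TL h p v) = TL (g \<otimes> h) p v"
proof -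
  have "(\<lambda>q. ltrans G g (ltrans G h q)) = ltrans G (g \<otimes> h)"
    by (simp add: fun_eq_iff ltrans_def m_assoc)
  moreover have "tangent_map A (\<lambda>q. ltrans G g (ltrans G h q)) p v = TL g (ltrans G h p) (TL h p v)"
    by (rule tangent_map_comp(2)[OF mdiff_ltrans mdiff_ltrans])
  moreover have "ltrans G h p = h \<otimes> p" by (rule ltrans_def)
  ultimately show ?thesis by simp
qed

lemma TL_one: "TL \<one> p v = v"
proof -
  have "ltrans G \<one> = (\<lambda>q. q)" by (simp add: fun_eq_iff ltrans_def)
  then show ?thesis by (simp add: tangent_map_ident)
qed

lemma TL_inv_TL: "TL (inv g) g (TL g \<one> v) = v"
  using TL_TL[of "inv g" g \<one> v] by (simp add: TL_one)

lemma TL_TL_inv: "TL g \<one> (TL (inv g) g v) = v"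
  using TL_TL[of g "inv g" g v] by (simp add: TL_one)

text \<open>This is Ad(g^-1). The inverse is chosen so that \<open>TR g \<one>\<close> is
  \<open>TL g \<one>\<close> after \<open>Ad_inv g\<close>: it expresses right translation in the
  left invariant frame.\<close>

definition Ad_inv :: "'g \<Rightarrow> real^'n \<Rightarrow> real^'n" where
  "Ad_inv g = tangent_map A (\<lambda>h. inv g \<otimes> h \<otimes> g) \<one>"

lemma mdiff_conj: "mdiff A (\<lambda>h. inv g \<otimes> h \<otimes> g) \<one>"
  using tangent_map_comp(1)[OF mdiff_rtrans[of g \<one>] mdiff_ltrans[of "inv g"]]
  by (simp add: ltrans_def rtrans_def m_assoc)

lemma linear_Ad_inv: "linear (Ad_inv g)"
  unfolding Ad_inv_def by (rule linear_tangent_map[OF mdiff_conj])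

lemma Ad_inv_eq: "Ad_inv g v = TL (inv g) g (TR g \<one> v)"
proof -
  have "tangent_map A (\<lambda>h. ltrans G (inv g) (rtrans G g h)) \<one> v = TL (inv g) (rtrans G g \<one>) (TR g \<one> v)"
    by (rule tangent_map_comp(2)[OF mdiff_rtrans mdiff_ltrans])
  moreover have "(\<lambda>h. ltrans G (inv g) (rtrans G g h)) = (\<lambda>h. inv g \<otimes> h \<otimes> g)"
    by (simp add: fun_eq_iff ltrans_def rtrans_def m_assoc)
  moreover have "rtrans G g \<one> = g" by (simp add: rtrans_def)
  ultimately show ?thesis by (simp add: Ad_inv_def)
qed

lemma TL_Ad_inv: "TL g \<one> (Ad_inv g v) = TR g \<one> v"
  by (simp add: Ad_inv_eq TL_TL_inv)

text \<open>Both sides are the tangent map at \<open>g\<close> of q -> (g h)^-1 q h, factored in two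
  ways. This turns the right translated summand of multiplicativity into the adjoint action.\<close>

lemma TL_TR: "TL (inv (g \<otimes> h)) (g \<otimes> h) (TR h g v) = Ad_inv h (TL (inv g) g v)"
proof -
  have a: "TL (inv (g \<otimes> h)) (g \<otimes> h) (TR h g v) = tangent_map A (\<lambda>q. inv (g \<otimes> h) \<otimes> (q \<otimes> h)) g v"
  proof -
    have "tangent_map A (\<lambda>q. ltrans G (inv (g \<otimes> h)) (rtrans G h q)) g v = TL (inv (g \<otimes> h)) (rtrans G h g) (TR h g v)"
      by (rule tangent_map_comp(2)[OF mdiff_rtrans mdiff_ltrans])
    moreover have "(\<lambda>q. ltrans G (inv (g \<otimes> h)) (rtrans G h q)) = (\<lambda>q. inv (g \<otimes> h) \<otimes> (q \<otimes> h))"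
      by (simp add: fun_eq_iff ltrans_def rtrans_def)
    moreover have "rtrans G h g = g \<otimes> h" by (rule rtrans_def)
    ultimately show ?thesis by simp
  qed
  have "mdiff A (\<lambda>q. inv h \<otimes> q \<otimes> h) (ltrans G (inv g) g)"
    using mdiff_conj[of h] by (simp add: ltrans_def)
  have "tangent_map A (\<lambda>q. inv h \<otimes> ltrans G (inv g) q \<otimes> h) g v =
      tangent_map A (\<lambda>q. inv h \<otimes> q \<otimes> h) (ltrans G (inv g) g) (TL (inv g) g v)"
    by (rule tangent_map_comp(2)[OF mdiff_ltrans \<open>mdiff A (\<lambda>q. inv h \<otimes> q \<otimes> h) (ltrans G (inv g) g)\<close>])
  moreover have "ltrans G (inv g) q = inv g \<otimes> q" for q by (rule ltrans_def)
  ultimately have "tangent_map A (\<lambda>q. inv h \<otimes> (inv g \<otimes> q) \<otimes> h) g v = Ad_inv h (TL (inv g) g v)"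
    by (simp add: Ad_inv_def)
  moreover have "inv h \<otimes> (inv g \<otimes> q) \<otimes> h = inv (g \<otimes> h) \<otimes> (q \<otimes> h)" for q
    by (simp add: inv_mult_group m_assoc)
  ultimately show ?thesis using a by simp
qed

lemma Ad_inv_one: "Ad_inv \<one> v = v"
  using tangent_map_ident[of \<one> v] by (simp add: Ad_inv_def)

section \<open>Left and right invariant fields in the coordinates of a fixed chart\<close>

definition frame :: "('g, 'n) chart \<Rightarrow> real^'n \<Rightarrow> real^'n \<Rightarrow> real^'n" where
  "frame C x v = to_chart A C (chart_inv C x) (TL (chart_inv C x) \<one> v)"

text \<open>The derivative of the left invariant field of \<open>v\<close> in direction
  \<open>a\<close>, written as a mixed second derivative of the multiplication so that the symmetry
  of second derivatives applies to it.\<close>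

definition dframe :: "('g, 'n) chart \<Rightarrow> real^'n \<Rightarrow> real^'n \<Rightarrow> real^'n \<Rightarrow> real^'n" where
  "dframe C x a v = second_derivative (mult_rep C C1 C) (x, x1) (0, v) (a, 0)"

lemma param1_eq: "param1 = chart_inv C1"
  by (simp add: param_def)

lemma mult_dom_one_right: "C \<in> A \<Longrightarrow> x \<in> chart_image C \<Longrightarrow> (x, x1) \<in> mult_dom C C1 C"
  using param_coord[of \<one>] by (simp add: mult_dom_def coord_in_image param1_eq chart_inv_in)

lemma mult_dom_one_left: "C \<in> A \<Longrightarrow> x \<in> chart_image C \<Longrightarrow> (x1, x) \<in> mult_dom C1 C C"
  using param_coord[of \<one>] by (simp add: mult_dom_def coord_in_image param1_eq chart_inv_in)

lemma frame_has_derivative: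
  assumes "C \<in> A" "x \<in> chart_image C"
  shows "((\<lambda>y. snd C (chart_inv C x \<otimes> param1 y)) has_derivative frame C x) (at x1)"
  using tangent_has_derivative[OF mdiff_ltrans[of "chart_inv C x" \<one>] assms(1)] assms
  by (simp add: ltrans_def frame_def[abs_def] chart_inv_in)

lemma frame_eq_Dmult:
  assumes "C \<in> A" "x \<in> chart_image C"
  shows "frame C x v = Dmult C C1 C (x, x1) (0, v)"
proof -
  have "((\<lambda>y. snd C (chart_inv C x \<otimes> param1 y)) has_derivative (\<lambda>v. Dmult C C1 C (x, x1) (0, v))) (at x1)"
    unfolding param1_eq by (rule mult_rep_slice2[OF assms(1) chart_at_in assms(1) mult_dom_one_right[OF assms]])
  from has_derivative_unique[OF frame_has_derivative[OF assms] this] show ?thesis by metis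
qed

lemma dframe_has_derivative:
  assumes "C \<in> A" "x \<in> chart_image C"
  shows "((\<lambda>x. frame C x v) has_derivative (\<lambda>a. dframe C x a v)) (at x)"
proof -
  have "\<forall>\<^sub>F y in nhds x. Dmult C C1 C (y, x1) (0, v) = frame C y v"
    using eventually_chart_image[OF assms] by eventually_elim (simp add: frame_eq_Dmult[OF assms(1)])
  from has_derivative_transform_nhds[OF Dmult_slice1[OF assms(1) chart_at_in assms(1) mult_dom_one_right[OF assms]] this]
  show ?thesis by (simp add: dframe_def)
qed

lemma linear_frame: "C \<in> A \<Longrightarrow> x \<in> chart_image C \<Longrightarrow> linear (frame C x)"
  by (rule has_derivative_linear[OF frame_has_derivative])

lemma from_chart_frame:
  assumes "C \<in> A" "x \<in> chart_image C"
  shows "from_chart A C x (frame C x v) = TL (chart_inv C x) \<one> v"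
  using from_to_chart[OF assms(1) chart_inv_in[OF assms]] by (simp add: frame_def chart_chart_inv[OF assms])

lemma inj_frame:
  assumes "C \<in> A" "x \<in> chart_image C"
  shows "inj (frame C x)"
proof (rule inj_on_inverseI)
  show "TL (inv (chart_inv C x)) (chart_inv C x) (from_chart A C x (frame C x v)) = v" for v
    by (simp add: from_chart_frame[OF assms] TL_inv_TL)
qed

lemma eventually_frame_iso:
  "C \<in> A \<Longrightarrow> x \<in> chart_image C \<Longrightarrow> \<forall>\<^sub>F z in nhds x. linear (frame C z) \<and> inj (frame C z)"
  by (rule eventually_mono[OF eventually_chart_image]) (auto simp: linear_frame inj_frame)

lemma eventually_linear_frame:
  "C \<in> A \<Longrightarrow> x \<in> chart_image C \<Longrightarrow> \<forall>\<^sub>F z in nhds x. linear (frame C z)"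
  by (rule eventually_mono[OF eventually_chart_image]) (auto simp: linear_frame)

lemma x1_in_image: "x1 \<in> chart_image C1"
  by (rule coord_in_image)

lemma chart_inv_x1: "chart_inv C1 x1 = \<one>"
  using param_coord[of \<one>] by (simp add: param_def)

lemma frame_one: "frame C1 x1 v = v"
  by (simp add: frame_def chart_inv_x1 TL_one to_chart_self)

definition rframe :: "real^'n \<Rightarrow> real^'n \<Rightarrow> real^'n" where
  "rframe x v = to_chart A C1 (param1 x) (TR (param1 x) \<one> v)"

text \<open>Read as a linear system for \<open>Ad_inv (param1 x) v\<close>, this yields both the
  differentiability and the derivative of the adjoint representation.\<close>

lemma frame_Ad_inv: "frame C1 x (Ad_inv (param1 x) v) = rframe x v"
  by (simp add: frame_def rframe_def param1_eq TL_Ad_inv)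

lemma TR_has_derivative:
  assumes "C \<in> A" "x \<in> chart_image C"
  shows "((\<lambda>y. snd C (param1 y \<otimes> chart_inv C x)) has_derivative
    (\<lambda>v. to_chart A C (chart_inv C x) (TR (chart_inv C x) \<one> v))) (at x1)"
  using tangent_has_derivative[OF mdiff_rtrans[of "chart_inv C x" \<one>] assms(1)] assms
  by (simp add: rtrans_def chart_inv_in)

lemma TR_eq_Dmult:
  assumes "C \<in> A" "x \<in> chart_image C"
  shows "to_chart A C (chart_inv C x) (TR (chart_inv C x) \<one> v) = Dmult C1 C C (x1, x) (v, 0)"
proof -
  have "((\<lambda>y. snd C (param1 y \<otimes> chart_inv C x)) has_derivative (\<lambda>v. Dmult C1 C C (x1, x) (v, 0))) (at x1)"
    unfolding param1_eq by (rule mult_rep_slice1[OF chart_at_in assms(1) assms(1) mult_dom_one_left[OF assms]])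
  from has_derivative_unique[OF TR_has_derivative[OF assms] this] show ?thesis by metis
qed

text \<open>By the symmetry of second derivatives the right invariant frame has the transposed derivative.\<close>

lemma rframe_has_derivative: "((\<lambda>x. rframe x v) has_derivative (\<lambda>a. dframe C1 x1 v a)) (at x1)"
proof -
  note one = chart_at_in[of \<one>]
  have "\<forall>\<^sub>F y in nhds x1. Dmult C1 C1 C1 (x1, y) (v, 0) = rframe y v"
    using eventually_chart_image[OF one x1_in_image]
    by eventually_elim (simp add: rframe_def param1_eq TR_eq_Dmult[OF one])
  from has_derivative_transform_nhds[OF Dmult_slice2[OF one one one mult_dom_one_left[OF one x1_in_image]] this]
  show ?thesis
    by (simp add: dframe_def second_Dmult_symmetric[OF one one one mult_dom_one_left[OF one x1_in_image], of "(v, 0)"])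
qed

section \<open>The Lie bracket and its relation to the frame\<close>

abbreviation "br \<equiv> lie_bracket A G"

text \<open>In \<open>C1\<close> the frame at the identity is the identity map, so the bracket is
  the antisymmetrised mixed second derivative of the multiplication there.\<close>

lemma lie_bracket_eq: "br u v = dframe C1 x1 u v - dframe C1 x1 v u"
proof -
  have "vf_rep A C1 (left_invariant_field A G w) = (\<lambda>x. frame C1 x w)" for w
    by (simp add: vf_rep_def frame_def left_invariant_field_def fun_eq_iff)
  then show ?thesis
    by (simp add: lie_bracket_def vf_bracket_def left_invariant_field_def TL_one
        frechet_derivativeI[OF dframe_has_derivative[OF chart_at_in x1_in_image]])
qed

lemma Ad_inv_differentiable:
  assumes "x \<in> chart_image C1" "(\<lambda>z. rframe z v) differentiable (at x)"
  shows "(\<lambda>z. Ad_inv (param1 z) v) differentiable (at x)"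
proof (rule differentiable_linear_solution[OF eventually_frame_iso[OF chart_at_in assms(1)] _ assms(2)])
  show "(\<lambda>z. frame C1 z w) differentiable at x" for w
    by (rule differentiableI[OF dframe_has_derivative[OF chart_at_in assms(1)]])
qed (simp add: frame_Ad_inv)

text \<open>Differentiate \<open>frame_Ad_inv\<close> at the identity: the left side gives
  \<open>dframe C1 x1 a v + D a\<close>, the right invariant frame gives
  \<open>dframe C1 x1 v a\<close>. The difference is -ad.\<close>

lemma Ad_inv_has_derivative: "((\<lambda>x. Ad_inv (param1 x) v) has_derivative (\<lambda>a. - br a v)) (at x1)"
proof -
  have "(\<lambda>z. Ad_inv (param1 z) v) differentiable (at x1)"
    by (rule Ad_inv_differentiable[OF x1_in_image differentiableI[OF rframe_has_derivative]])
  then obtain D where D: "((\<lambda>z. Ad_inv (param1 z) v) has_derivative D) (at x1)" by (auto simp: differentiable_def)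
  have "((\<lambda>z. frame C1 z (Ad_inv (param1 z) v)) has_derivative
      (\<lambda>a. dframe C1 x1 a (Ad_inv (param1 x1) v) + frame C1 x1 (D a))) (at x1)"
    by (rule has_derivative_apply_linear[OF eventually_linear_frame[OF chart_at_in x1_in_image]
          dframe_has_derivative[OF chart_at_in x1_in_image] D])
  then have "((\<lambda>z. rframe z v) has_derivative (\<lambda>a. dframe C1 x1 a v + D a)) (at x1)"
    by (simp add: frame_Ad_inv frame_one Ad_inv_one)
  from has_derivative_unique[OF this rframe_has_derivative]
  have "dframe C1 x1 a v + D a = dframe C1 x1 v a" for a by (rule fun_cong)
  then have "D = (\<lambda>a. - br a v)" by (simp add: lie_bracket_eq fun_eq_iff algebra_simps)
  then show ?thesis using D by simp
qed

lemma linear_br: "linear (br a)"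
proof -
  have "linear (\<lambda>v. - br a v)"
    by (rule linear_derivative_parameter[OF _ Ad_inv_has_derivative]) (simp add: linear_Ad_inv)
  then have "linear (\<lambda>v. - (- br a v))" by (rule linear_compose_neg)
  then show ?thesis by simp
qed

lemma eventually_mult_dom:
  assumes "C \<in> A" "D \<in> A" "E \<in> A" "(x, y) \<in> mult_dom C D E"
  shows "\<forall>\<^sub>F y in nhds y. (x, y) \<in> mult_dom C D E" "\<forall>\<^sub>F x in nhds x. (x, y) \<in> mult_dom C D E"
  by (rule eventually_nhds_slice2[OF open_mult_dom[OF assms(1-3)] assms(4)],
      rule eventually_nhds_slice1[OF open_mult_dom[OF assms(1-3)] assms(4)])

text \<open>Associativity, g (z y) = (g z) y with g = \<open>chart_inv C x\<close>, carries the
  frame near the identity to the frame near \<open>x\<close>. The second derivative of the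
  translation is symmetric and cancels on antisymmetrisation.\<close>

lemma structure_equation:
  assumes "C \<in> A" "x \<in> chart_image C"
  shows "frame C x (br a b) = dframe C x (frame C x a) b - dframe C x (frame C x b) a"
proof -
  note one = chart_at_in[of \<one>]
  note dom = mult_dom_one_right[OF assms]
  let ?\<phi> = "\<lambda>y. snd C (chart_inv C x \<otimes> param1 y)"
  let ?\<phi>2 = "\<lambda>a v. second_derivative (mult_rep C C1 C) (x, x1) (0, v) (0, a)"
  have \<phi>x: "?\<phi> x1 = x" by (simp add: chart_chart_inv assms)
  have dom1: "\<forall>\<^sub>F z in nhds x1. (x, z) \<in> mult_dom C C1 C"
    by (rule eventually_mult_dom(1)[OF assms(1) one assms(1) dom])
  have dom2: "\<forall>\<^sub>F y in nhds x1. (z, y) \<in> mult_dom C1 C1 C1" if "z \<in> chart_image C1" for z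
    by (rule eventually_mult_dom(1)[OF one one one mult_dom_one_right[OF one that]])
  have main: "?\<phi>2 a b + Dmult C C1 C (x, x1) (0, dframe C1 x1 a b) =
      dframe C x (Dmult C C1 C (x, x1) (0, a)) b" for a b
  proof (rule intertwining_second_order[where \<phi> = ?\<phi> and \<phi>' = "\<lambda>z v. Dmult C C1 C (x, z) (0, v)" and \<phi>'' = ?\<phi>2
        and m = "\<lambda>z y. snd C1 (param1 z \<otimes> param1 y)" and n = "\<lambda>z y. snd C (chart_inv C z \<otimes> param1 y)"
        and M = "frame C1" and X = "frame C" and \<kappa> = "\<lambda>y. y" and K = "\<lambda>v. v" and x = x1])
    show "\<forall>\<^sub>F z in nhds x1. (?\<phi> has_derivative (\<lambda>v. Dmult C C1 C (x, z) (0, v))) (at z)"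
      using dom1 by eventually_elim (unfold param1_eq, rule mult_rep_slice2[OF assms(1) one assms(1)])
    show "((\<lambda>z. Dmult C C1 C (x, z) (0, v)) has_derivative (\<lambda>a. ?\<phi>2 a v)) (at x1)" for v
      by (rule Dmult_slice2[OF assms(1) one assms(1) dom])
    show "\<forall>\<^sub>F z in nhds x1. ((\<lambda>y. snd C1 (param1 z \<otimes> param1 y)) has_derivative frame C1 z) (at x1)"
      using eventually_chart_image[OF one x1_in_image]
      by eventually_elim (use frame_has_derivative[OF one] in \<open>simp add: param1_eq\<close>)
    show "((\<lambda>z. frame C1 z v) has_derivative (\<lambda>a. dframe C1 x1 a v)) (at x1)" for v
      by (rule dframe_has_derivative[OF one x1_in_image])
    show "frame C1 x1 v = v" for v by (rule frame_one)
    show "\<forall>\<^sub>F z in nhds x1. snd C1 (param1 z \<otimes> param1 x1) = z"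
      using eventually_chart_image[OF one x1_in_image]
      by eventually_elim (simp add: param1_eq chart_inv_x1 chart_chart_inv[OF one])
    show "\<forall>\<^sub>F z in nhds (?\<phi> x1). ((\<lambda>y. snd C (chart_inv C z \<otimes> param1 y)) has_derivative frame C z) (at x1)"
      unfolding \<phi>x using eventually_chart_image[OF assms]
      by eventually_elim (rule frame_has_derivative[OF assms(1)])
    show "((\<lambda>z. frame C z v) has_derivative (\<lambda>a. dframe C x a v)) (at (?\<phi> x1))" for v
      unfolding \<phi>x by (rule dframe_has_derivative[OF assms])
    show "((\<lambda>y. y) has_derivative (\<lambda>v. v)) (at x1)" by (rule has_derivative_ident)
    show "\<forall>\<^sub>F z in nhds x1. \<forall>\<^sub>F y in nhds x1. ?\<phi> (snd C1 (param1 z \<otimes> param1 y)) = snd C (chart_inv C (?\<phi> z) \<otimes> param1 y)"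
      using eventually_chart_image[OF one x1_in_image] dom1
    proof eventually_elim
      case (elim z)
      show ?case using dom2[OF elim(1)]
      proof eventually_elim
        case (elim y)
        then show ?case using \<open>(x, z) \<in> mult_dom C C1 C\<close>
          by (simp add: mult_dom_def param1_eq chart_inv_chart[OF one] chart_inv_chart[OF assms(1)] m_assoc)
      qed
    qed
  qed
  have sym: "?\<phi>2 a b = ?\<phi>2 b a" by (rule second_Dmult_symmetric[OF assms(1) one assms(1) dom])
  show ?thesis
    unfolding lie_bracket_eq linear_diff[OF linear_frame[OF assms]]
    using main[of a b, unfolded frame_eq_Dmult[OF assms, symmetric], symmetric]
      main[of b a, unfolded frame_eq_Dmult[OF assms, symmetric], symmetric] sym by simp
qed

text \<open>With \<phi> the right translation by \<open>g\<close> and \<kappa> the conjugation, the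
  relation is (z y) g = (z g) (g^-1 y g). Its antisymmetrised second order part is compared with the
  structure equation at \<open>g\<close> for \<open>Ad_inv g a\<close> and
  \<open>Ad_inv g b\<close>; injectivity of the frame concludes.\<close>

lemma Ad_inv_br: "Ad_inv g (br a b) = br (Ad_inv g a) (Ad_inv g b)"
proof -
  note one = chart_at_in[of \<one>]
  let ?C = "chart_at A g" and ?x = "coord A g g"
  note C = chart_at_in[of g]
  note x = coord_in_image[of g]
  note dom = mult_dom_one_left[OF C x]
  have g: "chart_inv ?C ?x = g" using param_coord[of g] by (simp add: param_def)
  let ?\<phi> = "\<lambda>y. snd ?C (param1 y \<otimes> g)"
  let ?\<phi>2 = "\<lambda>a v. second_derivative (mult_rep C1 ?C ?C) (x1, ?x) (v, 0) (a, 0)"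
  let ?F = "frame ?C ?x"
  have \<phi>x: "?\<phi> x1 = ?x" by (simp add: coord_def[of A g])
  have D: "Dmult C1 ?C ?C (x1, ?x) (v, 0) = ?F (Ad_inv g v)" for v
    using TR_eq_Dmult[OF C x, of v] by (simp add: frame_def g TL_Ad_inv)
  have dom1: "\<forall>\<^sub>F z in nhds x1. (z, ?x) \<in> mult_dom C1 ?C ?C"
    by (rule eventually_mult_dom(2)[OF one C C dom])
  have dom2: "\<forall>\<^sub>F y in nhds x1. (z, y) \<in> mult_dom C1 C1 C1" if "z \<in> chart_image C1" for z
    by (rule eventually_mult_dom(1)[OF one one one mult_dom_one_right[OF one that]])
  have "\<forall>\<^sub>F q in nhds (inv g \<otimes> \<one> \<otimes> g). q \<in> fst C1"
    using eventually_chart_domain[OF one in_chart_at] by simp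
  from eventually_param[OF isCont_eventually[OF mdiff_isCont[OF mdiff_conj] this]]
  have dom3: "\<forall>\<^sub>F y in nhds x1. inv g \<otimes> param1 y \<otimes> g \<in> fst C1" .
  have conj: "snd C1 (inv g \<otimes> param1 x1 \<otimes> g) = x1" by (simp add: coord_def[of A \<one>] chart_inv_chart[OF one in_chart_at] param1_eq)
  have main: "?\<phi>2 a b + Dmult C1 ?C ?C (x1, ?x) (dframe C1 x1 a b, 0) =
      dframe ?C ?x (Dmult C1 ?C ?C (x1, ?x) (a, 0)) (Ad_inv g b)" for a b
  proof (rule intertwining_second_order[where \<phi> = ?\<phi> and \<phi>' = "\<lambda>z v. Dmult C1 ?C ?C (z, ?x) (v, 0)" and \<phi>'' = ?\<phi>2
        and m = "\<lambda>z y. snd C1 (param1 z \<otimes> param1 y)" and n = "\<lambda>z y. snd ?C (chart_inv ?C z \<otimes> param1 y)"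
        and M = "frame C1" and X = "frame ?C" and \<kappa> = "\<lambda>y. snd C1 (inv g \<otimes> param1 y \<otimes> g)" and K = "Ad_inv g" and x = x1])
    show "\<forall>\<^sub>F z in nhds x1. (?\<phi> has_derivative (\<lambda>v. Dmult C1 ?C ?C (z, ?x) (v, 0))) (at z)"
      using dom1
    proof eventually_elim
      case (elim z)
      from mult_rep_slice1[OF one C C this] show ?case by (simp add: param1_eq g)
    qed
    show "((\<lambda>z. Dmult C1 ?C ?C (z, ?x) (v, 0)) has_derivative (\<lambda>a. ?\<phi>2 a v)) (at x1)" for v
      by (rule Dmult_slice1[OF one C C dom])
    show "\<forall>\<^sub>F z in nhds x1. ((\<lambda>y. snd C1 (param1 z \<otimes> param1 y)) has_derivative frame C1 z) (at x1)"
      using eventually_chart_image[OF one x1_in_image]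
      by eventually_elim (use frame_has_derivative[OF one] in \<open>simp add: param1_eq\<close>)
    show "((\<lambda>z. frame C1 z v) has_derivative (\<lambda>a. dframe C1 x1 a v)) (at x1)" for v
      by (rule dframe_has_derivative[OF one x1_in_image])
    show "frame C1 x1 v = v" for v by (rule frame_one)
    show "\<forall>\<^sub>F z in nhds x1. snd C1 (param1 z \<otimes> param1 x1) = z"
      using eventually_chart_image[OF one x1_in_image]
      by eventually_elim (simp add: param1_eq chart_inv_x1 chart_chart_inv[OF one])
    show "\<forall>\<^sub>F z in nhds (?\<phi> x1). ((\<lambda>y. snd ?C (chart_inv ?C z \<otimes> param1 y)) has_derivative frame ?C z)
        (at (snd C1 (inv g \<otimes> param1 x1 \<otimes> g)))"
      unfolding \<phi>x conj using eventually_chart_image[OF C x]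
      by eventually_elim (rule frame_has_derivative[OF C])
    show "((\<lambda>z. frame ?C z v) has_derivative (\<lambda>a. dframe ?C ?x a v)) (at (?\<phi> x1))" for v
      unfolding \<phi>x by (rule dframe_has_derivative[OF C x])
    show "((\<lambda>y. snd C1 (inv g \<otimes> param1 y \<otimes> g)) has_derivative Ad_inv g) (at x1)"
      using tangent_has_derivative[OF mdiff_conj[of g] one] in_chart_at[of \<one>]
      by (simp add: to_chart_self Ad_inv_def)
    show "\<forall>\<^sub>F z in nhds x1. \<forall>\<^sub>F y in nhds x1. ?\<phi> (snd C1 (param1 z \<otimes> param1 y)) =
        snd ?C (chart_inv ?C (?\<phi> z) \<otimes> param1 (snd C1 (inv g \<otimes> param1 y \<otimes> g)))"
      using eventually_chart_image[OF one x1_in_image] dom1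
    proof eventually_elim
      case (elim z)
      then have z: "param1 z \<otimes> g \<in> fst ?C" by (simp add: mult_dom_def param1_eq g)
      have "param1 z \<otimes> g \<otimes> (inv g \<otimes> param1 y \<otimes> g) = param1 z \<otimes> param1 y \<otimes> g" for y
        by (simp add: m_assoc) (simp add: m_assoc[symmetric])
      note assoc = this
      show ?case using dom2[OF elim(1)] dom3
      proof eventually_elim
        case (elim y)
        then show ?case using z assoc[of y]
          by (simp add: mult_dom_def param1_eq chart_inv_chart[OF one] chart_inv_chart[OF C])
      qed
    qed
  qed
  have sym: "?\<phi>2 a b = ?\<phi>2 b a" by (rule second_Dmult_symmetric[OF one C C dom])
  have "?F (Ad_inv g (br a b)) = ?F (br (Ad_inv g a) (Ad_inv g b))"
    unfolding structure_equation[OF C x] lie_bracket_eq[of a b] linear_diff[OF linear_Ad_inv] linear_diff[OF linear_frame[OF C x]]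
    using main[of a b, unfolded D, symmetric] main[of b a, unfolded D, symmetric] sym by simp
  then show ?thesis using inj_frame[OF C x] by (simp add: inj_eq)
qed

lemma inj_Ad_inv: "inj (Ad_inv g)"
proof (rule inj_on_inverseI)
  fix v
  have "tangent_map A (\<lambda>h. inv (inv g) \<otimes> (inv g \<otimes> h \<otimes> g) \<otimes> inv g) \<one> v = Ad_inv (inv g) (Ad_inv g v)"
    using tangent_map_comp(2)[OF mdiff_conj[of g], of "\<lambda>h. inv (inv g) \<otimes> h \<otimes> inv g" v] mdiff_conj[of "inv g"]
    by (simp add: Ad_inv_def)
  moreover have "inv (inv g) \<otimes> (inv g \<otimes> h \<otimes> g) \<otimes> inv g = h" for h
    by (simp add: m_assoc) (simp add: m_assoc[symmetric])
  ultimately show "Ad_inv (inv g) (Ad_inv g v) = v" by (simp add: tangent_map_ident)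
qed

end

section \<open>Poisson-Lie groups\<close>

locale poisson_lie =
  lie_group_manifold A G for A :: "('g::{t2_space, second_countable_topology}, 'n::finite) chart set" and G :: "'g monoid" (structure) +
  fixes P :: "'g \<Rightarrow> real^'n^'n"
  assumes poisson_tensor: "poisson_tensor A P" and multiplicative: "multiplicative A G P"
begin

abbreviation "pl \<equiv> left_translate A G P"
abbreviation "\<xi> \<equiv> cocycle A G P"

lemma P_eq_push: "P g = push_bivector (TL g \<one>) (pl g)"
proof -
  have "TL g \<one> \<circ> TL (inv g) g = id" by (simp add: fun_eq_iff TL_TL_inv)
  then show ?thesis by (simp add: left_translate_def push_bivector_compose linear_TL)
qed

lemma pl_mult: "pl (g \<otimes> h) = pl h + push_bivector (Ad_inv h) (pl g)"
proof -
  have "TL (inv (g \<otimes> h)) (g \<otimes> h) (TL g h v) = TL (inv h) h v" for v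
    by (simp add: TL_TL inv_mult_group m_assoc)
  then have 1: "TL (inv (g \<otimes> h)) (g \<otimes> h) \<circ> TL g h = TL (inv h) h" by (simp add: fun_eq_iff)
  have 2: "TL (inv (g \<otimes> h)) (g \<otimes> h) \<circ> TR h g = Ad_inv h \<circ> TL (inv g) g" by (simp add: fun_eq_iff TL_TR)
  have "P (g \<otimes> h) = push_bivector (TL g h) (P h) + push_bivector (TR h g) (P g)"
    using multiplicative by (simp add: multiplicative_def)
  then show ?thesis
    by (simp add: left_translate_def push_bivector_add push_bivector_compose linear_TL linear_TR linear_Ad_inv 1 2)
qed

lemma pl_one: "pl \<one> = 0"
proof -
  have "Ad_inv \<one> = id" by (simp add: fun_eq_iff Ad_inv_one)
  then show ?thesis using pl_mult[of \<one> \<one>] by simp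
qed

lemma bivector_pl: "bivector (pl g)"
  using poisson_tensor unfolding left_translate_def
  by (intro push_bivector_bivector) (simp add: poisson_tensor_def bivector_field_def)

lemma bivector_rep_eq:
  assumes "C \<in> A" "x \<in> chart_image C"
  shows "bivector_rep A C P x = push_bivector (frame C x) (pl (chart_inv C x))"
proof -
  let ?g = "chart_inv C x"
  have "to_chart A C ?g \<circ> TL ?g \<one> = frame C x" by (simp add: fun_eq_iff frame_def)
  then show ?thesis unfolding bivector_rep_def P_eq_push[of ?g]
    by (simp add: push_bivector_compose linear_TL linear_to_chart[OF assms(1) chart_inv_in[OF assms]])
qed

lemma bivector_rep_smooth: "C \<in> A \<Longrightarrow> smooth_on (chart_image C) (bivector_rep A C P)"
  using poisson_tensor by (simp add: poisson_tensor_def bivector_field_def)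

lemma bivector_rep_has_derivative:
  "C \<in> A \<Longrightarrow> x \<in> chart_image C \<Longrightarrow>
    (bivector_rep A C P has_derivative frechet_derivative (bivector_rep A C P) (at x)) (at x)"
  by (rule smooth_on_has_derivative[OF bivector_rep_smooth])

text \<open>By definition \<open>pl\<close> passes through preferred charts that vary irregularly.
  The smooth chart components of \<open>P\<close> are the push-forward of \<open>pl\<close> by the
  frame, and cancelling the frame transfers differentiability.\<close>

lemma pl_differentiable:
  assumes "C \<in> A" "x \<in> chart_image C"
  shows "(\<lambda>z. pl (chart_inv C z)) differentiable (at x)"
proof (rule differentiable_push_bivector_cancel[OF eventually_frame_iso[OF assms]])
  show "(\<lambda>z. frame C z v) differentiable at x" for v
    by (rule differentiableI[OF dframe_has_derivative[OF assms]])
  show "bivector_rep A C P differentiable at x"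
    by (rule differentiableI[OF bivector_rep_has_derivative[OF assms]])
  show "\<forall>\<^sub>F z in nhds x. push_bivector (frame C z) (pl (chart_inv C z)) = bivector_rep A C P z"
    using eventually_chart_image[OF assms] by eventually_elim (simp add: bivector_rep_eq[OF assms(1)])
qed

lemma pl_has_derivative_one: "((\<lambda>z. pl (param1 z)) has_derivative \<xi>) (at x1)"
  using pl_differentiable[OF chart_at_in x1_in_image]
  by (simp add: cocycle_def param1_eq o_def frechet_derivative_works[symmetric])

lemma linear_cocycle: "linear \<xi>"
  by (rule has_derivative_linear[OF pl_has_derivative_one])

lemma bivector_cocycle: "bivector (\<xi> u)"
proof -
  have "((\<lambda>z. transpose (pl (param1 z))) has_derivative (\<lambda>u. transpose (\<xi> u))) (at x1)"
    by (rule has_derivative_linear_comp[OF linear_transpose pl_has_derivative_one])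
  moreover have "((\<lambda>z. transpose (pl (param1 z))) has_derivative (\<lambda>u. - \<xi> u)) (at x1)"
    using has_derivative_minus[OF pl_has_derivative_one] bivector_pl by (simp add: bivector_def)
  ultimately have "(\<lambda>u. transpose (\<xi> u)) = (\<lambda>u. - \<xi> u)" by (rule has_derivative_unique)
  then show ?thesis unfolding bivector_def by (rule fun_cong)
qed

text \<open>Since \<open>pl\<close> vanishes at the identity, the terms in which the frame is
  differentiated drop out.\<close>

lemma bivector_rep_derivative_one: "frechet_derivative (bivector_rep A C1 P) (at x1) = \<xi>"
proof (rule frechet_derivativeI)
  have "((\<lambda>z. push_bivector (frame C1 z) (pl (param1 z))) has_derivative
    (\<lambda>a. matrix (dframe C1 x1 a) ** pl (param1 x1) ** transpose (matrix (frame C1 x1)) + push_bivector (frame C1 x1) (\<xi> a) +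
      matrix (frame C1 x1) ** pl (param1 x1) ** transpose (matrix (dframe C1 x1 a)))) (at x1)"
    by (rule push_bivector_has_derivative[OF dframe_has_derivative[OF chart_at_in x1_in_image] pl_has_derivative_one])
  moreover have "frame C1 x1 = id" by (simp add: fun_eq_iff frame_one)
  moreover have "(M::real^'n^'n) ** 0 = 0" "0 ** (M::real^'n^'n) = 0" for M
    by (simp_all add: matrix_matrix_mult_def vec_eq_iff)
  ultimately have "((\<lambda>z. push_bivector (frame C1 z) (pl (param1 z))) has_derivative \<xi>) (at x1)"
    by (simp add: pl_one eta_contract_eq)
  then show "(bivector_rep A C1 P has_derivative \<xi>) (at x1)"
    by (rule has_derivative_transform_nhds)
      (rule eventually_mono[OF eventually_chart_image[OF chart_at_in x1_in_image]], simp add: bivector_rep_eq[OF chart_at_in] param1_eq)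
qed

lemma pl_has_derivative:
  "((\<lambda>z. pl (g \<otimes> param1 z)) has_derivative
    (\<lambda>a. \<xi> a - (matrix (br a) ** pl g + pl g ** transpose (matrix (br a))))) (at x1)"
proof -
  have "((\<lambda>z. push_bivector (Ad_inv (param1 z)) (pl g)) has_derivative
    (\<lambda>a. matrix (\<lambda>v. - br a v) ** pl g ** transpose (matrix (Ad_inv (param1 x1))) + push_bivector (Ad_inv (param1 x1)) 0 +
      matrix (Ad_inv (param1 x1)) ** pl g ** transpose (matrix (\<lambda>v. - br a v)))) (at x1)"
    by (rule push_bivector_has_derivative[OF Ad_inv_has_derivative has_derivative_const])
  moreover have "Ad_inv (param1 x1) = id" by (simp add: fun_eq_iff Ad_inv_one)
  moreover have "matrix (id :: real^'n \<Rightarrow> real^'n) = mat 1" by (rule matrix_id_mat_1)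
  moreover have "matrix (\<lambda>v. - br a v) ** Q = - (matrix (br a) ** Q)"
    "Q ** transpose (matrix (\<lambda>v. - br a v)) = - (Q ** transpose (matrix (br a)))" for a and Q :: "real^'n^'n"
    by (simp_all add: matrix_def transpose_def matrix_matrix_mult_def vec_eq_iff sum_negf)
  ultimately have "((\<lambda>z. push_bivector (Ad_inv (param1 z)) (pl g)) has_derivative
      (\<lambda>a. - (matrix (br a) ** pl g) - pl g ** transpose (matrix (br a)))) (at x1)"
    by simp
  from has_derivative_add[OF pl_has_derivative_one this]
  show ?thesis by (simp add: pl_mult algebra_simps)
qed

section \<open>The Jacobi identity of the Poisson bracket in coordinates\<close>

lemma smooth_fun_on_coordinate:
  assumes "E \<in> A"
  shows "smooth_fun_on A (fst E) (\<lambda>g. snd E g $ i)"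
  unfolding smooth_fun_on_def smooth_on_def
proof (intro ballI allI)
  fix C k assume C: "C \<in> A"
  have "Ck_on k (snd C ` (fst C \<inter> fst E)) (\<lambda>x. (snd E \<circ> chart_inv C) x $ i)"
    by (rule Ck_on_bounded_linear[OF open_chart_Int[OF C open_chart_domain[OF assms]] bounded_linear_vec_nth])
      (use transition_smooth[OF C assms] in \<open>simp add: smooth_on_def o_def\<close>)
  then show "Ck_on k (snd C ` (fst C \<inter> fst E)) ((\<lambda>g. snd E g $ i) \<circ> chart_inv C)"
    by (simp add: o_def)
qed

lemma differential_coordinate:
  assumes "C \<in> A" "p \<in> fst C"
  shows "differential A (\<lambda>g. snd C g $ i) p = row i (matrix (to_chart A C p))"
proof -
  have "(((\<lambda>g. snd C g $ i) \<circ> param A p) has_derivative (\<lambda>v. to_chart A C p v $ i)) (at (coord A p p))"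
    using bounded_linear.has_derivative[OF bounded_linear_vec_nth to_chart_has_derivative[OF assms]]
    by (simp add: o_def)
  then show ?thesis
    by (simp add: differential_def frechet_derivativeI row_def matrix_def vec_eq_iff)
qed

lemma row_matrix_mult: "row i (M :: real^'n^'n) \<bullet> (Q *v w) = (M ** Q *v w) $ i"
  unfolding matrix_vector_mul_assoc[symmetric]
  by (simp add: matrix_vector_mult_def[of M] row_def inner_vec_def)

lemma poisson_bracket_coordinates:
  assumes "C \<in> A" "p \<in> fst C"
  shows "poisson_bracket A P (\<lambda>g. snd C g $ i) (\<lambda>g. snd C g $ j) p = bivector_rep A C P (snd C p) $ i $ j"
proof -
  have "poisson_bracket A P (\<lambda>g. snd C g $ i) (\<lambda>g. snd C g $ j) p =
      (matrix (to_chart A C p) ** P p *v row j (matrix (to_chart A C p))) $ i"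
    by (simp add: poisson_bracket_def bivector_pairing_def differential_coordinate[OF assms] row_matrix_mult)
  then show ?thesis
    by (simp add: bivector_rep_def push_bivector_def chart_inv_chart[OF assms] row_def
        matrix_vector_mult_def matrix_matrix_mult_def[of "_ ** _"] transpose_def)
qed

text \<open>The coordinate formula {x_i, {x_j, x_k}} = sum over l of P_il d_l P_jk. Coordinate
  functions are meaningful only on the chart domain, so the inner bracket is identified with a
  component of \<open>P\<close> near \<open>p\<close> only.\<close>

lemma poisson_bracket_iterated:
  assumes "C \<in> A" "p \<in> fst C"
  shows "poisson_bracket A P (\<lambda>g. snd C g $ i)
      (poisson_bracket A P (\<lambda>g. snd C g $ j) (\<lambda>g. snd C g $ k)) p =
    (\<Sum>l\<in>UNIV. bivector_rep A C P (snd C p) $ i $ l *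
      frechet_derivative (bivector_rep A C P) (at (snd C p)) (axis l 1) $ j $ k)"
proof -
  let ?R = "bivector_rep A C P" and ?T = "to_chart A C p"
  let ?h = "poisson_bracket A P (\<lambda>g. snd C g $ j) (\<lambda>g. snd C g $ k)"
  define R' where "R' v = frechet_derivative ?R (at (snd C p)) v $ j $ k" for v
  note T = linear_to_chart[OF assms]
  have R: "(?R has_derivative frechet_derivative ?R (at (snd C p))) (at (snd C p))"
    by (rule bivector_rep_has_derivative[OF assms(1) chart_in_image[OF assms(2)]])
  have R'lin: "linear R'"
    using has_derivative_linear[OF R] unfolding R'_def by (simp add: linear_iff)
  have "((\<lambda>y. ?R y $ j $ k) has_derivative R') (at (snd C p))"
    unfolding R'_def
    by (rule bounded_linear.has_derivative[OF bounded_linear_vec_nth bounded_linear.has_derivative[OF bounded_linear_vec_nth R]])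
  then have "((\<lambda>y. ?R y $ j $ k) has_derivative R') (at ((snd C \<circ> param A p) (coord A p p)))" by simp
  from has_derivative_compose[OF to_chart_has_derivative[OF assms] this]
  have "((\<lambda>y. ?R (snd C (param A p y)) $ j $ k) has_derivative (\<lambda>v. R' (?T v))) (at (coord A p p))" by simp
  moreover have "\<forall>\<^sub>F y in nhds (coord A p p). ?R (snd C (param A p y)) $ j $ k = (?h \<circ> param A p) y"
    using eventually_param[OF eventually_chart_domain[OF assms]]
    by eventually_elim (simp add: poisson_bracket_coordinates[OF assms(1)])
  ultimately have "((?h \<circ> param A p) has_derivative (\<lambda>v. R' (?T v))) (at (coord A p p))"
    by (rule has_derivative_transform_nhds)
  then have "differential A ?h p = (\<chi> m. R' (?T (axis m 1)))"
    by (simp add: differential_def frechet_derivativeI)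
  also have "\<dots> = transpose (matrix ?T) *v (\<chi> l. R' (axis l 1))"
    by (simp add: vec_eq_iff matrix_vector_mult_def transpose_def matrix_def linear_axis_expand[OF R'lin, of "?T _"])
  finally have "poisson_bracket A P (\<lambda>g. snd C g $ i) ?h p =
      (matrix ?T ** P p *v (transpose (matrix ?T) *v (\<chi> l. R' (axis l 1)))) $ i"
    by (simp add: poisson_bracket_def bivector_pairing_def differential_coordinate[OF assms] row_matrix_mult)
  also have "\<dots> = (?R (snd C p) *v (\<chi> l. R' (axis l 1))) $ i"
    by (simp only: bivector_rep_def push_bivector_def chart_inv_chart[OF assms] matrix_vector_mul_assoc)
  finally show ?thesis by (simp add: matrix_vector_mult_def R'_def)
qed

text \<open>The Jacobi identity of the Poisson bracket of coordinate functions around \<open>\<one>\<close>, linearised at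
  \<open>\<one>\<close>, where the tensor vanishes.\<close>

lemma cocycle_jacobi:
  "(\<Sum>l\<in>UNIV. \<xi> u $ i $ l * \<xi> (axis l 1) $ j $ k) + (\<Sum>l\<in>UNIV. \<xi> u $ j $ l * \<xi> (axis l 1) $ k $ i) +
   (\<Sum>l\<in>UNIV. \<xi> u $ k $ l * \<xi> (axis l 1) $ i $ j) = 0"
proof -
  note one = chart_at_in[of \<one>]
  let ?R = "bivector_rep A C1 P"
  define t where "t i j k x = (\<Sum>l\<in>UNIV. ?R x $ i $ l * frechet_derivative ?R (at x) (axis l 1) $ j $ k)" for i j k x
  have vn: "((\<lambda>x. f x $ a $ b) has_derivative (\<lambda>v. f' v $ a $ b)) F"
    if "(f has_derivative f') F" for f f' F and a b :: 'n
    by (rule bounded_linear.has_derivative[OF bounded_linear_vec_nth bounded_linear.has_derivative[OF bounded_linear_vec_nth that]])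
  have R1: "?R x1 = 0"
    using bivector_rep_eq[OF one x1_in_image] by (simp add: chart_inv_x1 pl_one)
  have t': "(t i j k has_derivative (\<lambda>u. \<Sum>l\<in>UNIV. \<xi> u $ i $ l * \<xi> (axis l 1) $ j $ k)) (at x1)" for i j k
  proof -
    have D: "(?R has_derivative \<xi>) (at x1)"
      using bivector_rep_has_derivative[OF one x1_in_image] by (simp add: bivector_rep_derivative_one)
    have DD: "((\<lambda>x. frechet_derivative ?R (at x) (axis l 1)) has_derivative second_derivative ?R x1 (axis l 1)) (at x1)" for l
      by (rule smooth_on_has_second_derivative[OF bivector_rep_smooth[OF one] x1_in_image])
    have "((\<lambda>x. \<Sum>l\<in>UNIV. ?R x $ i $ l * frechet_derivative ?R (at x) (axis l 1) $ j $ k) has_derivative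
      (\<lambda>u. \<Sum>l\<in>UNIV. ?R x1 $ i $ l * second_derivative ?R x1 (axis l 1) u $ j $ k +
         \<xi> u $ i $ l * frechet_derivative ?R (at x1) (axis l 1) $ j $ k)) (at x1)"
      by (rule has_derivative_sum, rule has_derivative_mult, rule vn[OF D], rule vn[OF DD])
    \<comment> \<open>\<open>R1\<close> removes the terms that contain second derivatives of the
      tensor.\<close>
    then show ?thesis by (simp add: R1 bivector_rep_derivative_one t_def[abs_def])
  qed
  have "t i j k x + t j k i x + t k i j x = 0" if "x \<in> chart_image C1" for x
  proof -
    let ?p = "chart_inv C1 x" and ?f = "\<lambda>i g. snd C1 g $ i"
    have p: "?p \<in> fst C1" by (rule chart_inv_in[OF one that])
    have "poisson_bracket A P (?f i) (poisson_bracket A P (?f j) (?f k)) ?p +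
        poisson_bracket A P (?f j) (poisson_bracket A P (?f k) (?f i)) ?p +
        poisson_bracket A P (?f k) (poisson_bracket A P (?f i) (?f j)) ?p = 0"
      using poisson_tensor p open_chart_domain[OF one] smooth_fun_on_coordinate[OF one]
      unfolding poisson_tensor_def by blast
    then show ?thesis
      unfolding poisson_bracket_iterated[OF one p] by (simp add: t_def chart_chart_inv[OF one that])
  qed
  then have "\<forall>\<^sub>F x in nhds x1. t i j k x + t j k i x + t k i j x = 0"
    by - (rule eventually_mono[OF eventually_chart_image[OF one x1_in_image]])
  from has_derivative_transform_nhds[OF has_derivative_add[OF has_derivative_add[OF t' t'] t'] this]
  have "((\<lambda>x. 0) has_derivative (\<lambda>u. (\<Sum>l\<in>UNIV. \<xi> u $ i $ l * \<xi> (axis l 1) $ j $ k) +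
     (\<Sum>l\<in>UNIV. \<xi> u $ j $ l * \<xi> (axis l 1) $ k $ i) + (\<Sum>l\<in>UNIV. \<xi> u $ k $ l * \<xi> (axis l 1) $ i $ j))) (at x1)" .
  from fun_cong[OF has_derivative_unique[OF this has_derivative_const], of u] show ?thesis .
qed

section \<open>The dual Lie algebra and the traces of its adjoint maps\<close>

abbreviation "dbr \<equiv> dual_bracket A G P"

lemma dual_bracket_nth: "dbr \<alpha> \<beta> $ k = (\<Sum>i\<in>UNIV. \<Sum>j\<in>UNIV. \<alpha> $ i * \<beta> $ j * \<xi> (axis k 1) $ i $ j)"
  by (simp add: dual_bracket_def bivector_pairing_def inner_vec_def matrix_vector_mult_def sum_distrib_left mult_ac)

text \<open>The Jacobi identity is \<open>cocycle_jacobi\<close> at basis vectors, contracted with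
  three covectors; the rotations of indices in \<open>b\<close> and \<open>c\<close> bring the
  nested brackets under one common sum.\<close>

lemma lie_algebra_dual_bracket: "lie_algebra dbr"
  unfolding lie_algebra_def
proof (intro conjI allI)
  show "bilinear dbr"
    unfolding bilinear_def
    by (auto intro!: linearI simp: vec_eq_iff dual_bracket_nth sum.distrib sum_distrib_left algebra_simps)
  fix \<alpha>
  have "dbr \<alpha> \<alpha> $ k = 0" for k
  proof -
    have sk: "\<alpha> $ i * \<alpha> $ j * \<xi> (axis k 1) $ i $ j = - (\<alpha> $ j * \<alpha> $ i * \<xi> (axis k 1) $ j $ i)" for i j
      using bivector_skew[OF bivector_cocycle, of "axis k 1" i j] by simp
    have "dbr \<alpha> \<alpha> $ k = - (\<Sum>i\<in>UNIV. \<Sum>j\<in>UNIV. \<alpha> $ j * \<alpha> $ i * \<xi> (axis k 1) $ j $ i)"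
      unfolding dual_bracket_nth sum_negf[symmetric] by (rule sum.cong[OF refl], rule sum.cong[OF refl], rule sk)
    also have "\<dots> = - dbr \<alpha> \<alpha> $ k" unfolding dual_bracket_nth by (rule arg_cong[OF sum.swap])
    finally show ?thesis by simp
  qed
  then show "dbr \<alpha> \<alpha> = 0" by (simp add: vec_eq_iff)
  fix \<beta> \<gamma>
  define c where "c k i j m = (\<Sum>l\<in>UNIV. \<xi> (axis k 1) $ i $ l * \<xi> (axis l 1) $ j $ m)" for k i j m
  have nest: "dbr \<alpha> (dbr \<beta> \<gamma>) $ k = (\<Sum>i\<in>UNIV. \<Sum>j\<in>UNIV. \<Sum>m\<in>UNIV. \<alpha> $ i * \<beta> $ j * \<gamma> $ m * c k i j m)" for \<alpha> \<beta> \<gamma> k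
  proof -
    have "dbr \<alpha> (dbr \<beta> \<gamma>) $ k = (\<Sum>i\<in>UNIV. \<Sum>l\<in>UNIV. \<Sum>j\<in>UNIV. \<Sum>m\<in>UNIV.
        \<alpha> $ i * \<beta> $ j * \<gamma> $ m * (\<xi> (axis k 1) $ i $ l * \<xi> (axis l 1) $ j $ m))"
      unfolding dual_bracket_nth[of \<alpha>] unfolding dual_bracket_nth
      by (simp add: sum_distrib_left sum_distrib_right mult_ac)
    also have "\<dots> = (\<Sum>i\<in>UNIV. \<Sum>j\<in>UNIV. \<Sum>m\<in>UNIV. \<Sum>l\<in>UNIV.
        \<alpha> $ i * \<beta> $ j * \<gamma> $ m * (\<xi> (axis k 1) $ i $ l * \<xi> (axis l 1) $ j $ m))"
      by (rule sum.cong[OF refl], rule sum_rotate)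
    finally show ?thesis by (simp add: c_def sum_distrib_left)
  qed
  have "dbr \<alpha> (dbr \<beta> \<gamma>) $ k + dbr \<beta> (dbr \<gamma> \<alpha>) $ k + dbr \<gamma> (dbr \<alpha> \<beta>) $ k = 0" for k
  proof -
    have b: "dbr \<beta> (dbr \<gamma> \<alpha>) $ k = (\<Sum>i\<in>UNIV. \<Sum>j\<in>UNIV. \<Sum>m\<in>UNIV. \<alpha> $ i * \<beta> $ j * \<gamma> $ m * c k j m i)"
      by (rule sym, subst sum_rotate) (simp add: nest mult_ac)
    have c: "dbr \<gamma> (dbr \<alpha> \<beta>) $ k = (\<Sum>i\<in>UNIV. \<Sum>j\<in>UNIV. \<Sum>m\<in>UNIV. \<alpha> $ i * \<beta> $ j * \<gamma> $ m * c k m i j)"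
      unfolding nest[of \<gamma>] by (subst sum_rotate) (simp add: mult_ac)
    have "dbr \<alpha> (dbr \<beta> \<gamma>) $ k + dbr \<beta> (dbr \<gamma> \<alpha>) $ k + dbr \<gamma> (dbr \<alpha> \<beta>) $ k =
      (\<Sum>i\<in>UNIV. \<Sum>j\<in>UNIV. \<Sum>m\<in>UNIV. \<alpha> $ i * \<beta> $ j * \<gamma> $ m * (c k i j m + c k j m i + c k m i j))"
      unfolding nest[of \<alpha>] b c by (simp add: sum.distrib[symmetric] distrib_left)
    also have "\<dots> = 0"
      using cocycle_jacobi[of "axis k 1"] by (simp add: c_def)
    finally show ?thesis .
  qed
  then show "dbr \<alpha> (dbr \<beta> \<gamma>) + dbr \<beta> (dbr \<gamma> \<alpha>) + dbr \<gamma> (dbr \<alpha> \<beta>) = 0" by (simp add: vec_eq_iff)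
qed

text \<open>The trace of the adjoint map of \<alpha> is minus the pairing of \<alpha> with the trace
  vector of \<xi>, so it vanishes for all \<alpha> exactly if that vector does.\<close>

lemma unimodular_dual_iff:
  "unimodular_lie_algebra dbr \<longleftrightarrow> (\<chi> l. \<Sum>k\<in>UNIV. \<xi> (axis k 1) $ k $ l) = 0"
proof -
  have tr: "trace (matrix (dbr \<alpha>)) = - (\<Sum>i\<in>UNIV. \<alpha> $ i * (\<Sum>k\<in>UNIV. \<xi> (axis k 1) $ k $ i))" for \<alpha>
  proof -
    have "matrix (dbr \<alpha>) $ k $ k = (\<Sum>i\<in>UNIV. \<alpha> $ i * \<xi> (axis k 1) $ i $ k)" for k
    proof -
      have "\<alpha> $ i * axis k 1 $ j * \<xi> (axis k 1) $ i $ j = (if j = k then \<alpha> $ i * \<xi> (axis k 1) $ i $ k else 0)" for i j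
        by (simp add: axis_def)
      then show ?thesis by (simp add: matrix_def dual_bracket_nth)
    qed
    then have "trace (matrix (dbr \<alpha>)) = (\<Sum>i\<in>UNIV. \<Sum>k\<in>UNIV. \<alpha> $ i * \<xi> (axis k 1) $ i $ k)"
      unfolding trace_def by (subst sum.swap) simp
    also have "\<dots> = (\<Sum>i\<in>UNIV. \<Sum>k\<in>UNIV. - (\<alpha> $ i * \<xi> (axis k 1) $ k $ i))"
    proof (rule sum.cong[OF refl], rule sum.cong[OF refl])
      fix i k
      show "\<alpha> $ i * \<xi> (axis k 1) $ i $ k = - (\<alpha> $ i * \<xi> (axis k 1) $ k $ i)"
        using bivector_skew[OF bivector_cocycle, of "axis k 1" i k] by simp
    qed
    finally show ?thesis by (simp add: sum_negf sum_distrib_left)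
  qed
  show ?thesis
  proof
    assume "unimodular_lie_algebra dbr"
    then have z: "trace (matrix (dbr \<alpha>)) = 0" for \<alpha> by (simp add: unimodular_lie_algebra_def)
    have "(\<Sum>k\<in>UNIV. \<xi> (axis k 1) $ k $ l) = 0" for l
    proof -
      have "axis l 1 $ i * (\<Sum>k\<in>UNIV. \<xi> (axis k 1) $ k $ i) = (if i = l then \<Sum>k\<in>UNIV. \<xi> (axis k 1) $ k $ l else 0)" for i
        by (simp add: axis_def)
      then show ?thesis using z[of "axis l 1"] tr[of "axis l 1"] by simp
    qed
    then show "(\<chi> l. \<Sum>k\<in>UNIV. \<xi> (axis k 1) $ k $ l) = 0" by (simp add: vec_eq_iff)
  next
    assume "(\<chi> l. \<Sum>k\<in>UNIV. \<xi> (axis k 1) $ k $ l) = 0"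
    then have "(\<Sum>k\<in>UNIV. \<xi> (axis k 1) $ k $ l) = 0" for l by (simp add: vec_eq_iff)
    then show "unimodular_lie_algebra dbr"
      by (simp add: unimodular_lie_algebra_def lie_algebra_dual_bracket tr)
  qed
qed

end

section \<open>The volume form and its invariance under the adjoint action\<close>

locale poisson_lie_volume =
  poisson_lie A G P
  for A :: "('g::{t2_space, second_countable_topology}, 'n::finite) chart set" and G :: "'g monoid" (structure)
    and P :: "'g \<Rightarrow> real^'n^'n" +
  fixes \<mu> :: "'g \<Rightarrow> (real^'n) list \<Rightarrow> real"
  assumes connected_group: "connected (UNIV :: 'g set)"
    and unimodular: "unimodular_group A G"
    and volume: "volume_form A \<mu>"
    and left_invariant: "left_invariant_form A G \<mu>"
begin

abbreviation "\<mu>1 \<equiv> \<mu> \<one>"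
abbreviation "i\<pi>\<mu> \<equiv> (\<lambda>g. contract (P g) (\<mu> g))"

lemma alternating_\<mu>: "alternating_form CARD('n) (\<mu> g)"
  using volume by (simp add: volume_form_def differential_form_def)

lemma \<mu>_TL: "\<mu> g (map (TL g \<one>) vs) = \<mu>1 vs"
proof -
  have "pullback A (ltrans G g) \<mu> \<one> vs = \<mu>1 vs" using left_invariant by (simp add: left_invariant_form_def)
  moreover have "ltrans G g \<one> = g" by (simp add: ltrans_def)
  ultimately show ?thesis by (simp add: pullback_def)
qed

text \<open>\<open>TR g \<one>\<close> is \<open>TL g \<one>\<close> after \<open>Ad_inv g\<close>,
  and left invariance of \<mu> removes \<open>TL\<close>. Unimodularity compares densities, so the
  sign stays open.\<close>

lemma abs_\<mu>_Ad_inv: "\<bar>\<mu>1 (map (Ad_inv g) vs)\<bar> = \<bar>\<mu>1 vs\<bar>"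
proof -
  have "\<bar>pullback A (rtrans G g) \<mu> \<one> vs\<bar> = \<bar>\<mu>1 vs\<bar>"
    using unimodular volume left_invariant by (simp add: unimodular_group_def)
  moreover have "rtrans G g \<one> = g" by (simp add: rtrans_def)
  moreover have "map (TR g \<one>) vs = map (TL g \<one>) (map (Ad_inv g) vs)" by (simp add: TL_Ad_inv)
  ultimately show ?thesis by (simp only: pullback_def \<mu>_TL)
qed

lemma \<mu>_Ad_inv_has_derivative:
  "((\<lambda>z. \<mu>1 (map (Ad_inv (param1 z)) vs)) has_derivative
    (\<lambda>a. - (\<Sum>j<length vs. \<mu>1 (vs[j := br a (vs ! j)])))) (at x1)"
proof -
  have "((\<lambda>z. \<mu>1 ([] @ map (Ad_inv (param1 z)) vs)) has_derivative
    (\<lambda>a. 0 + (\<Sum>j<length vs. \<mu>1 ([] @ (map (Ad_inv (param1 x1)) vs)[j := - br a (vs ! j)])))) (at x1)"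
    by (rule has_derivative_multilinear[OF _ has_derivative_const Ad_inv_has_derivative])
      (simp add: alternating_form_linear[OF alternating_\<mu>])
  moreover have "map (Ad_inv (param1 x1)) vs = vs" by (simp add: map_idI Ad_inv_one)
  moreover have "\<mu>1 (vs[j := - w]) = - \<mu>1 (vs[j := w])" if "j < length vs" for j w
    using linear_neg[OF alternating_form_linear[OF alternating_\<mu>[of \<one>], of "take j vs" "drop (Suc j) vs"], of w] that
    by (simp add: list_update_split)
  ultimately show ?thesis by (simp add: sum_negf)
qed

text \<open>A continuous function of constant modulus is locally constant.\<close>

lemma eventually_\<mu>_Ad_inv: "\<forall>\<^sub>F z in nhds x1. \<mu>1 (map (Ad_inv (param1 z)) vs) = \<mu>1 vs"
proof (cases "\<mu>1 vs = 0")
  case True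
  then show ?thesis using abs_\<mu>_Ad_inv[of _ vs] by simp
next
  case False
  let ?f = "\<lambda>z. \<mu>1 (map (Ad_inv (param1 z)) vs)"
  have f1: "?f x1 = \<mu>1 vs" by (simp add: map_idI Ad_inv_one)
  have "isCont ?f x1" by (rule has_derivative_continuous[OF \<mu>_Ad_inv_has_derivative])
  \<comment> \<open>The ball is chosen so as to exclude \<open>- \<mu>1 vs\<close>, the only other
    value of the same modulus.\<close>
  moreover have "\<forall>\<^sub>F r in nhds (?f x1). r \<in> ball (\<mu>1 vs) \<bar>\<mu>1 vs\<bar>"
    unfolding f1 using False by (intro eventually_nhds_open) simp_all
  ultimately have "\<forall>\<^sub>F z in nhds x1. ?f z \<in> ball (\<mu>1 vs) \<bar>\<mu>1 vs\<bar>" by (rule isCont_eventually)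
  then show ?thesis
  proof (rule eventually_mono)
    fix z assume "?f z \<in> ball (\<mu>1 vs) \<bar>\<mu>1 vs\<bar>"
    then have "\<bar>\<mu>1 vs - ?f z\<bar> < \<bar>\<mu>1 vs\<bar>" by (simp add: dist_real_def)
    then show "?f z = \<mu>1 vs" using abs_\<mu>_Ad_inv[of "param1 z" vs] by linarith
  qed
qed

text \<open>The left-hand side is tr(ad_a) times \<open>\<mu>1 vs\<close> for lists of full length.
  Up to sign it is the derivative of the function that \<open>eventually_\<mu>_Ad_inv\<close> shows
  to be constant near the identity.\<close>

lemma \<mu>_br: "(\<Sum>j<length vs. \<mu>1 (vs[j := br a (vs ! j)])) = 0"
proof -
  have "((\<lambda>z. \<mu>1 vs) has_derivative (\<lambda>a. - (\<Sum>j<length vs. \<mu>1 (vs[j := br a (vs ! j)])))) (at x1)"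
    by (rule has_derivative_transform_nhds[OF \<mu>_Ad_inv_has_derivative eventually_\<mu>_Ad_inv])
  from fun_cong[OF has_derivative_unique[OF this has_derivative_const], of a] show ?thesis by simp
qed

text \<open>For a single list the neighbourhood depends on the list. The finitely many lists of
  basis vectors have a common neighbourhood, and they determine the form.\<close>

lemma eventually_\<mu>_Ad_inv_all: "\<forall>\<^sub>F z in nhds x1. \<forall>vs. \<mu>1 (map (Ad_inv (param1 z)) vs) = \<mu>1 vs"
proof -
  let ?B = "{vs :: (real^'n) list. set vs \<subseteq> Basis \<and> length vs = CARD('n)}"
  have "finite ?B" by (rule finite_lists_length_eq) simp
  then have "\<forall>\<^sub>F z in nhds x1. \<forall>vs\<in>?B. \<mu>1 (map (Ad_inv (param1 z)) vs) = \<mu>1 vs"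
    by (rule eventually_ball_finite) (simp add: eventually_\<mu>_Ad_inv)
  then show ?thesis
  proof (rule eventually_mono)
    fix z assume z: "\<forall>vs\<in>?B. \<mu>1 (map (Ad_inv (param1 z)) vs) = \<mu>1 vs"
    show "\<forall>vs. \<mu>1 (map (Ad_inv (param1 z)) vs) = \<mu>1 vs"
    proof
      fix vs show "\<mu>1 (map (Ad_inv (param1 z)) vs) = \<mu>1 vs"
        by (rule form_eq_if_eq_on_axes[OF alternating_map[OF alternating_\<mu> linear_Ad_inv] alternating_\<mu>])
          (use z in simp)
    qed
  qed
qed

section \<open>The exterior derivative in the left invariant frame\<close>

lemma form_rep_frame:
  assumes "C \<in> A" "x \<in> chart_image C"
  shows "form_rep A C i\<pi>\<mu> x (map (frame C x) bs) = contract (pl (chart_inv C x)) \<mu>1 bs"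
proof -
  let ?g = "chart_inv C x"
  have "map (from_chart A C x) (map (frame C x) bs) = map (TL ?g \<one>) bs"
    by (simp add: from_chart_frame[OF assms])
  then have "form_rep A C i\<pi>\<mu> x (map (frame C x) bs) = contract (push_bivector (TL ?g \<one>) (pl ?g)) (\<mu> ?g) (map (TL ?g \<one>) bs)"
    by (simp only: form_rep_def P_eq_push[of ?g, symmetric])
  then show ?thesis by (simp add: contract_push[OF alternating_\<mu> linear_TL] \<mu>_TL)
qed

text \<open>In contrast to \<open>form_rep_frame\<close>, both factors appear with their coordinate
  components, which are smooth by hypothesis. This is what makes the contracted form differentiable
  in the chart.\<close>

lemma form_rep_eq_contract:
  assumes "C \<in> A" "x \<in> chart_image C"
  shows "form_rep A C i\<pi>\<mu> x vs = contract (bivector_rep A C P x) (form_rep A C \<mu> x) vs"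
proof -
  let ?g = "chart_inv C x"
  note g = chart_inv_in[OF assms]
  have x: "snd C ?g = x" by (rule chart_chart_inv[OF assms])
  have lin: "linear (from_chart A C x)" using linear_from_chart[OF assms(1) g] by (simp add: x)
  have "from_chart A C x \<circ> to_chart A C ?g = id"
    using from_to_chart[OF assms(1) g] by (simp add: fun_eq_iff x)
  then have "P ?g = push_bivector (from_chart A C x) (bivector_rep A C P x)"
    by (simp add: bivector_rep_def push_bivector_compose lin linear_to_chart[OF assms(1) g])
  then show ?thesis
    by (simp add: form_rep_def[of A C i\<pi>\<mu>] contract_push[OF alternating_\<mu> lin]) (simp add: form_rep_def[abs_def])
qed

lemma form_rep_differentiable:
  assumes "C \<in> A" "x \<in> chart_image C"
  shows "(\<lambda>x. form_rep A C i\<pi>\<mu> x vs) differentiable (at x)"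
proof -
  have "smooth_on (chart_image C) (\<lambda>x. form_rep A C \<mu> x ws)" for ws
    using volume assms(1) by (simp add: volume_form_def differential_form_def)
  then have m: "(\<lambda>x. form_rep A C \<mu> x ws) differentiable (at x)" for ws
    using smooth_on_has_derivative assms(2) differentiableI by blast
  have p: "(\<lambda>x. bivector_rep A C P x $ i $ j) differentiable (at x)" for i j
    by (rule differentiable_vec_nth[OF differentiable_vec_nth[OF differentiableI[OF bivector_rep_has_derivative[OF assms]]]])
  have "(\<lambda>x. bivector_rep A C P x $ i $ j / 2 * form_rep A C \<mu> x ws) differentiable (at x)" for i j ws
    using differentiable_mult[OF differentiable_mult[OF p[of i j] differentiable_const[of "1/2"]] m[of ws]] by simp
  then have "(\<lambda>x. contract (bivector_rep A C P x) (form_rep A C \<mu> x) vs) differentiable (at x)"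
    unfolding contract_def by (intro differentiable_sum finite) simp_all
  then obtain D where "((\<lambda>x. contract (bivector_rep A C P x) (form_rep A C \<mu> x) vs) has_derivative D) (at x)"
    by (auto simp: differentiable_def)
  then have "((\<lambda>x. form_rep A C i\<pi>\<mu> x vs) has_derivative D) (at x)"
    by (rule has_derivative_transform_nhds)
      (rule eventually_mono[OF eventually_chart_image[OF assms]], simp add: form_rep_eq_contract[OF assms(1)])
  then show ?thesis by (auto simp: differentiable_def)
qed

lemma linear_form_rep:
  assumes "C \<in> A" "x \<in> chart_image C"
  shows "linear (\<lambda>v. form_rep A C i\<pi>\<mu> x (us @ v # ws))"
proof -
  have "linear (from_chart A C x)"
    using linear_from_chart[OF assms(1) chart_inv_in[OF assms]] by (simp add: chart_chart_inv[OF assms])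
  from linear_compose[OF this linear_contract_slot[OF alternating_\<mu>]]
  show ?thesis by (simp add: form_rep_def o_def)
qed

text \<open>The derivative of \<open>i\<^sub>\<pi> \<mu>\<close> in the left invariant frame, computed in two ways.\<close>

lemma frame_derivative:
  fixes p a bs
  defines "C \<equiv> chart_at A p" and "x \<equiv> coord A p p"
  shows "contract (\<xi> a - (matrix (br a) ** pl p + pl p ** transpose (matrix (br a)))) \<mu>1 bs =
    frechet_derivative (\<lambda>x. form_rep A C i\<pi>\<mu> x (map (TL p \<one>) bs)) (at x) (TL p \<one> a) +
    (\<Sum>j<length bs. form_rep A C i\<pi>\<mu> x ((map (TL p \<one>) bs)[j := dframe C x (TL p \<one> a) (bs ! j)]))"
proof -
  have C: "C \<in> A" and x: "x \<in> chart_image C" by (simp_all add: C_def x_def chart_at_in coord_in_image)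
  have p: "chart_inv C x = p" using param_coord[of p] by (simp add: C_def x_def param_def)
  have fr: "frame C x v = TL p \<one> v" for v unfolding frame_def p by (simp add: C_def to_chart_self)
  let ?L = "\<lambda>w vs. frechet_derivative (\<lambda>x. form_rep A C i\<pi>\<mu> x vs) (at x) w"
  have L: "((\<lambda>x. form_rep A C i\<pi>\<mu> x vs) has_derivative (\<lambda>w. ?L w vs)) (at x)" for vs
    using form_rep_differentiable[OF C x] by (simp add: frechet_derivative_works[symmetric] eta_contract_eq)
  have lin: "\<forall>\<^sub>F y in nhds x. \<forall>us ws. linear (\<lambda>v. form_rep A C i\<pi>\<mu> y (us @ v # ws))"
    by (rule eventually_mono[OF eventually_chart_image[OF C x]]) (simp add: linear_form_rep[OF C])
  \<comment> \<open>First computation: the product rule in the chart, in which both the form and the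
    frame vary.\<close>
  have "((\<lambda>y. form_rep A C i\<pi>\<mu> y ([] @ map (frame C y) bs)) has_derivative
    (\<lambda>w. ?L w ([] @ map (frame C x) bs) +
      (\<Sum>j<length bs. form_rep A C i\<pi>\<mu> x ([] @ (map (frame C x) bs)[j := dframe C x w (bs ! j)])))) (at x)"
    by (rule has_derivative_multilinear[OF lin L dframe_has_derivative[OF C x]])
  then have D: "((\<lambda>y. form_rep A C i\<pi>\<mu> y (map (frame C y) bs)) has_derivative
    (\<lambda>w. ?L w (map (TL p \<one>) bs) +
      (\<Sum>j<length bs. form_rep A C i\<pi>\<mu> x ((map (TL p \<one>) bs)[j := dframe C x w (bs ! j)])))) (at (snd C (p \<otimes> param1 x1)))"
    by (simp add: fr[abs_def] eta_contract_eq x_def[symmetric]) (simp add: C_def x_def coord_def)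
  have "((\<lambda>z. snd C (p \<otimes> param1 z)) has_derivative TL p \<one>) (at x1)"
    using frame_has_derivative[OF C x] by (simp add: p fr[abs_def] eta_contract_eq)
  from has_derivative_compose[OF this D]
  have "((\<lambda>z. form_rep A C i\<pi>\<mu> (snd C (p \<otimes> param1 z)) (map (frame C (snd C (p \<otimes> param1 z))) bs)) has_derivative
    (\<lambda>a. ?L (TL p \<one> a) (map (TL p \<one>) bs) +
      (\<Sum>j<length bs. form_rep A C i\<pi>\<mu> x ((map (TL p \<one>) bs)[j := dframe C x (TL p \<one> a) (bs ! j)])))) (at x1)" .
  moreover have "\<forall>\<^sub>F h in nhds \<one>. p \<otimes> h \<in> fst C"
  proof -
    have "\<forall>\<^sub>F h in nhds (p \<otimes> \<one>). h \<in> fst C"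
      using eventually_chart_domain[OF C, of p] in_chart_at[of p] by (simp add: C_def)
    from isCont_eventually[OF isCont_mult_left this] show ?thesis .
  qed
  from eventually_param[OF this]
  have "\<forall>\<^sub>F z in nhds x1. form_rep A C i\<pi>\<mu> (snd C (p \<otimes> param1 z)) (map (frame C (snd C (p \<otimes> param1 z))) bs)
      = contract (pl (p \<otimes> param1 z)) \<mu>1 bs"
    by eventually_elim (simp add: form_rep_frame[OF C chart_in_image] chart_inv_chart[OF C])
  ultimately have 1: "((\<lambda>z. contract (pl (p \<otimes> param1 z)) \<mu>1 bs) has_derivative
    (\<lambda>a. ?L (TL p \<one> a) (map (TL p \<one>) bs) +
      (\<Sum>j<length bs. form_rep A C i\<pi>\<mu> x ((map (TL p \<one>) bs)[j := dframe C x (TL p \<one> a) (bs ! j)])))) (at x1)"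
    by (rule has_derivative_transform_nhds)
  \<comment> \<open>Second computation: in the frame the form is the contraction of
    \<open>pl\<close> with the fixed form \<open>\<mu>1\<close>, and the derivative of
    \<open>pl\<close> is known from the cocycle property.\<close>
  have "((\<lambda>z. contract (pl (p \<otimes> param1 z)) \<mu>1 bs) has_derivative
    (\<lambda>a. contract (\<xi> a - (matrix (br a) ** pl p + pl p ** transpose (matrix (br a)))) \<mu>1 bs)) (at x1)"
    by (rule has_derivative_linear_comp[OF linear_contract pl_has_derivative])
  from fun_cong[OF has_derivative_unique[OF this 1], of a] show ?thesis .
qed

abbreviation modular_term :: "(real^'n) list \<Rightarrow> real" where
  "modular_term as \<equiv> (\<Sum>i<length as. (-1) ^ i * contract (\<xi> (as ! i)) \<mu>1 (remove_nth i as))"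

lemma br_skew: "br a b = - br b a"
  by (simp add: lie_bracket_eq)

text \<open>Each derivative in \<open>ext_d\<close> is replaced by means of
  \<open>frame_derivative\<close>, and the alternating sum is split into the \<xi> part, the ad part
  and the variation of the frame.\<close>

lemma ext_d_TL:
  assumes "length as = CARD('n) - 1"
  shows "ext_d A i\<pi>\<mu> p (map (TL p \<one>) as) = modular_term as + dual_cocycle br (contract (pl p) \<mu>1) as"
\<comment> \<open>The empty list is the case of dimension one, where both sides are empty sums;
  otherwise the dimension is \<open>Suc (Suc m)\<close> and the contracted form has degree
  \<open>m\<close>.\<close>
proof (cases "as = []")
  case True
  then show ?thesis by (simp add: ext_d_def dual_cocycle_def ce_d_def)
next
  case False
  then obtain m where m: "length as = Suc m" by (cases as) auto
  have n: "CARD('n) = Suc (Suc m)" using assms m by simp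
  let ?C = "chart_at A p" and ?x = "coord A p p" and ?T = "TL p \<one>"
  note C = chart_at_in[of p] and x = coord_in_image[of p]
  have p: "chart_inv ?C ?x = p" using param_coord[of p] by (simp add: param_def)
  have fr: "frame ?C ?x v = ?T v" for v unfolding frame_def p by (simp add: to_chart_self)
  have len: "length (remove_nth i as) = m" if "i < Suc m" for i using that m by (simp add: length_remove_nth)
  have alt: "alternating_form m (contract Q \<mu>1)" for Q
    by (rule alternating_contract) (use alternating_\<mu>[of \<one>] n in simp)
  define \<Lambda> where "\<Lambda> = form_rep A ?C i\<pi>\<mu> ?x"
  have \<Lambda>T: "\<Lambda> (map ?T ws) = contract (pl p) \<mu>1 ws" for ws
    using form_rep_frame[OF C x, of ws] unfolding \<Lambda>_def fr[abs_def] p by (simp add: eta_contract_eq)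
  have alt\<Lambda>: "alternating_form m \<Lambda>"
  proof -
    have "linear (from_chart A ?C ?x)"
      using linear_from_chart[OF C chart_inv_in[OF C x]] by (simp add: chart_chart_inv[OF C x])
    moreover have "alternating_form m (contract (P p) (\<mu> p))"
      by (rule alternating_contract) (use alternating_\<mu>[of p] n in simp)
    ultimately have "alternating_form m (\<lambda>ws. contract (P p) (\<mu> p) (map (from_chart A ?C ?x) ws))"
      by (intro alternating_map)
    moreover have "\<Lambda> = (\<lambda>ws. contract (P p) (\<mu> p) (map (from_chart A ?C ?x) ws))"
      by (simp add: \<Lambda>_def fun_eq_iff form_rep_def p)
    ultimately show ?thesis by simp
  qed
  \<comment> \<open>\<open>S\<close> expresses the derivative of the frame as a function of two
    vectors at \<open>p\<close>, the shape required by \<open>sum_replace_eq_ce_d\<close>. By the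
    structure equation its commutator is the bracket carried to \<open>p\<close>.\<close>
  define S where "S u v = dframe ?C ?x u (TL (inv p) p v)" for u v
  have ST: "S u (?T b) = dframe ?C ?x u b" for u b by (simp add: S_def TL_inv_TL)
  have frame_part: "(\<Sum>i<Suc m. (-1) ^ i * (\<Sum>k<m. \<Lambda> ((map ?T (remove_nth i as))[k := dframe ?C ?x (?T (as ! i)) (remove_nth i as ! k)]))) =
      - ce_d br (contract (pl p) \<mu>1) as"
  proof -
    have "(\<Sum>i<Suc m. (-1) ^ i * (\<Sum>k<m. \<Lambda> ((map ?T (remove_nth i as))[k := dframe ?C ?x (?T (as ! i)) (remove_nth i as ! k)]))) =
      (\<Sum>i<Suc m. (-1) ^ i * (\<Sum>k<m. \<Lambda> ((remove_nth i (map ?T as))[k := S (map ?T as ! i) (remove_nth i (map ?T as) ! k)])))"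
      by (rule sum.cong[OF refl]) (simp add: map_remove_nth[symmetric] ST m len)
    also have "\<dots> = - ce_d (\<lambda>a b. S a b - S b a) \<Lambda> (map ?T as)"
      by (rule sum_replace_eq_ce_d[OF alt\<Lambda>]) (simp add: m)
    also have "ce_d (\<lambda>a b. S a b - S b a) \<Lambda> (map ?T as) = ce_d br (\<lambda>ws. \<Lambda> (map ?T ws)) as"
      by (rule ce_d_map) (use structure_equation[OF C x] in \<open>simp add: ST fr\<close>)
    finally show ?thesis by (simp add: \<Lambda>T)
  qed
  \<comment> \<open>Here the bracket itself takes the place of \<open>S\<close>, and its commutator
    is twice the bracket: the source of the factor 2.\<close>
  have ad_part: "(\<Sum>i<Suc m. (-1) ^ i * contract (matrix (br (as ! i)) ** pl p + pl p ** transpose (matrix (br (as ! i)))) \<mu>1 (remove_nth i as)) =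
      2 * ce_d br (contract (pl p) \<mu>1) as"
  proof -
    have "(\<Sum>i<Suc m. (-1) ^ i * contract (matrix (br (as ! i)) ** pl p + pl p ** transpose (matrix (br (as ! i)))) \<mu>1 (remove_nth i as)) =
      - (\<Sum>i<Suc m. (-1) ^ i * (\<Sum>k<m. contract (pl p) \<mu>1 ((remove_nth i as)[k := br (as ! i) (remove_nth i as ! k)])))"
      unfolding sum_negf[symmetric]
      by (rule sum.cong[OF refl])
        (simp add: contract_derivation[OF alternating_\<mu> linear_br \<mu>_br] len n)
    also have "\<dots> = ce_d (\<lambda>a b. br a b - br b a) (contract (pl p) \<mu>1) as"
      by (simp only: sum_replace_eq_ce_d[OF alt m] minus_minus)
    also have "(\<lambda>a b. br a b - br b a) = (\<lambda>a b. 2 *\<^sub>R br a b)"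
    proof (intro ext)
      fix a b show "br a b - br b a = 2 *\<^sub>R br a b"
        by (subst br_skew[of b a]) (simp add: scaleR_2)
    qed
    also have "ce_d (\<lambda>a b. 2 *\<^sub>R br a b) (contract (pl p) \<mu>1) as = 2 * ce_d br (contract (pl p) \<mu>1) as"
      unfolding ce_d_def
      by (simp add: linear_scale[OF alternating_form_linear_Cons[OF alt]] sum_distrib_left mult_ac)
    finally show ?thesis .
  qed
  have "ext_d A i\<pi>\<mu> p (map ?T as) = (\<Sum>i<Suc m. (-1) ^ i *
      frechet_derivative (\<lambda>y. form_rep A ?C i\<pi>\<mu> y (map ?T (remove_nth i as))) (at ?x) (?T (as ! i)))"
    unfolding ext_d_def by (simp add: m map_remove_nth del: sum.lessThan_Suc)
  also have "\<dots> = (\<Sum>i<Suc m. (-1) ^ i *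
      (contract (\<xi> (as ! i) - (matrix (br (as ! i)) ** pl p + pl p ** transpose (matrix (br (as ! i))))) \<mu>1 (remove_nth i as) -
       (\<Sum>k<m. \<Lambda> ((map ?T (remove_nth i as))[k := dframe ?C ?x (?T (as ! i)) (remove_nth i as ! k)]))))"
    by (rule sum.cong[OF refl]) (simp add: frame_derivative[of _ p] \<Lambda>_def len)
  also have "\<dots> = (\<Sum>i<Suc m. (-1) ^ i * contract (\<xi> (as ! i)) \<mu>1 (remove_nth i as)) -
      (\<Sum>i<Suc m. (-1) ^ i * contract (matrix (br (as ! i)) ** pl p + pl p ** transpose (matrix (br (as ! i)))) \<mu>1 (remove_nth i as)) -
      (\<Sum>i<Suc m. (-1) ^ i * (\<Sum>k<m. \<Lambda> ((map ?T (remove_nth i as))[k := dframe ?C ?x (?T (as ! i)) (remove_nth i as ! k)])))"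
    by (simp only: contract_diff right_diff_distrib sum_subtractf)
  finally show ?thesis
    unfolding frame_part ad_part dual_cocycle_def m by simp
qed

lemma ext_d_length:
  assumes "length vs \<noteq> CARD('n) - 1"
  shows "ext_d A i\<pi>\<mu> p vs = 0"
proof -
  have "form_rep A C i\<pi>\<mu> x (remove_nth i vs) = 0" if "i < length vs" for C x i
    unfolding form_rep_def
    by (rule contract_length[OF alternating_\<mu>]) (use that assms in \<open>simp add: length_remove_nth\<close>)
  then show ?thesis by (simp add: ext_d_def)
qed

lemma dual_cocycle_length:
  "length vs \<noteq> CARD('n) - 1 \<Longrightarrow> dual_cocycle br (contract Q \<mu>1) vs = 0"
  by (simp add: dual_cocycle_def ce_d_contract_length[OF alternating_\<mu>])

lemma ext_d_zero_iff:
  "ext_d A i\<pi>\<mu> = (\<lambda>g vs. 0) \<longleftrightarrow>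
    (\<forall>as. length as = CARD('n) - 1 \<longrightarrow> modular_term as = 0) \<and>
    (\<forall>g as. dual_cocycle br (contract (pl g) \<mu>1) as = 0)" (is "?L \<longleftrightarrow> ?T \<and> ?J")
proof
  assume L: ?L
  have sum0: "modular_term as + dual_cocycle br (contract (pl g) \<mu>1) as = 0" if "length as = CARD('n) - 1" for g as
    using ext_d_TL[OF that, of g] L by simp
  have "dual_cocycle br (contract (pl \<one>) \<mu>1) as = 0" for as
    by (simp add: pl_one dual_cocycle_def ce_d_def)
  with sum0[of _ \<one>] have T: ?T by simp
  moreover have ?J
  proof (intro allI)
    fix g as
    show "dual_cocycle br (contract (pl g) \<mu>1) as = 0"
      using sum0[of as g] T dual_cocycle_length[of as "pl g"] by (cases "length as = CARD('n) - 1") auto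
  qed
  ultimately show "?T \<and> ?J" ..
next
  assume R: "?T \<and> ?J"
  have "ext_d A i\<pi>\<mu> p vs = 0" for p vs
  proof (cases "length vs = CARD('n) - 1")
    case True
    define ws where "ws = map (TL (inv p) p) vs"
    have len: "length ws = CARD('n) - 1" using True by (simp add: ws_def)
    have "map (TL p \<one>) ws = vs" by (simp add: ws_def map_idI TL_TL_inv)
    moreover have "modular_term ws = 0" using R len by blast
    ultimately show ?thesis using ext_d_TL[OF len, of p] R by simp
  qed (rule ext_d_length)
  then show ?L by (simp add: fun_eq_iff)
qed

text \<open>\<open>modular_term\<close> is minus the interior product of \<open>\<mu>1\<close> with
  the trace vector of \<xi>, and a nonzero top form has no kernel.\<close>

lemma modular_term_zero_iff:
  "(\<forall>as. length as = CARD('n) - 1 \<longrightarrow> modular_term as = 0) \<longleftrightarrow> unimodular_lie_algebra dbr"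
proof -
  let ?t = "\<chi> l. \<Sum>k\<in>UNIV. \<xi> (axis k 1) $ k $ l"
  have T: "modular_term as = - \<mu>1 (?t # as)" for as
    by (rule sum_contract_eq_trace[OF alternating_\<mu> linear_cocycle bivector_cocycle])
  obtain vs where "\<mu>1 vs \<noteq> 0" using volume by (auto simp: volume_form_def)
  then have "(\<forall>as. length as = CARD('n) - 1 \<longrightarrow> \<mu>1 (?t # as) = 0) \<Longrightarrow> ?t = 0"
    using top_form_nondegenerate[OF alternating_\<mu>, of \<one> vs ?t] by blast
  moreover have "?t = 0 \<Longrightarrow> \<mu>1 (?t # as) = 0" for as
    using linear_0[OF alternating_form_linear_Cons[OF alternating_\<mu>[of \<one>], of as]] by metis
  ultimately show ?thesis unfolding T unimodular_dual_iff by auto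
qed

section \<open>Vanishing of the cocycle form on the connected group\<close>

abbreviation cocycle_form :: "real^'n^'n \<Rightarrow> (real^'n) list \<Rightarrow> real" where
  "cocycle_form Q \<equiv> dual_cocycle br (contract Q \<mu>1)"

lemma linear_cocycle_form: "linear (\<lambda>Q. cocycle_form Q vs)"
  unfolding dual_cocycle_def by (rule linear_compose_neg[OF linear_ce_d_contract])

text \<open>\<open>cocycle_form\<close> is built from the bracket, the contraction and
  \<open>\<mu>1\<close>, and \<open>Ad_inv g\<close> respects all three. The assumption is available
  for \<open>g\<close> near the identity, where the sign is settled.\<close>

lemma cocycle_form_push:
  assumes "\<And>vs. \<mu>1 (map (Ad_inv g) vs) = \<mu>1 vs"
  shows "cocycle_form (push_bivector (Ad_inv g) Q) (map (Ad_inv g) vs) = cocycle_form Q vs"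
  unfolding dual_cocycle_def
  by (simp add: ce_d_map[of br "Ad_inv g" br, OF Ad_inv_br[symmetric]] contract_push[OF alternating_\<mu> linear_Ad_inv] assms)

lemma cocycle_form_push_zero_iff:
  assumes "\<And>vs. \<mu>1 (map (Ad_inv g) vs) = \<mu>1 vs"
  shows "(\<forall>vs. cocycle_form (push_bivector (Ad_inv g) Q) vs = 0) \<longleftrightarrow> (\<forall>vs. cocycle_form Q vs = 0)"
proof -
  have "surj (Ad_inv g)" by (rule linear_inj_imp_surj[OF linear_Ad_inv inj_Ad_inv])
  then have "\<exists>ws. vs = map (Ad_inv g) ws" for vs
    by (metis ex_map_conv surjD)
  then show ?thesis using cocycle_form_push[OF assms] by metis
qed

text \<open>By multiplicativity \<open>g \<mapsto> \<rho>(i\<^bsub>\<pi>\<^sub>\<ell>(g)\<^esub> \<mu>)\<close> has vanishing derivative in the right invariant directions.\<close>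

lemma cocycle_form_pl_near_one:
  assumes "\<And>u. cocycle_form (\<xi> u) = (\<lambda>vs. 0)"
  obtains U where "open U" "\<one> \<in> U" "\<And>h vs. h \<in> U \<Longrightarrow> cocycle_form (pl h) vs = 0"
    "\<And>h vs. h \<in> U \<Longrightarrow> \<mu>1 (map (Ad_inv h) vs) = \<mu>1 vs"
proof -
  note one = chart_at_in[of \<one>]
  \<comment> \<open>The ball lies in the chart image, and \<open>\<mu>1\<close> is invariant, sign
    included, under \<open>Ad_inv\<close> of all its points.\<close>
  from eventually_conj[OF eventually_chart_image[OF one x1_in_image] eventually_\<mu>_Ad_inv_all]
  obtain r where r: "r > 0" and rC: "ball x1 r \<subseteq> chart_image C1"
    and r\<mu>: "\<And>z vs. z \<in> ball x1 r \<Longrightarrow> \<mu>1 (map (Ad_inv (param1 z)) vs) = \<mu>1 vs"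
    by (auto simp: eventually_nhds_metric dist_commute subset_iff)
  have zero: "((\<lambda>z. cocycle_form (pl (param1 z)) vs) has_derivative (\<lambda>a. 0)) (at z)" if z: "z \<in> ball x1 r" for z vs
  proof -
    have zC: "z \<in> chart_image C1" using z rC by blast
    let ?g = "param1 z"
    have g: "chart_inv C1 z = ?g" by (simp add: param1_eq)
    have push0: "cocycle_form (push_bivector (Ad_inv ?g) (\<xi> a)) vs = 0" for a
      using cocycle_form_push_zero_iff[of ?g "\<xi> a", OF r\<mu>[OF z]] assms by simp
    obtain D where "((\<lambda>z. pl (param1 z)) has_derivative D) (at z)"
      using pl_differentiable[OF one zC] by (auto simp: differentiable_def param1_eq)
    from has_derivative_linear_comp[OF linear_cocycle_form this]
    have F: "((\<lambda>z. cocycle_form (pl (param1 z)) vs) has_derivative (\<lambda>a. cocycle_form (D a) vs)) (at z)" .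
    \<comment> \<open>\<open>?N\<close> is the derivative at the identity of y -> y g, thus the
      right invariant frame at g. The function is differentiated along y -> y g in two ways: by the
      chain rule, and by \<open>pl_mult\<close>, where only \<open>pl (param1 y)\<close>
      varies.\<close>
    let ?N = "\<lambda>v. to_chart A C1 ?g (TR ?g \<one> v)"
    have "snd C1 (param1 x1 \<otimes> ?g) = z" by (simp add: g[symmetric] chart_chart_inv[OF one zC])
    then have "((\<lambda>y. cocycle_form (pl (param1 (snd C1 (param1 y \<otimes> ?g)))) vs) has_derivative (\<lambda>a. cocycle_form (D (?N a)) vs)) (at x1)"
      using has_derivative_compose[OF TR_has_derivative[OF one zC]] F by (simp add: g)
    moreover have "\<forall>\<^sub>F y in nhds x1. cocycle_form (pl (param1 (snd C1 (param1 y \<otimes> ?g)))) vs =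
        cocycle_form (pl ?g) vs + cocycle_form (push_bivector (Ad_inv ?g) (pl (param1 y))) vs"
      using eventually_mult_dom(2)[OF one one one mult_dom_one_left[OF one zC]]
    proof (rule eventually_mono)
      fix y assume "(y, z) \<in> mult_dom C1 C1 C1"
      then have "param1 (snd C1 (param1 y \<otimes> ?g)) = param1 y \<otimes> ?g"
        by (simp add: mult_dom_def param1_eq chart_inv_chart[OF one])
      then show "cocycle_form (pl (param1 (snd C1 (param1 y \<otimes> ?g)))) vs =
        cocycle_form (pl ?g) vs + cocycle_form (push_bivector (Ad_inv ?g) (pl (param1 y))) vs"
        by (simp add: pl_mult linear_add[OF linear_cocycle_form])
    qed
    ultimately have "((\<lambda>y. cocycle_form (pl ?g) vs + cocycle_form (push_bivector (Ad_inv ?g) (pl (param1 y))) vs)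
        has_derivative (\<lambda>a. cocycle_form (D (?N a)) vs)) (at x1)"
      by (rule has_derivative_transform_nhds)
    moreover have "((\<lambda>y. cocycle_form (pl ?g) vs + cocycle_form (push_bivector (Ad_inv ?g) (pl (param1 y))) vs)
        has_derivative (\<lambda>a. 0 + cocycle_form (push_bivector (Ad_inv ?g) (\<xi> a)) vs)) (at x1)"
    proof (rule has_derivative_add[OF has_derivative_const])
      have "linear (push_bivector (Ad_inv ?g))"
        by (rule linearI, rule push_bivector_add)
          (simp add: push_bivector_def matrix_matrix_mult_def vec_eq_iff sum_distrib_left sum_distrib_right mult_ac)
      then have "linear (\<lambda>Q. cocycle_form (push_bivector (Ad_inv ?g) Q) vs)"
        using linear_compose[OF _ linear_cocycle_form] by (simp add: o_def)
      from has_derivative_linear_comp[OF this pl_has_derivative_one]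
      show "((\<lambda>y. cocycle_form (push_bivector (Ad_inv ?g) (pl (param1 y))) vs)
        has_derivative (\<lambda>a. cocycle_form (push_bivector (Ad_inv ?g) (\<xi> a)) vs)) (at x1)" .
    qed
    ultimately have "(\<lambda>a. cocycle_form (D (?N a)) vs) = (\<lambda>a. 0 + cocycle_form (push_bivector (Ad_inv ?g) (\<xi> a)) vs)"
      by (rule has_derivative_unique)
    then have N0: "cocycle_form (D (?N a)) vs = 0" for a by (simp add: push0 fun_eq_iff)
    have N: "?N a = frame C1 z (Ad_inv ?g a)" for a by (simp add: frame_Ad_inv rframe_def)
    \<comment> \<open>\<open>?N\<close> is the frame after \<open>Ad_inv\<close>, both surjective,
      so the right invariant directions are all directions.\<close>
    have "cocycle_form (D w) vs = 0" for w
    proof -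
      have "surj (frame C1 z)" "surj (Ad_inv ?g)"
        by (rule linear_inj_imp_surj[OF linear_frame[OF one zC] inj_frame[OF one zC]],
            rule linear_inj_imp_surj[OF linear_Ad_inv inj_Ad_inv])
      then obtain b a where "w = frame C1 z b" "b = Ad_inv ?g a" by (meson surjD)
      then show ?thesis using N0[of a] N[of a] by simp
    qed
    then show ?thesis using F by simp
  qed
  have const: "cocycle_form (pl (param1 z)) vs = 0" if "z \<in> ball x1 r" for z vs
  proof -
    have "\<exists>c. \<forall>z\<in>ball x1 r. cocycle_form (pl (param1 z)) vs = c"
      by (rule has_derivative_zero_constant[OF convex_ball]) (rule has_derivative_at_withinI[OF zero])
    then have "cocycle_form (pl (param1 z)) vs = cocycle_form (pl (param1 x1)) vs" using that r by (metis centre_in_ball)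
    then show ?thesis by (simp add: pl_one linear_0[OF linear_cocycle_form])
  qed
  let ?U = "{h \<in> fst C1. snd C1 h \<in> ball x1 r}"
  have "?U = fst C1 \<inter> snd C1 -` ball x1 r" by auto
  moreover have "open (snd C1 -` ball x1 r \<inter> fst C1)"
    using chart_homeomorphism[OF one] continuous_on_open_vimage[OF open_chart_domain[OF one], of "snd C1"]
    by (simp add: homeomorphism_def)
  ultimately have "open ?U" by (simp add: Int_commute)
  moreover have "\<one> \<in> ?U" using r in_chart_at[of \<one>] by (simp add: coord_def)
  moreover have "cocycle_form (pl h) vs = 0" "\<mu>1 (map (Ad_inv h) vs) = \<mu>1 vs" if "h \<in> ?U" for h vs
  proof -
    have h: "param1 (snd C1 h) = h" using that by (simp add: param1_eq chart_inv_chart[OF one])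
    show "cocycle_form (pl h) vs = 0" using const[of "snd C1 h" vs] that by (simp add: h)
    show "\<mu>1 (map (Ad_inv h) vs) = \<mu>1 vs" using r\<mu>[of "snd C1 h" vs] that by (simp add: h)
  qed
  ultimately show ?thesis by (rule that)
qed

lemma cocycle_form_pl_zero_iff:
  "(\<forall>g vs. cocycle_form (pl g) vs = 0) \<longleftrightarrow> (\<forall>u. cocycle_form (\<xi> u) = (\<lambda>vs. 0))" (is "?L \<longleftrightarrow> ?R")
proof
  assume L: ?L
  have "cocycle_form (\<xi> u) vs = 0" for u vs
  proof -
    have "((\<lambda>z. cocycle_form (pl (param1 z)) vs) has_derivative (\<lambda>u. cocycle_form (\<xi> u) vs)) (at x1)"
      by (rule has_derivative_linear_comp[OF linear_cocycle_form pl_has_derivative_one])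
    then have "((\<lambda>z. 0) has_derivative (\<lambda>u. cocycle_form (\<xi> u) vs)) (at x1)" using L by simp
    from fun_cong[OF has_derivative_unique[OF this has_derivative_const], of u] show ?thesis .
  qed
  then show ?R by (simp add: fun_eq_iff)
next
  assume R: ?R
  then obtain U where U: "open U" "\<one> \<in> U" and Z: "\<And>h vs. h \<in> U \<Longrightarrow> cocycle_form (pl h) vs = 0"
    and U\<mu>: "\<And>h vs. h \<in> U \<Longrightarrow> \<mu>1 (map (Ad_inv h) vs) = \<mu>1 vs"
    using cocycle_form_pl_near_one by metis
  \<comment> \<open>Passing from \<open>g\<close> to \<open>g \<otimes> h\<close> with
    \<open>h\<close> in \<open>U\<close> applies \<open>Ad_inv h\<close> to the bivector, which may
    change the value of the cocycle form but not whether it vanishes. Hence the predicate, rather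
    than the value, is shown to be locally constant.\<close>
  define z where "z g \<longleftrightarrow> (\<forall>vs. cocycle_form (pl g) vs = 0)" for g
  have mult: "z (g \<otimes> h) \<longleftrightarrow> z g" if "h \<in> U" for g h
  proof -
    have "cocycle_form (pl (g \<otimes> h)) vs = cocycle_form (push_bivector (Ad_inv h) (pl g)) vs" for vs
      by (simp add: pl_mult linear_add[OF linear_cocycle_form] Z[OF that])
    then show ?thesis using cocycle_form_push_zero_iff[OF U\<mu>[OF that], of "pl g"] by (simp add: z_def)
  qed
  have "\<forall>\<^sub>F k in at g. z g = z k" for g
  proof -
    have "\<forall>\<^sub>F u in nhds (inv g \<otimes> g). u \<in> U" using eventually_nhds_open[OF U] by simp
    with isCont_mult_left have "\<forall>\<^sub>F k in nhds g. inv g \<otimes> k \<in> U" by (rule isCont_eventually)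
    then have "\<forall>\<^sub>F k in nhds g. z g = z k"
    proof (rule eventually_mono)
      fix k assume "inv g \<otimes> k \<in> U"
      then have "z (g \<otimes> (inv g \<otimes> k)) \<longleftrightarrow> z g" by (rule mult)
      moreover have "g \<otimes> (inv g \<otimes> k) = k" by (simp add: m_assoc[symmetric])
      ultimately show "z g = z k" by simp
    qed
    then show ?thesis by (simp add: eventually_at_filter eventually_mono)
  qed
  then have "z \<one> = z g" for g
    by (intro connected_local_const[OF connected_group]) auto
  moreover have "z \<one>" using Z[OF U(2)] by (simp add: z_def)
  ultimately show ?L by (simp add: z_def)
qed

lemma main_equivalence:
  "ext_d A i\<pi>\<mu> = (\<lambda>g vs. 0) \<longleftrightarrow>
    unimodular_lie_algebra dbr \<and> (\<forall>u. dual_cocycle br (contract (\<xi> u) \<mu>1) = (\<lambda>vs. 0))"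
  unfolding ext_d_zero_iff modular_term_zero_iff cocycle_form_pl_zero_iff ..

end

theorem theorem1p2:
  fixes A :: "('g::{t2_space, second_countable_topology}, 'n::finite) chart set"
    and G :: "'g monoid"
    and P :: "'g \<Rightarrow> real^'n^'n"
    and \<mu> :: "'g \<Rightarrow> (real^'n) list \<Rightarrow> real"
  assumes "poisson_lie_group A G P"
    and "connected (UNIV :: 'g set)"
    and "unimodular_group A G"
    and "volume_form A \<mu>"
    and "left_invariant_form A G \<mu>"
  shows "ext_d A (\<lambda>g. contract (P g) (\<mu> g)) = (\<lambda>g vs. 0) \<longleftrightarrow>
    unimodular_lie_algebra (dual_bracket A G P) \<and>
    (\<forall>u. dual_cocycle (lie_bracket A G) (contract (cocycle A G P u) (\<mu> \<one>\<^bsub>G\<^esub>)) = (\<lambda>vs. 0))"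
proof -
  interpret poisson_lie_volume A G P \<mu>
    using assms by unfold_locales (simp_all add: poisson_lie_group_def)
  show ?thesis by (rule main_equivalence)
qed

end
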